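(* Let $T$ be a standard tableau with $n$ boxes. The following are equivalent descriptions of (i.e. define the same subspace as) the left Gelfand-Tsetlin module $V_T=V_{\bullet,T}\subseteq\mathbb{C}[S_n]$: (1) the left $S_n$-module generated by following the induction path corresponding to $T$; (2) the weight space corresponding to $T$ for $X_1,\ldots,X_n$ acting by right multiplication, i.e. $\{v\in\mathbb{C}[S_n]: v\cdot X_i=\mathrm{cont}(b(T,i))\,v \text{ for } i=1,\ldots,n\}$; (3) the image $\mathbb{C}[S_n]\cdot p_T(X_1,\ldots,X_n)$ of $p_T(X_1,\ldots,X_n)$ acting as a right multiplication operator on $\mathbb{C}[S_n]$. The corresponding description of $V_{T,\bullet}$ holds with left and right, and induction and restriction, switched: $V_{T,\bullet}$ equals the right $S_n$-module obtained by following the induction path $T$ for the right action, equals $\{v: X_i\cdot v=\mathrm{cont}(b(T,i))\,v\ \forall i\}$, and equals $p_T(X_1,\ldots,X_n)\cdot\mathbb{C}[S_n]$.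
   Context: Permutations compose as functions; $S_k\subseteq S_n$ is the subgroup fixing $k+1,\ldots,n$. $X_k=(1\ k)+\cdots+(k-1\ k)\in\mathbb{C}[S_n]$, $X_1=0$. The content of a box of a Young diagram (rows counted from the top) is (column index) $-$ (row index). A standard tableau of shape $\lambda\vdash n$ is a filling of the boxes of $\lambda$ by $1,\ldots,n$, each used once, increasing along rows and down columns. $b(T,i)$ is the box of $T$ containing $i$, $T^{(i)}$ the subtableau formed by $1,\ldots,i$. For a partition $\lambda$ of $k$, $V_\lambda$ denotes the irreducible complex $S_k$-module (Young's seminormal form) having a basis $\{v_T\}$ indexed by standard tableaux $T$ of shape $\lambda$ with $X_i\cdot v_T=\mathrm{cont}(b(T,i))\,v_T$ for all $i$. A right $S_k$-module has type $\lambda$ if it becomes isomorphic to $V_\lambda$ when regarded as a left module via $\sigma\cdot v=v\sigma^{-1}$. Induction path (left action). Given $T$, let $V_{T^{(1)}}=\mathbb{C}[S_1]$ and for $2\le k\le n$ let $V_{T^{(k)}}\subseteq\mathbb{C}[S_k]$ be the unique irreducible left $S_k$-submodule of $\mathrm{Ind}_{S_{k-1}}^{S_k}V_{T^{(k-1)}}=\mathbb{C}[S_k]\cdot V_{T^{(k-1)}}$ isomorphic to $V_{\mathrm{shape}(T^{(k)})}$ (the induced module is multiplicity-free). Then $V_T=V_{\bullet,T}:=V_{T^{(n)}}$. For the right action, exchange left and right throughout: at step $k$ take the unique irreducible right $S_k$-submodule of (previous module)$\,\cdot\,\mathbb{C}[S_k]$ of type $\mathrm{shape}(T^{(k)})$.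 For $T'$ of the same shape as $T$, $v_{T',T}$ is the vector (unique up to nonzero scalar) in $V_T$ with $X_i\cdot v_{T',T}=\mathrm{cont}(b(T',i))\,v_{T',T}$ for all $i$. $V_{T,\bullet}$ is the span of the vectors $v_{T,T'}$, $T'$ ranging over standard tableaux of the same shape as $T$. Projectors. An outer corner of a Young diagram is a location where one box can be added to give a Young diagram. For $2\le k\le n$ let $b=b(T,k)$ and let $b_1,\ldots,b_j$ be the outer corners of the shape of $T^{(k-1)}$ other than $b$. Put $p_{T^{(k-1)},T^{(k)}}(X_k)=\prod_{i=1}^j\frac{X_k-\mathrm{cont}(b_i)}{\mathrm{cont}(b)-\mathrm{cont}(b_i)}$ and $p_T(X_1,\ldots,X_n)=\prod_{k=2}^n p_{T^{(k-1)},T^{(k)}}(X_k)\in\mathbb{C}[S_n]$. *)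

theory Defs
  imports
    Complex_Main
    "HOL-Combinatorics.Perm"
    "HOL-Library.Poly_Mapping"
    "HOL-Computational_Algebra.Polynomial"
begin

section \<open>The group algebra\<close>

text \<open>
  The convolution product of \<open>Poly_Mapping\<close> is indexed by additive monoids. The wrapper
  below reads the composition of permutations as an addition, so that
  \<open>'a additive \<Rightarrow>\<^sub>0 complex\<close> is the complex monoid algebra of the (in general
  non-commutative) monoid \<open>'a\<close>.
\<close>

datatype 'a additive = Additive (of_additive: 'a)

instantiation additive :: (monoid_mult) monoid_add
begin

definition zero_additive :: "'a additive" where
  "0 = Additive 1"

definition plus_additive :: "'a additive \<Rightarrow> 'a additive \<Rightarrow> 'a additive" where
  "x + y = Additive (of_additive x * of_additive y)"

instance
  by standard (simp_all add: zero_additive_def plus_additive_def mult.assoc)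

end

type_synonym galg = "nat perm additive \<Rightarrow>\<^sub>0 complex"

definition cscale :: "complex \<Rightarrow> ('b \<Rightarrow>\<^sub>0 complex) \<Rightarrow> ('b \<Rightarrow>\<^sub>0 complex)" where
  "cscale c v = Poly_Mapping.map ((*) c) v"

lemma lookup_cscale: "Poly_Mapping.lookup (cscale c v) x = c * Poly_Mapping.lookup v x"
  unfolding cscale_def by (simp add: Poly_Mapping.map.rep_eq when_def)

interpretation cvec: vector_space "cscale :: complex \<Rightarrow> ('b \<Rightarrow>\<^sub>0 complex) \<Rightarrow> _"
  by standard (auto intro!: poly_mapping_eqI simp: lookup_cscale lookup_add algebra_simps)

definition Sym :: "nat \<Rightarrow> nat perm set" where
  "Sym k = {\<sigma>. affected \<sigma> \<subseteq> {1..k}}"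

definition gelem :: "nat perm \<Rightarrow> galg" where
  "gelem \<sigma> = Poly_Mapping.single (Additive \<sigma>) 1"

text \<open>All the algebras \<open>\<complex>[S\<^sub>k]\<close> live inside the one type \<open>galg\<close>, so that
  \<open>\<complex>[S\<^sub>k] \<subseteq> \<complex>[S\<^sub>n]\<close> for \<open>k \<le> n\<close> is a literal inclusion.\<close>

definition CS :: "nat \<Rightarrow> galg set" where
  "CS k = {v. Poly_Mapping.keys v \<subseteq> Additive ` Sym k}"

definition JM :: "nat \<Rightarrow> galg" where
  "JM k = (\<Sum>j\<in>{1..<k}. gelem (Perm.swap j k))"


section \<open>Young diagrams and standard tableaux\<close>

text \<open>A box is a pair (row, column), both counted from 0.\<close>

type_synonym box = "nat \<times> nat"

fun cont :: "box \<Rightarrow> int" where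
  "cont (r, c) = int c - int r"

definition young_diagram :: "box set \<Rightarrow> bool" where
  "young_diagram D \<longleftrightarrow> finite D \<and> (\<forall>r c r' c'. (r, c) \<in> D \<and> r' \<le> r \<and> c' \<le> c \<longrightarrow> (r', c') \<in> D)"

definition outer_corners :: "box set \<Rightarrow> box set" where
  "outer_corners D = {b. b \<notin> D \<and> young_diagram (insert b D)}"

text \<open>A tableau assigns to each box its entry; the value 0 means that the box does not belong
  to the tableau. So a tableau determines its shape, and equal tableaux are equal functions.\<close>

type_synonym tableau = "box \<Rightarrow> nat"

definition shape :: "tableau \<Rightarrow> box set" where
  "shape T = {b. T b \<noteq> 0}"

definition standard_tableau :: "nat \<Rightarrow> tableau \<Rightarrow> bool" where
  "standard_tableau n T \<longleftrightarrow>
     young_diagram (shape T) \<and> bij_betw T (shape T) {1..n} \<and>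
     (\<forall>r c c'. (r, c) \<in> shape T \<and> (r, c') \<in> shape T \<and> c < c' \<longrightarrow> T (r, c) < T (r, c')) \<and>
     (\<forall>r r' c. (r, c) \<in> shape T \<and> (r', c) \<in> shape T \<and> r < r' \<longrightarrow> T (r, c) < T (r', c))"

definition SYT :: "box set \<Rightarrow> tableau set" where
  "SYT \<mu> = {T. standard_tableau (card \<mu>) T \<and> shape T = \<mu>}"

definition box_of :: "tableau \<Rightarrow> nat \<Rightarrow> box" where
  "box_of T i = (THE b. b \<in> shape T \<and> T b = i)"

definition subtableau :: "tableau \<Rightarrow> nat \<Rightarrow> tableau" where
  "subtableau T k = (\<lambda>b. if T b \<le> k then T b else 0)"


section \<open>Modules over symmetric groups\<close>

definition linear_on :: "('a \<Rightarrow>\<^sub>0 complex) set \<Rightarrow> (('a \<Rightarrow>\<^sub>0 complex) \<Rightarrow> ('b \<Rightarrow>\<^sub>0 complex)) \<Rightarrow> bool" where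
  "linear_on M f \<longleftrightarrow> (\<forall>u\<in>M. \<forall>v\<in>M. f (u + v) = f u + f v) \<and> (\<forall>c. \<forall>v\<in>M. f (cscale c v) = cscale c (f v))"

text \<open>\<open>S_module k \<rho> M\<close>: the subspace \<open>M\<close> is a left \<open>S\<^sub>k\<close>-module under the
  action \<open>\<sigma>\<cdot>v = \<rho> \<sigma> v\<close>.\<close>

definition S_module :: "nat \<Rightarrow> (nat perm \<Rightarrow> ('b \<Rightarrow>\<^sub>0 complex) \<Rightarrow> ('b \<Rightarrow>\<^sub>0 complex)) \<Rightarrow>
    ('b \<Rightarrow>\<^sub>0 complex) set \<Rightarrow> bool" where
  "S_module k \<rho> M \<longleftrightarrow>
     cvec.subspace M \<and>
     (\<forall>\<sigma>\<in>Sym k. \<rho> \<sigma> ` M \<subseteq> M \<and> linear_on M (\<rho> \<sigma>)) \<and>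
     (\<forall>v\<in>M. \<rho> 1 v = v) \<and>
     (\<forall>\<sigma>\<in>Sym k. \<forall>\<tau>\<in>Sym k. \<forall>v\<in>M. \<rho> (\<sigma> * \<tau>) v = \<rho> \<sigma> (\<rho> \<tau> v))"

definition irreducible_S_module :: "nat \<Rightarrow> (nat perm \<Rightarrow> ('b \<Rightarrow>\<^sub>0 complex) \<Rightarrow> ('b \<Rightarrow>\<^sub>0 complex)) \<Rightarrow>
    ('b \<Rightarrow>\<^sub>0 complex) set \<Rightarrow> bool" where
  "irreducible_S_module k \<rho> M \<longleftrightarrow>
     S_module k \<rho> M \<and> M \<noteq> {0} \<and> (\<forall>N. N \<subseteq> M \<and> S_module k \<rho> N \<longrightarrow> N = {0} \<or> N = M)"

definition S_isomorphic :: "nat \<Rightarrow>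
    (nat perm \<Rightarrow> ('a \<Rightarrow>\<^sub>0 complex) \<Rightarrow> ('a \<Rightarrow>\<^sub>0 complex)) \<Rightarrow> ('a \<Rightarrow>\<^sub>0 complex) set \<Rightarrow>
    (nat perm \<Rightarrow> ('b \<Rightarrow>\<^sub>0 complex) \<Rightarrow> ('b \<Rightarrow>\<^sub>0 complex)) \<Rightarrow> ('b \<Rightarrow>\<^sub>0 complex) set \<Rightarrow> bool" where
  "S_isomorphic k \<rho> M \<rho>' M' \<longleftrightarrow>
     (\<exists>\<phi>. bij_betw \<phi> M M' \<and> linear_on M \<phi> \<and> (\<forall>\<sigma>\<in>Sym k. \<forall>v\<in>M. \<phi> (\<rho> \<sigma> v) = \<rho>' \<sigma> (\<phi> v)))"

text \<open>The space with basis \<open>v\<^sub>T\<close>, where \<open>T\<close> ranges over the standard tableaux of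
  shape \<open>\<mu>\<close>.\<close>

definition young_vec :: "tableau \<Rightarrow> (tableau \<Rightarrow>\<^sub>0 complex)" where
  "young_vec T = Poly_Mapping.single T 1"

definition young_space :: "box set \<Rightarrow> (tableau \<Rightarrow>\<^sub>0 complex) set" where
  "young_space \<mu> = cvec.span (young_vec ` SYT \<mu>)"

text \<open>\<open>\<rho>\<close> makes \<open>young_space \<mu>\<close> a copy of \<open>V\<^sub>\<mu>\<close>: an irreducible
  \<open>S\<^sub>k\<close>-module with \<open>X\<^sub>i\<cdot>v\<^sub>T = cont(b(T,i)) v\<^sub>T\<close>. Such a \<open>\<rho>\<close> is not
  unique (the \<open>v\<^sub>T\<close> can be rescaled), but the isomorphism class of the module is.\<close>

definition young_module :: "box set \<Rightarrow> (nat perm \<Rightarrow> (tableau \<Rightarrow>\<^sub>0 complex) \<Rightarrow> (tableau \<Rightarrow>\<^sub>0 complex)) \<Rightarrow> bool" where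
  "young_module \<mu> \<rho> \<longleftrightarrow>
     irreducible_S_module (card \<mu>) \<rho> (young_space \<mu>) \<and>
     (\<forall>T\<in>SYT \<mu>. \<forall>i\<in>{1..card \<mu>}.
        (\<Sum>j\<in>{1..<i}. \<rho> (Perm.swap j i) (young_vec T)) =
          cscale (of_int (cont (box_of T i))) (young_vec T))"

definition has_type :: "box set \<Rightarrow> (nat perm \<Rightarrow> ('b \<Rightarrow>\<^sub>0 complex) \<Rightarrow> ('b \<Rightarrow>\<^sub>0 complex)) \<Rightarrow>
    ('b \<Rightarrow>\<^sub>0 complex) set \<Rightarrow> bool" where
  "has_type \<mu> \<rho> M \<longleftrightarrow>
     (\<exists>\<rho>'. young_module \<mu> \<rho>' \<and> S_isomorphic (card \<mu>) \<rho> M \<rho>' (young_space \<mu>))"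


section \<open>Gelfand--Tsetlin modules\<close>

definition left_act :: "nat perm \<Rightarrow> galg \<Rightarrow> galg" where
  "left_act \<sigma> v = gelem \<sigma> * v"

text \<open>A right module is treated as the left module with \<open>\<sigma>\<cdot>v = v\<sigma>\<^sup>-\<^sup>1\<close>;
  submodules are the same for both structures.\<close>

definition right_act :: "nat perm \<Rightarrow> galg \<Rightarrow> galg" where
  "right_act \<sigma> v = v * gelem (inverse \<sigma>)"

definition left_induced :: "nat \<Rightarrow> galg set \<Rightarrow> galg set" where
  "left_induced k V = cvec.span {a * v | a v. a \<in> CS k \<and> v \<in> V}"

definition right_induced :: "nat \<Rightarrow> galg set \<Rightarrow> galg set" where
  "right_induced k V = cvec.span {v * a | a v. a \<in> CS k \<and> v \<in> V}"

text \<open>The induction paths start at \<open>k = 1\<close>; the clause for 0 only serves the empty tableau,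
  with \<open>\<complex>[S\<^sub>0] = \<complex>\<close>.\<close>

fun left_path :: "tableau \<Rightarrow> nat \<Rightarrow> galg set" where
  "left_path T 0 = CS 0"
| "left_path T (Suc 0) = CS 1"
| "left_path T (Suc (Suc k)) =
     (THE W. W \<subseteq> left_induced (Suc (Suc k)) (left_path T (Suc k)) \<and>
             irreducible_S_module (Suc (Suc k)) left_act W \<and>
             has_type (shape (subtableau T (Suc (Suc k)))) left_act W)"

fun right_path :: "tableau \<Rightarrow> nat \<Rightarrow> galg set" where
  "right_path T 0 = CS 0"
| "right_path T (Suc 0) = CS 1"
| "right_path T (Suc (Suc k)) =
     (THE W. W \<subseteq> right_induced (Suc (Suc k)) (right_path T (Suc k)) \<and>
             irreducible_S_module (Suc (Suc k)) right_act W \<and>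
             has_type (shape (subtableau T (Suc (Suc k)))) right_act W)"

text \<open>\<open>V\<^sub>T = V\<^sub>\<bullet>\<^sub>,\<^sub>T\<close>\<close>

definition left_GT :: "tableau \<Rightarrow> galg set" where
  "left_GT T = left_path T (card (shape T))"

text \<open>\<open>v\<^bsub>T',T\<^esub>\<close>, which is determined only up to a nonzero scalar, so a choice is made.\<close>

definition GT_vec :: "tableau \<Rightarrow> tableau \<Rightarrow> galg" where
  "GT_vec T' T = (SOME v. v \<in> left_GT T \<and> v \<noteq> 0 \<and>
     (\<forall>i\<in>{1..card (shape T)}. JM i * v = cscale (of_int (cont (box_of T' i))) v))"

text \<open>\<open>V\<^sub>T\<^sub>,\<^sub>\<bullet>\<close>\<close>

definition right_GT :: "tableau \<Rightarrow> galg set" where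
  "right_GT T = cvec.span (GT_vec T ` SYT (shape T))"


section \<open>Projectors\<close>

definition poly_at :: "complex poly \<Rightarrow> galg \<Rightarrow> galg" where
  "poly_at p x = (\<Sum>i\<le>Polynomial.degree p. cscale (poly.coeff p i) (x ^ i))"

definition step_poly :: "tableau \<Rightarrow> nat \<Rightarrow> complex poly" where
  "step_poly T k =
     (\<Prod>b'\<in>outer_corners (shape (subtableau T (k - 1))) - {box_of T k}.
        smult (1 / of_int (cont (box_of T k) - cont b')) [:- of_int (cont b'), 1:])"

text \<open>The factors commute; they are multiplied in the order of increasing \<open>k\<close>.\<close>

definition projector :: "tableau \<Rightarrow> galg" where
  "projector T = prod_list (map (\<lambda>k. poly_at (step_poly T k) (JM k)) [2..<card (shape T) + 1])"

end

theory Submission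
  imports Defs "HOL-Combinatorics.Permutations"
begin

text \<open>
  By induction on \<open>n\<close>, the projectors of the standard tableaux with \<open>n\<close> boxes are orthogonal
  self-adjoint idempotents \<open>p\<^sub>T\<close> with sum 1 and with \<open>p\<^sub>T \<complex>[S\<^sub>n] p\<^sub>T = \<complex> p\<^sub>T\<close>; the blocks
  \<open>p\<^sub>S \<complex>[S\<^sub>n] p\<^sub>T\<close> are lines if \<open>S\<close> and \<open>T\<close> have the same shape and vanish otherwise, because
  the symmetric functions of the \<open>X\<^sub>i\<close> are central. That no line is missing follows by counting
  dimensions, the number of pairs of tableaux of the same shape being at most \<open>n!\<close>.

  The step from \<open>n\<close> to \<open>n + 1\<close> needs that \<open>X = X\<^bsub>n+1\<^esub>\<close> is annihilated on \<open>p\<^sub>T\<close> by the polynomial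
  whose roots are the contents of the outer corners. If \<open>T\<close> arises from \<open>T'\<close> by adding a box of
  content \<open>c\<close>, an intertwiner between \<open>X\<^sub>n\<close> and \<open>X\<close> shows that \<open>X\<close> is annihilated by
  the polynomial of \<open>T'\<close> times \<open>(X - c - 1) (X - c + 1)\<close>. The factor \<open>X - c\<close> can be dropped, and so
  can \<open>X - c \<mp> 1\<close> unless there is an outer corner of that content: otherwise some
  tableau of the same shape would have the consecutive weights \<open>c \<plusminus> 1, c, c \<plusminus> 1\<close>, against the
  braid relation.

  The left ideal of \<open>p\<^sub>T\<close> is then irreducible with a basis of weight vectors, and any submodule of
  the induced module of the type of \<open>T\<close> contains a vector of left weight \<open>T\<close>, which must lie in that
  ideal. The statements for right modules follow by inverting permutations.
\<close>

section \<open>The group algebra of the finitary symmetric group\<close>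

text \<open>Irreducible modules, their dimensions and the branching rule are not presupposed:
  \<open>has_type\<close> refers to a module that must be shown to exist, so the representation
  theory is extracted from the projectors. The obstacle is that a product of interpolation
  polynomials is idempotent only if each \<open>JM (Suc n)\<close> satisfies the matching polynomial
  identity on the preceding projectors. That identity needs the nonvanishing of the blocks at level
  \<open>n\<close>, and level \<open>Suc n\<close> needs the identity, so the two statements climb
  together. In place of complete reducibility stands the positivity of the identity coefficient of
  \<open>star y * y\<close>: since contents are real, it excludes Jordan blocks of the Jucys-Murphy
  elements, and it makes a nonzero element of a block invertible, with inverse proportional to its
  star. The number of pairs of tableaux is needed only as an upper bound, because the blocks span
  the algebra and thereby give the reverse inequality.\<close>

lemma cscale_conv_mult: "cscale c v = Poly_Mapping.single 0 c * v"
  unfolding cscale_def by (rule mult_map_scale_conv_mult)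

lemma cscale_mult_left: "cscale c (a :: galg) * b = cscale c (a * b)"
  by (simp add: cscale_conv_mult mult.assoc)

lemma single_zero_mult_commute:
  "Poly_Mapping.single 0 c * Poly_Mapping.single x d = Poly_Mapping.single x d * Poly_Mapping.single 0 (c::complex)"
  by (simp add: mult_single mult.commute)

lemma galg_expand:
  "(\<Sum>x\<in>Poly_Mapping.keys a. cscale (Poly_Mapping.lookup a x) (gelem (of_additive x))) = a"
proof (rule poly_mapping_eqI)
  fix y
  have "Poly_Mapping.lookup (\<Sum>x\<in>Poly_Mapping.keys a. cscale (Poly_Mapping.lookup a x) (gelem (of_additive x))) y
     = (\<Sum>x\<in>Poly_Mapping.keys a. Poly_Mapping.lookup a x * (if x = y then 1 else 0))"
    by (simp add: lookup_sum lookup_cscale gelem_def lookup_single when_def)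
  also have "\<dots> = (\<Sum>x\<in>Poly_Mapping.keys a. if x = y then Poly_Mapping.lookup a x else 0)"
    by (rule sum.cong) auto
  also have "\<dots> = Poly_Mapping.lookup a y"
    by (simp add: sum.delta' in_keys_iff)
  finally show "Poly_Mapping.lookup (\<Sum>x\<in>Poly_Mapping.keys a. cscale (Poly_Mapping.lookup a x) (gelem (of_additive x))) y
     = Poly_Mapping.lookup a y" .
qed

lemma galg_induct [case_names zero gelem add]:
  fixes a :: galg
  assumes "P 0" "\<And>c \<sigma>. P (cscale c (gelem \<sigma>))" "\<And>a b. P a \<Longrightarrow> P b \<Longrightarrow> P (a + b)"
  shows "P a"
proof -
  have "P (\<Sum>x\<in>K. cscale (Poly_Mapping.lookup a x) (gelem (of_additive x)))" if "finite K" for K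
    using that by (induction K) (auto intro: assms)
  from this[of "Poly_Mapping.keys a"] show ?thesis
    by (simp add: galg_expand)
qed

text \<open>Scalars act as left multiplication by \<open>Poly_Mapping.single 0 c\<close>, so on this
  side the claim is that these elements are central; the product being noncommutative, this is
  checked on multiples of group elements.\<close>

lemma cscale_mult_right: "a * cscale c (b :: galg) = cscale c (a * b)"
proof -
  have "a * Poly_Mapping.single 0 c = Poly_Mapping.single 0 c * a"
    by (induction a rule: galg_induct)
       (simp_all add: distrib_left distrib_right gelem_def cscale_def single_zero_mult_commute mult_1_right)
  then show ?thesis
    by (simp add: cscale_conv_mult flip: mult.assoc)
qed

lemmas cscale_mult [simp] = cscale_mult_left cscale_mult_right

lemma cscale_simps [simp]:
  "cscale 1 v = v" "cscale 0 v = 0" "cscale c 0 = 0"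
  "cscale a (cscale b v) = cscale (a * b) v" "cscale c v = 0 \<longleftrightarrow> c = 0 \<or> v = 0"
  by (simp_all add: cvec.scale_eq_0_iff)

lemma gelem_1 [simp]: "gelem 1 = 1"
  by (simp add: gelem_def flip: zero_additive_def)

lemma gelem_mult: "gelem (\<sigma> * \<tau>) = gelem \<sigma> * gelem \<tau>"
  by (simp add: gelem_def mult_single plus_additive_def)

lemma gelem_eq_iff [simp]: "gelem \<sigma> = gelem \<tau> \<longleftrightarrow> \<sigma> = \<tau>"
  by (auto simp: gelem_def dest!: injD[OF inj_single] arg_cong[of _ _ Poly_Mapping.keys])

lemma lookup_gelem: "Poly_Mapping.lookup (gelem \<sigma>) x = (if x = Additive \<sigma> then 1 else 0)"
  by (simp add: gelem_def lookup_single when_def)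

lemma keys_gelem [simp]: "Poly_Mapping.keys (gelem \<sigma>) = {Additive \<sigma>}"
  by (simp add: gelem_def)

lemma gelem_in_CS [simp]: "gelem \<sigma> \<in> CS n \<longleftrightarrow> \<sigma> \<in> Sym n"
  by (auto simp: CS_def)

lemma subspace_keys: "cvec.subspace {v. Poly_Mapping.keys v \<subseteq> A}"
proof (rule cvec.subspaceI)
  show "x + y \<in> {v. Poly_Mapping.keys v \<subseteq> A}"
    if "x \<in> {v. Poly_Mapping.keys v \<subseteq> A}" "y \<in> {v. Poly_Mapping.keys v \<subseteq> A}" for x y
    using that Poly_Mapping.keys_add[of x y] by auto
  show "cscale c x \<in> {v. Poly_Mapping.keys v \<subseteq> A}" if "x \<in> {v. Poly_Mapping.keys v \<subseteq> A}" for c x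
    using that by (auto simp: in_keys_iff lookup_cscale)
qed simp

lemma subspace_CS: "cvec.subspace (CS n)"
  unfolding CS_def by (rule subspace_keys)

lemmas CS_0 [simp, intro] = cvec.subspace_0[OF subspace_CS]
  and CS_add [intro] = cvec.subspace_add[OF subspace_CS]
  and CS_diff [intro] = cvec.subspace_diff[OF subspace_CS]
  and CS_cscale [intro] = cvec.subspace_scale[OF subspace_CS]
  and CS_sum [intro] = cvec.subspace_sum[OF subspace_CS]

lemma CS_induct [consumes 1, case_names zero gelem add]:
  assumes "a \<in> CS n" "P 0" "\<And>c \<sigma>. \<sigma> \<in> Sym n \<Longrightarrow> P (cscale c (gelem \<sigma>))"
    "\<And>a b. a \<in> CS n \<Longrightarrow> b \<in> CS n \<Longrightarrow> P a \<Longrightarrow> P b \<Longrightarrow> P (a + b)"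
  shows "P a"
proof -
  have "(\<Sum>x\<in>K. cscale (Poly_Mapping.lookup a x) (gelem (of_additive x))) \<in> CS n \<and>
      P (\<Sum>x\<in>K. cscale (Poly_Mapping.lookup a x) (gelem (of_additive x)))"
    if "finite K" "K \<subseteq> Additive ` Sym n" for K
    using that
  proof (induction K)
    case (insert x F)
    then have "of_additive x \<in> Sym n" by auto
    then have "cscale (Poly_Mapping.lookup a x) (gelem (of_additive x)) \<in> CS n"
      "P (cscale (Poly_Mapping.lookup a x) (gelem (of_additive x)))"
      by (auto intro: assms)
    with insert show ?case by (auto intro: assms(4))
  qed (auto intro: assms)
  from this[of "Poly_Mapping.keys a"] show ?thesis
    using assms(1) by (simp add: galg_expand CS_def)
qed

lemma CS_eq_span: "CS n = cvec.span (gelem ` Sym n)"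
proof
  show "CS n \<subseteq> cvec.span (gelem ` Sym n)"
  proof
    fix a assume "a \<in> CS n"
    then show "a \<in> cvec.span (gelem ` Sym n)"
      by (induction rule: CS_induct)
         (auto intro: cvec.span_zero cvec.span_add cvec.span_scale cvec.span_base)
  qed
  show "cvec.span (gelem ` Sym n) \<subseteq> CS n"
    by (rule cvec.span_minimal[OF _ subspace_CS]) auto
qed

lemma Sym_1 [simp]: "1 \<in> Sym n"
  by (simp add: Sym_def)

lemma Sym_mult [intro]: "\<sigma> \<in> Sym n \<Longrightarrow> \<tau> \<in> Sym n \<Longrightarrow> \<sigma> * \<tau> \<in> Sym n"
  using affected_times[of \<sigma> \<tau>] unfolding Sym_def mem_Collect_eq by blast

lemma Sym_inverse [simp]: "inverse \<sigma> \<in> Sym n \<longleftrightarrow> \<sigma> \<in> Sym n"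
  by (simp add: Sym_def)

lemma Sym_mono: "m \<le> n \<Longrightarrow> Sym m \<subseteq> Sym n"
  by (auto simp: Sym_def)

lemma Sym_apply_fixed: "\<sigma> \<in> Sym n \<Longrightarrow> j \<notin> {1..n} \<Longrightarrow> Perm.apply \<sigma> j = j"
  by (auto simp: Sym_def in_affected)

lemma Sym_apply_in: "\<sigma> \<in> Sym n \<Longrightarrow> j \<in> {1..n} \<Longrightarrow> Perm.apply \<sigma> j \<in> {1..n}"
  by (metis Sym_def apply_affected in_affected mem_Collect_eq subset_iff)

lemma swap_in_Sym: "i \<in> {1..n} \<Longrightarrow> j \<in> {1..n} \<Longrightarrow> Perm.swap i j \<in> Sym n"
  by (cases "i = j") (auto simp: Sym_def affected_swap)

lemma CS_mono: "m \<le> n \<Longrightarrow> CS m \<subseteq> CS n"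
  using Sym_mono[of m n] unfolding CS_def by blast

lemma CS_mono': "a \<in> CS m \<Longrightarrow> m \<le> n \<Longrightarrow> a \<in> CS n"
  using CS_mono by blast

lemma CS_1 [simp, intro]: "1 \<in> CS n"
  using gelem_in_CS[of 1 n] by simp

lemma CS_mult [intro]:
  assumes "a \<in> CS n" "b \<in> CS n"
  shows "a * b \<in> CS n"
  using assms(1)
proof (induction rule: CS_induct)
  case (gelem c \<sigma>)
  from assms(2) have "gelem \<sigma> * b \<in> CS n"
  proof (induction rule: CS_induct)
    case (gelem c' \<tau>)
    with \<open>\<sigma> \<in> Sym n\<close> have "gelem (\<sigma> * \<tau>) \<in> CS n" by auto
    then show ?case by (auto simp: gelem_mult)
  qed (auto simp: distrib_left)
  then show ?case by auto
qed (auto simp: distrib_right)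

lemma CS_power [intro]: "a \<in> CS n \<Longrightarrow> a ^ k \<in> CS n"
  by (induction k) auto

text \<open>A permutation cannot move exactly one point, so \<open>Sym 1\<close> is as trivial as
  \<open>Sym 0\<close>.\<close>

lemma Sym_le_1: "n \<le> 1 \<Longrightarrow> Sym n = {1}"
proof -
  have "affected \<sigma> = {}" if "affected \<sigma> \<subseteq> {1::nat}" for \<sigma>
    using that card_affected_not_one[of \<sigma>] by (cases "affected \<sigma> = {}") (auto dest: subset_singletonD)
  then show "n \<le> 1 \<Longrightarrow> Sym n = {1}"
    by (cases n) (auto simp: Sym_def)
qed

lemma CS_le_1: "n \<le> 1 \<Longrightarrow> CS n = range (\<lambda>c. cscale c 1)"
  by (simp add: CS_eq_span Sym_le_1 cvec.span_singleton)

lemma apply_image_Sym: "Perm.apply ` Sym n = {p. p permutes {1..n}}"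
proof (intro equalityI subsetI)
  fix p assume "p \<in> Perm.apply ` Sym n"
  then obtain \<sigma> where \<sigma>: "p = Perm.apply \<sigma>" "\<sigma> \<in> Sym n" by blast
  then show "p \<in> {p. p permutes {1..n}}"
    using bij_apply[of \<sigma>] Sym_apply_fixed[OF \<sigma>(2)] by (auto simp: bij_iff permutes_def)
next
  fix p assume "p \<in> {p. p permutes {1..n}}"
  then have p: "p permutes {1..n}" by simp
  then have "{a. p a \<noteq> a} \<subseteq> {1..n}" by (auto simp: permutes_def)
  then have "bij p \<and> finite {a. p a \<noteq> a}"
    using p by (auto intro: permutes_bij finite_subset)
  then have "Perm.apply (Perm p) = p" by (simp add: Perm_inverse)
  moreover from this have "Perm p \<in> Sym n"
    using \<open>{a. p a \<noteq> a} \<subseteq> {1..n}\<close> by (auto simp: Sym_def in_affected)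
  ultimately show "p \<in> Perm.apply ` Sym n" by (metis imageI)
qed

lemma card_Sym: "card (Sym n) = fact n"
proof -
  have "inj_on Perm.apply (Sym n)"
    by (simp add: apply_inject inj_on_def)
  then have "card (Sym n) = card (Perm.apply ` Sym n)"
    by (simp add: card_image)
  then show ?thesis
    by (simp add: apply_image_Sym card_permutations)
qed

lemma independent_gelem: "cvec.independent (range gelem)"
proof
  assume "cvec.dependent (range gelem)"
  then obtain S u where S: "finite S" "S \<subseteq> range gelem" "(\<Sum>v\<in>S. cscale (u v) v) = 0" "\<exists>v\<in>S. u v \<noteq> 0"
    by (auto simp: cvec.dependent_explicit)
  then obtain \<sigma> where \<sigma>: "gelem \<sigma> \<in> S" "u (gelem \<sigma>) \<noteq> 0" by blast
  have "0 = Poly_Mapping.lookup (\<Sum>v\<in>S. cscale (u v) v) (Additive \<sigma>)"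
    by (simp add: S(3))
  also have "\<dots> = (\<Sum>v\<in>S. if v = gelem \<sigma> then u v else 0)"
    unfolding lookup_sum
    by (rule sum.cong) (use S(2) in \<open>auto simp: lookup_cscale lookup_gelem\<close>)
  also have "\<dots> = u (gelem \<sigma>)"
    using S(1) \<sigma>(1) by simp
  finally show False using \<sigma>(2) by simp
qed

text \<open>Supplies the lower bound of the dimension count: the \<open>n!\<close> group elements
  are independent, so no smaller set spans.\<close>

lemma fact_le_card_spanning:
  assumes "finite B" "CS n \<subseteq> cvec.span B"
  shows "fact n \<le> card B"
proof -
  have "cvec.independent (gelem ` Sym n)"
    by (rule cvec.independent_mono[OF independent_gelem]) auto
  moreover have "gelem ` Sym n \<subseteq> cvec.span B"
    using assms(2) by auto
  ultimately have "card (gelem ` Sym n) \<le> card B"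
    using cvec.independent_span_bound[OF assms(1)] by blast
  then show ?thesis
    by (simp add: card_image inj_on_def card_Sym)
qed

subsection \<open>Anti-automorphisms\<close>

definition inv_key :: "nat perm additive \<Rightarrow> nat perm additive" where
  "inv_key x = Additive (inverse (of_additive x))"

text \<open>Inversion of group elements combined with \<open>h\<close> on the coefficients. For
  \<open>h\<close> the identity it exchanges left and right and carries the left theory to the right
  one; for \<open>h = cnj\<close> it gives the adjoints for the inner product that makes the group
  elements orthonormal.\<close>

definition antiaut :: "(complex \<Rightarrow> complex) \<Rightarrow> galg \<Rightarrow> galg" where
  "antiaut h a = Poly_Mapping.map h (Poly_Mapping.map_key inv_key a)"

locale field_involution =
  fixes h :: "complex \<Rightarrow> complex"
  assumes h_add: "h (a + b) = h a + h b" and h_mult: "h (a * b) = h a * h b"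
    and h_h: "h (h a) = a"
begin

lemma h_0: "h 0 = 0"
  using h_add[of 0 0] by simp

lemma h_1: "h 1 = 1"
  using h_mult[of "h 1" 1] by (simp add: h_h)

lemma lookup_antiaut: "Poly_Mapping.lookup (antiaut h a) x = h (Poly_Mapping.lookup a (inv_key x))"
proof -
  have "inj inv_key"
    by (rule injI) (metis inv_key_def additive.collapse additive.inject perm.inverse_inverse)
  then show ?thesis
    by (simp add: antiaut_def Poly_Mapping.map.rep_eq Poly_Mapping.map_key.rep_eq when_def h_0)
qed

lemma antiaut_0 [simp]: "antiaut h 0 = 0"
  by (rule poly_mapping_eqI) (simp add: lookup_antiaut h_0)

lemma antiaut_add: "antiaut h (a + b) = antiaut h a + antiaut h b"
  by (rule poly_mapping_eqI) (simp add: lookup_antiaut lookup_add h_add)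

lemma antiaut_cscale [simp]: "antiaut h (cscale c a) = cscale (h c) (antiaut h a)"
  by (rule poly_mapping_eqI) (simp add: lookup_antiaut lookup_cscale h_mult)

lemma antiaut_minus [simp]: "antiaut h (- a) = - antiaut h a"
  using antiaut_add[of a "- a"] by (simp add: eq_neg_iff_add_eq_0 add.commute)

lemma antiaut_diff: "antiaut h (a - b) = antiaut h a - antiaut h b"
  using antiaut_add[of a "- b"] by simp

lemma antiaut_sum: "antiaut h (\<Sum>i\<in>I. f i) = (\<Sum>i\<in>I. antiaut h (f i))"
  by (induction I rule: infinite_finite_induct) (auto simp: antiaut_add)

lemma antiaut_gelem [simp]: "antiaut h (gelem \<sigma>) = gelem (inverse \<sigma>)"
  by (rule poly_mapping_eqI) (auto simp: lookup_antiaut lookup_gelem inv_key_def h_0 h_1)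

lemma antiaut_mult: "antiaut h (a * b) = antiaut h b * antiaut h a"
proof (induction a rule: galg_induct)
  case (gelem c \<sigma>)
  have "antiaut h (gelem \<sigma> * b) = antiaut h b * antiaut h (gelem \<sigma>)"
    by (induction b rule: galg_induct)
       (simp_all add: antiaut_add distrib_left distrib_right flip: gelem_mult)
  then show ?case by simp
qed (simp_all add: antiaut_add distrib_left distrib_right)

lemma antiaut_antiaut [simp]: "antiaut h (antiaut h a) = a"
  by (rule poly_mapping_eqI) (simp add: lookup_antiaut inv_key_def h_h)

lemma antiaut_eq_0_iff [simp]: "antiaut h a = 0 \<longleftrightarrow> a = 0"
  by (metis antiaut_0 antiaut_antiaut)

lemma antiaut_in_CS [simp]: "antiaut h a \<in> CS n \<longleftrightarrow> a \<in> CS n"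
proof -
  have "antiaut h a \<in> CS n" if "a \<in> CS n" for a
    using that by (induction rule: CS_induct) (auto simp: antiaut_add)
  from this[of a] this[of "antiaut h a"] show ?thesis by auto
qed

lemma antiaut_JM [simp]: "antiaut h (JM k) = JM k"
  by (simp add: JM_def antiaut_sum)

end

interpretation flip: field_involution "\<lambda>c. c"
  by standard auto

interpretation star: field_involution cnj
  by standard auto

abbreviation flip :: "galg \<Rightarrow> galg" where
  "flip \<equiv> antiaut (\<lambda>c. c)"

abbreviation star :: "galg \<Rightarrow> galg" where
  "star \<equiv> antiaut cnj"

text \<open>The coefficient at the identity is a positive definite trace.\<close>

lemma star_mult_self_eq_0:
  assumes "star y * y = 0"
  shows "y = 0"
proof -
  define K where "K = Poly_Mapping.keys y"
  define l where "l = Poly_Mapping.lookup y"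
  have fin: "finite K" by (simp add: K_def)
  have y: "y = (\<Sum>x\<in>K. cscale (l x) (gelem (of_additive x)))"
    unfolding K_def l_def by (rule galg_expand[symmetric])
  have S: "star y * y = (\<Sum>x\<in>K. \<Sum>z\<in>K. cscale (cnj (l x) * l z) (gelem (inverse (of_additive x) * of_additive z)))"
  proof -
    have "star y = (\<Sum>x\<in>K. cscale (cnj (l x)) (gelem (inverse (of_additive x))))"
      by (subst y) (simp add: star.antiaut_sum)
    then have "star y * y = (\<Sum>x\<in>K. cscale (cnj (l x)) (gelem (inverse (of_additive x)))) * (\<Sum>x\<in>K. cscale (l x) (gelem (of_additive x)))"
      using y by simp
    then show ?thesis
      by (simp add: sum_product gelem_mult mult.commute)
  qed
  have "0 = Poly_Mapping.lookup (star y * y) (Additive 1)"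
    by (simp only: assms lookup_zero)
  also have "\<dots> = (\<Sum>x\<in>K. \<Sum>z\<in>K. if z = x then cnj (l x) * l x else 0)"
  proof -
    have "inverse (of_additive x) * of_additive z = 1 \<longleftrightarrow> z = x" for x z :: "nat perm additive"
    proof
      assume *: "inverse (of_additive x) * of_additive z = 1"
      have "of_additive z = of_additive x * inverse (of_additive x) * of_additive z" by simp
      also have "\<dots> = of_additive x" by (simp only: mult.assoc * mult_1_right)
      finally show "z = x" by (simp add: additive.expand)
    qed simp
    then have "Poly_Mapping.lookup (cscale (cnj (l x) * l z) (gelem (inverse (of_additive x) * of_additive z))) (Additive 1)
        = (if z = x then cnj (l x) * l x else 0)" for x z
      by (metis additive.inject lookup_cscale lookup_gelem mult.right_neutral mult_zero_right)
    then show ?thesis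
      by (simp only: S lookup_sum)
  qed
  also have "\<dots> = (\<Sum>x\<in>K. of_real ((cmod (l x))\<^sup>2))"
    using fin by (intro sum.cong) (simp_all add: complex_norm_square mult.commute del: of_real_power)
  also have "\<dots> = of_real (\<Sum>x\<in>K. (cmod (l x))\<^sup>2)"
    by (rule of_real_sum[symmetric])
  finally have "complex_of_real (\<Sum>x\<in>K. (cmod (l x))\<^sup>2) = 0"
    by (rule sym)
  then have "(\<Sum>x\<in>K. (cmod (l x))\<^sup>2) = 0"
    by (rule of_real_eq_0_iff[THEN iffD1])
  then have "\<forall>x\<in>K. l x = 0"
    by (subst (asm) sum_nonneg_eq_0_iff[OF fin]) simp_all
  then have "(\<Sum>x\<in>K. cscale (l x) (gelem (of_additive x))) = 0"
    by (intro sum.neutral) simp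
  then show ?thesis
    using y by (rule trans[rotated])
qed

lemma mult_star_self_eq_0: "y * star y = 0 \<Longrightarrow> y = 0"
  using star_mult_self_eq_0[of "star y"] by simp

section \<open>Corners of Young diagrams\<close>

definition inner_corners :: "box set \<Rightarrow> box set" where
  "inner_corners D = {d \<in> D. young_diagram (D - {d})}"

lemma young_diagramD:
  "young_diagram D \<Longrightarrow> (r, c) \<in> D \<Longrightarrow> r' \<le> r \<Longrightarrow> c' \<le> c \<Longrightarrow> (r', c') \<in> D"
  unfolding young_diagram_def by blast

lemma young_diagram_finite: "young_diagram D \<Longrightarrow> finite D"
  by (simp add: young_diagram_def)

lemma young_diagram_Un: "young_diagram D \<Longrightarrow> young_diagram E \<Longrightarrow> young_diagram (D \<union> E)"
  unfolding young_diagram_def by (metis Un_iff finite_UnI)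

lemma young_diagram_Int: "young_diagram D \<Longrightarrow> young_diagram E \<Longrightarrow> young_diagram (D \<inter> E)"
  unfolding young_diagram_def by blast

lemma young_diagram_empty [simp]: "young_diagram {}"
  by (simp add: young_diagram_def)

lemma outer_cornersD:
  assumes "b \<in> outer_corners D"
  shows "b \<notin> D" "young_diagram (insert b D)"
  using assms by (auto simp: outer_corners_def)

lemma outer_corner_less:
  assumes "(r, c) \<in> outer_corners D" "r' \<le> r" "c' \<le> c" "(r', c') \<noteq> (r, c)"
  shows "(r', c') \<in> D"
  using young_diagramD[OF outer_cornersD(2)[OF assms(1)], of r c r' c'] assms by auto

lemma outer_corner_insert:
  assumes "b \<in> outer_corners D" "d \<in> outer_corners D" "b \<noteq> d"
  shows "b \<in> outer_corners (insert d D)"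
proof -
  have "young_diagram (insert b D \<union> insert d D)"
    using assms by (intro young_diagram_Un outer_cornersD)
  moreover have "insert b D \<union> insert d D = insert b (insert d D)" by auto
  ultimately show ?thesis
    using assms by (auto simp: outer_corners_def)
qed

text \<open>Two boxes whose contents differ by at most 1 are comparable in the product order, while
  all other boxes weakly above and to the left of an outer corner already belong to the
  diagram.\<close>

lemma outer_corners_cont_near:
  assumes "b \<in> outer_corners D" "d \<in> outer_corners D" "\<bar>cont b - cont d\<bar> \<le> 1"
  shows "b = d"
proof (rule ccontr)
  assume neq: "b \<noteq> d"
  obtain r c r' c' where [simp]: "b = (r, c)" "d = (r', c')" by (cases b, cases d) auto
  from assms(3) have "r' \<le> r \<and> c' \<le> c \<or> r \<le> r' \<and> c \<le> c'" by auto
  then show False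
    using outer_corner_less[of r c D r' c'] outer_corner_less[of r' c' D r c] neq assms(1,2)
      outer_cornersD(1)[of b D] outer_cornersD(1)[of d D]
    by auto
qed

lemma inj_on_cont_outer_corners: "inj_on cont (outer_corners D)"
  by (rule inj_onI) (rule outer_corners_cont_near; simp)

text \<open>For \<open>\<epsilon> = 1\<close>, if the right neighbour of \<open>d\<close> cannot be
  added after \<open>d\<close>, a box above that neighbour is missing. Hence the box directly above
  \<open>d\<close> ends its row and its column in \<open>D\<close>, so it is removable, and its
  content is that of \<open>d\<close> plus 1. The case \<open>\<epsilon> = - 1\<close> is the
  transpose.\<close>

lemma blocking_inner_corner:
  assumes D: "young_diagram D" and d: "d \<in> outer_corners D" and \<epsilon>: "\<epsilon> = 1 \<or> \<epsilon> = - 1"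
    and no: "\<And>b. b \<in> outer_corners (insert d D) \<Longrightarrow> cont b \<noteq> cont d + \<epsilon>"
  obtains g where "g \<in> inner_corners D" "cont g = cont d + \<epsilon>"
proof -
  obtain r c where d_eq: "d = (r, c)" by (cases d)
  have dD: "(r, c) \<notin> D" and Y: "young_diagram (insert (r, c) D)"
    using outer_cornersD[OF d] d_eq by auto
  have fin: "finite D" using young_diagram_finite[OF D] .
  have remove: "young_diagram (D - {(x, y)})" if "(x, Suc y) \<notin> D" "(Suc x, y) \<notin> D" for x y
    unfolding young_diagram_def
  proof (intro conjI allI impI)
    fix u v u' v' assume *: "(u, v) \<in> D - {(x, y)} \<and> u' \<le> u \<and> v' \<le> v"
    then have "(u', v') \<in> D" using young_diagramD[OF D] by blast
    moreover have "(u', v') \<noteq> (x, y)"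
    proof
      assume "(u', v') = (x, y)"
      with * have "x < u \<and> y \<le> v \<or> x \<le> u \<and> y < v" by auto
      then show False
        using that * young_diagramD[OF D, of u v "Suc x" y] young_diagramD[OF D, of u v x "Suc y"] by auto
    qed
    ultimately show "(u', v') \<in> D - {(x, y)}" by simp
  qed (use fin in simp)
  from \<epsilon> show thesis
  proof
    assume e: "\<epsilon> = 1"
    have nD: "(r, Suc c) \<notin> D" using young_diagramD[OF D, of r "Suc c" r c] dD by auto
    have "(r, Suc c) \<notin> outer_corners (insert d D)" using no[of "(r, Suc c)"] d_eq e by auto
    then have "\<not> young_diagram (insert (r, Suc c) (insert (r, c) D))"
      using nD d_eq by (auto simp: outer_corners_def)
    then obtain u v where uv: "u \<le> r" "v \<le> Suc c" "(u, v) \<noteq> (r, Suc c)" "(u, v) \<notin> insert (r, c) D"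
      using fin young_diagramD[OF Y] unfolding young_diagram_def by (metis (no_types, lifting) Pair_inject finite.insertI insert_iff)
    have "v = Suc c" using young_diagramD[OF Y, of r c u v] uv by (metis insertI1 le_Suc_eq)
    with uv have "u < r" by auto
    then obtain r0 where r0: "r = Suc r0" by (cases r) auto
    have "(r0, c) \<in> D" using young_diagramD[OF Y, of r c r0 c] r0 by auto
    moreover have "(r0, Suc c) \<notin> D"
      using young_diagramD[OF D, of r0 "Suc c" u v] uv \<open>u < r\<close> \<open>v = Suc c\<close> r0 by auto
    moreover have "(Suc r0, c) \<notin> D" using dD r0 by simp
    ultimately have "(r0, c) \<in> inner_corners D" using remove by (auto simp: inner_corners_def)
    then show thesis using that[of "(r0, c)"] d_eq r0 e by simp
  next
    assume e: "\<epsilon> = - 1"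
    have nD: "(Suc r, c) \<notin> D" using young_diagramD[OF D, of "Suc r" c r c] dD by auto
    have "(Suc r, c) \<notin> outer_corners (insert d D)" using no[of "(Suc r, c)"] d_eq e by auto
    then have "\<not> young_diagram (insert (Suc r, c) (insert (r, c) D))"
      using nD d_eq by (auto simp: outer_corners_def)
    then obtain u v where uv: "u \<le> Suc r" "v \<le> c" "(u, v) \<noteq> (Suc r, c)" "(u, v) \<notin> insert (r, c) D"
      using fin young_diagramD[OF Y] unfolding young_diagram_def by (metis (no_types, lifting) Pair_inject finite.insertI insert_iff)
    have "u = Suc r" using young_diagramD[OF Y, of r c u v] uv by (metis insertI1 le_Suc_eq)
    with uv have "v < c" by auto
    then obtain c0 where c0: "c = Suc c0" by (cases c) auto
    have "(r, c0) \<in> D" using young_diagramD[OF Y, of r c r c0] c0 by auto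
    moreover have "(Suc r, c0) \<notin> D"
      using young_diagramD[OF D, of "Suc r" c0 u v] uv \<open>v < c\<close> \<open>u = Suc r\<close> c0 by auto
    moreover have "(r, Suc c0) \<notin> D" using dD c0 by simp
    ultimately have "(r, c0) \<in> inner_corners D" using remove by (auto simp: inner_corners_def)
    then show thesis using that[of "(r, c0)"] d_eq c0 e by simp
  qed
qed

lemma inner_corner_outer:
  assumes "young_diagram D" "d \<in> inner_corners D"
  shows "d \<in> outer_corners (D - {d})"
  using assms by (auto simp: inner_corners_def outer_corners_def insert_absorb)

lemma outer_corner_inner:
  assumes "young_diagram D" "d \<in> outer_corners D"
  shows "d \<in> inner_corners (insert d D)"
  using assms by (auto simp: inner_corners_def outer_corners_def insert_absorb)

text \<open>On a common diagonal the outer corner would lie beyond \<open>d\<close>, which forces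
  the box just below \<open>d\<close> into the diagram, and \<open>d\<close> could not be removed.
  This inequality is what later lets the scalar \<open>weight T (Suc n) - weight R n\<close> be
  inverted.\<close>

lemma cont_inner_outer_neq:
  assumes D: "young_diagram D" and d: "d \<in> inner_corners D" and b: "b \<in> outer_corners D"
  shows "cont b \<noteq> cont d"
proof
  assume eq: "cont b = cont d"
  obtain r c r' c' where [simp]: "b = (r, c)" "d = (r', c')" by (cases b, cases d) auto
  have dD: "d \<in> D" "young_diagram (D - {d})" using d by (auto simp: inner_corners_def)
  have bD: "b \<notin> D" using outer_cornersD[OF b] by auto
  have "\<not> (r \<le> r' \<and> c \<le> c')" using young_diagramD[OF D, of r' c' r c] dD bD by auto
  with eq have lt: "r' < r" "c' < c" by auto
  then have "(Suc r', c') \<in> D" using outer_corner_less[of r c D "Suc r'" c'] b by auto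
  then show False using young_diagramD[OF dD(2), of "Suc r'" c' r' c'] by auto
qed

lemma outer_corners_subset:
  "outer_corners D \<subseteq> insert (0, 0) ((\<lambda>(r, c). (Suc r, c)) ` D \<union> (\<lambda>(r, c). (r, Suc c)) ` D)"
proof
  fix b assume b: "b \<in> outer_corners D"
  obtain r c where [simp]: "b = (r, c)" by (cases b)
  show "b \<in> insert (0, 0) ((\<lambda>(r, c). (Suc r, c)) ` D \<union> (\<lambda>(r, c). (r, Suc c)) ` D)"
  proof (cases r)
    case (Suc r0)
    then have "(r0, c) \<in> D" using outer_corner_less[of r c D r0 c] b by auto
    then show ?thesis using Suc by force
  next
    case 0
    show ?thesis
    proof (cases c)
      case (Suc c0)
      then have "(r, c0) \<in> D" using outer_corner_less[of r c D r c0] b by auto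
      then show ?thesis using Suc by force
    qed (use 0 in simp)
  qed
qed

lemma finite_outer_corners [simp]: "finite D \<Longrightarrow> finite (outer_corners D)"
  by (rule finite_subset[OF outer_corners_subset]) simp

lemma finite_inner_corners [simp]: "finite D \<Longrightarrow> finite (inner_corners D)"
  by (simp add: inner_corners_def)

lemma outer_corners_empty [simp]: "outer_corners {} = {(0, 0)}"
  using outer_corners_subset[of "{}"] by (auto simp: outer_corners_def young_diagram_def)

text \<open>A row has at most one outer corner, and to an outer corner off the top row the last box
  of the row above can be assigned, which is removable; this assignment is injective.\<close>

lemma card_outer_corners_le:
  assumes D: "young_diagram D"
  shows "card (outer_corners D) \<le> card (inner_corners D) + 1"
proof -
  define O' where "O' = {b \<in> outer_corners D. fst b > 0}"
  have fin: "finite D" using young_diagram_finite[OF D] .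
  have row: "b = d" if "b \<in> outer_corners D" "d \<in> outer_corners D" "fst b = fst d" for b d
    using that outer_corner_less[of "fst b" "snd b" D "fst d" "snd d"] outer_corner_less[of "fst d" "snd d" D "fst b" "snd b"]
    by (metis le_cases le_refl outer_cornersD(1) prod.collapse)
  have "card {b \<in> outer_corners D. fst b = 0} \<le> Suc 0"
    unfolding card_le_Suc0_iff_eq[OF finite_subset[OF _ finite_outer_corners[OF fin], of "{b \<in> outer_corners D. fst b = 0}", simplified]]
    using row by auto
  have "\<exists>g. g \<in> inner_corners D \<and> Suc (fst g) = fst b" if b: "b \<in> O'" for b
  proof -
    obtain r c where b_eq: "b = (Suc r, c)" using b by (cases b; cases "fst b") (auto simp: O'_def)
    have bo: "(Suc r, c) \<in> outer_corners D" using b b_eq by (auto simp: O'_def)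
    have rc: "(r, c) \<in> D" using outer_corner_less[OF bo, of r c] by auto
    define m where "m = Max {x. (r, x) \<in> D}"
    have finm: "finite {x. (r, x) \<in> D}"
      using finite_subset[of "{x. (r, x) \<in> D}" "snd ` D"] fin by force
    have m: "(r, m) \<in> D" using Max_in[OF finm] rc by (auto simp: m_def)
    have m_le: "x \<le> m" if "(r, x) \<in> D" for x using Max_ge[OF finm, of x] that by (simp add: m_def)
    have "(Suc r, m) \<notin> D"
      using young_diagramD[OF D, of "Suc r" m "Suc r" c] m_le[OF rc] outer_cornersD(1)[OF bo] by auto
    have "young_diagram (D - {(r, m)})"
      unfolding young_diagram_def
    proof (intro conjI allI impI)
      fix u v u' v' assume *: "(u, v) \<in> D - {(r, m)} \<and> u' \<le> u \<and> v' \<le> v"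
      have "(u', v') \<noteq> (r, m)"
      proof
        assume "(u', v') = (r, m)"
        with * have "Suc r \<le> u \<and> m \<le> v \<or> r \<le> u \<and> Suc m \<le> v" by auto
        then show False
          using * young_diagramD[OF D, of u v "Suc r" m] young_diagramD[OF D, of u v r "Suc m"]
            \<open>(Suc r, m) \<notin> D\<close> m_le[of "Suc m"] by auto
      qed
      then show "(u', v') \<in> D - {(r, m)}" using * young_diagramD[OF D] by blast
    qed (use fin in simp)
    then have "(r, m) \<in> inner_corners D" using m by (simp add: inner_corners_def)
    then show ?thesis using b_eq by force
  qed
  then obtain g where g: "\<And>b. b \<in> O' \<Longrightarrow> g b \<in> inner_corners D \<and> Suc (fst (g b)) = fst b"
    by metis
  have "inj_on g O'"
  proof (rule inj_onI)
    fix b d assume *: "b \<in> O'" "d \<in> O'" "g b = g d"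
    then have "fst b = fst d" using g[of b] g[of d] by metis
    with * show "b = d" unfolding O'_def by (intro row) simp_all
  qed
  then have "card O' \<le> card (inner_corners D)"
    using g fin by (intro card_inj_on_le[of g]) auto
  have "card (outer_corners D) \<le> card (O' \<union> {b \<in> outer_corners D. fst b = 0})"
    by (rule card_mono) (use fin in \<open>auto simp: O'_def\<close>)
  also have "\<dots> \<le> card O' + card {b \<in> outer_corners D. fst b = 0}"
    by (rule card_Un_le)
  finally show ?thesis
    using \<open>card O' \<le> _\<close> \<open>card {b \<in> outer_corners D. fst b = 0} \<le> Suc 0\<close> by linarith
qed

text \<open>Boxes of one diagonal are totally ordered, and a diagram occupies an initial segment of
  each diagonal; a box of \<open>D\<close> outside \<open>E\<close> therefore makes its diagonal
  strictly longer in \<open>D\<close>.\<close>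

lemma young_diagram_subset_by_contents:
  assumes D: "young_diagram D" and E: "young_diagram E"
    and eq: "\<And>x. card {b \<in> D. cont b = x} = card {b \<in> E. cont b = x}"
  shows "D \<subseteq> E"
proof (rule ccontr)
  assume "\<not> D \<subseteq> E"
  then obtain r c where rc: "(r, c) \<in> D" "(r, c) \<notin> E" by auto
  let ?x = "cont (r, c)"
  have "{b \<in> E. cont b = ?x} \<subset> {b \<in> D. cont b = ?x}"
  proof
    show "{b \<in> E. cont b = ?x} \<subseteq> {b \<in> D. cont b = ?x}"
    proof clarsimp
      fix u v assume uv: "(u, v) \<in> E" "int v - int u = int c - int r"
      then have "u \<le> r \<and> v \<le> c \<or> r \<le> u \<and> c \<le> v" by auto
      then show "(u, v) \<in> D"
        using young_diagramD[OF D, of r c u v] young_diagramD[OF E, of u v r c] rc uv(1) by blast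
    qed
    show "{b \<in> E. cont b = ?x} \<noteq> {b \<in> D. cont b = ?x}"
    proof
      assume *: "{b \<in> E. cont b = ?x} = {b \<in> D. cont b = ?x}"
      have "(r, c) \<in> {b \<in> D. cont b = ?x}" using rc by blast
      with * rc show False by blast
    qed
  qed
  then have "card {b \<in> E. cont b = ?x} < card {b \<in> D. cont b = ?x}"
    by (rule psubset_card_mono[rotated]) (use young_diagram_finite[OF D] in simp)
  with eq show False by simp
qed

lemma young_diagram_eq_by_contents:
  assumes "young_diagram D" "young_diagram E"
    and "\<And>x. card {b \<in> D. cont b = x} = card {b \<in> E. cont b = x}"
  shows "D = E"
  using young_diagram_subset_by_contents[of D E] young_diagram_subset_by_contents[of E D] assms by auto

text \<open>A box with the largest sum of row and column index has nothing to its right or below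
  it.\<close>

lemma inner_corner_exists:
  assumes "young_diagram D" "D \<noteq> {}"
  shows "inner_corners D \<noteq> {}"
proof -
  have "finite ((\<lambda>b. fst b + snd b) ` D)" "(\<lambda>b. fst b + snd b) ` D \<noteq> {}"
    using assms young_diagram_finite[OF assms(1)] by auto
  from Max_in[OF this] Max_ge[OF this(1)]
  obtain b where b: "b \<in> D" "\<And>b'. b' \<in> D \<Longrightarrow> fst b' + snd b' \<le> fst b + snd b"
    by fastforce
  have "young_diagram (D - {b})"
    unfolding young_diagram_def
  proof (intro conjI allI impI)
    fix u v u' v' assume *: "(u, v) \<in> D - {b} \<and> u' \<le> u \<and> v' \<le> v"
    then have "(u', v') \<noteq> b" using b(2)[of "(u, v)"] by auto
    then show "(u', v') \<in> D - {b}" using * young_diagramD[OF assms(1)] by blast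
  qed (use young_diagram_finite[OF assms(1)] in simp)
  with b have "b \<in> inner_corners D" by (simp add: inner_corners_def)
  then show ?thesis by blast
qed

section \<open>Standard tableaux\<close>

lemma standard_tableau_shape:
  assumes "standard_tableau n T"
  shows "young_diagram (shape T)" "finite (shape T)" "card (shape T) = n"
  using assms bij_betw_same_card[of T "shape T" "{1..n}"]
  by (auto simp: standard_tableau_def young_diagram_def)

lemma in_shape_iff: "b \<in> shape T \<longleftrightarrow> T b \<noteq> 0"
  by (simp add: shape_def)

lemma standard_tableau_le: "standard_tableau n T \<Longrightarrow> T b \<le> n"
  by (cases "b \<in> shape T") (auto simp: standard_tableau_def in_shape_iff dest: bij_betwE)

lemma standard_tableau_inj:
  "standard_tableau n T \<Longrightarrow> T b = T b' \<Longrightarrow> T b \<noteq> 0 \<Longrightarrow> b = b'"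
  unfolding standard_tableau_def bij_betw_def inj_on_def by (metis in_shape_iff)

lemma standard_tableau_mono:
  assumes "standard_tableau n T" "(r, c) \<in> shape T" "r' \<le> r" "c' \<le> c"
  shows "T (r', c') \<le> T (r, c)"
proof -
  have rc': "(r, c') \<in> shape T"
    using assms young_diagramD[OF standard_tableau_shape(1)[OF assms(1)]] by blast
  have "T (r, c') \<le> T (r, c)"
    using assms rc' unfolding standard_tableau_def by (cases "c' = c") (auto simp: less_imp_le)
  moreover have "(r', c') \<in> shape T"
    using rc' assms young_diagramD[OF standard_tableau_shape(1)[OF assms(1)]] by blast
  then have "T (r', c') \<le> T (r, c')"
    using assms rc' unfolding standard_tableau_def by (cases "r' = r") (auto simp: less_imp_le)
  ultimately show ?thesis by simp
qed

lemma box_of_entry: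
  assumes "standard_tableau n T" "b \<in> shape T"
  shows "box_of T (T b) = b"
  unfolding box_of_def
  by (rule the_equality) (use assms standard_tableau_inj[OF assms(1)] in \<open>auto simp: in_shape_iff\<close>)

lemma
  assumes "standard_tableau n T" "i \<in> {1..n}"
  shows box_of_in_shape: "box_of T i \<in> shape T" and entry_box_of: "T (box_of T i) = i"
proof -
  have "i \<in> T ` shape T"
    using assms by (auto simp: standard_tableau_def bij_betw_def)
  then obtain b where b: "b \<in> shape T" "T b = i" by auto
  then show "box_of T i \<in> shape T" "T (box_of T i) = i"
    using box_of_entry[OF assms(1) b(1)] by auto
qed

lemma box_of_eqI: "standard_tableau n T \<Longrightarrow> T b = i \<Longrightarrow> i \<noteq> 0 \<Longrightarrow> box_of T i = b"
  using box_of_entry[of n T b] by (auto simp: in_shape_iff)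

lemma bij_betw_box_of:
  assumes "standard_tableau n T"
  shows "bij_betw (box_of T) {1..n} (shape T)"
proof (rule bij_betw_byWitness[where f' = T])
  show "T ` shape T \<subseteq> {1..n}"
    using assms by (auto simp: standard_tableau_def dest: bij_betwE)
qed (use assms box_of_in_shape entry_box_of box_of_entry in auto)

lemma shape_fun_upd: "k \<noteq> 0 \<Longrightarrow> shape (T(b := k)) = insert b (shape T)"
  by (auto simp: shape_def)

lemma shape_subtableau: "shape (subtableau T k) = {b \<in> shape T. T b \<le> k}"
  by (auto simp: shape_def subtableau_def)

lemma standard_tableau_extend:
  assumes T: "standard_tableau n T" and b: "b \<in> outer_corners (shape T)"
  shows "standard_tableau (Suc n) (T(b := Suc n))"
  unfolding standard_tableau_def
proof (intro conjI allI impI)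
  have nb: "b \<notin> shape T" and Y: "young_diagram (insert b (shape T))"
    using outer_cornersD[OF b] by auto
  show "young_diagram (shape (T(b := Suc n)))"
    using Y by (simp add: shape_fun_upd)
  have "bij_betw (T(b := Suc n)) (shape T) {1..n}"
    using T nb by (subst bij_betw_cong[of _ _ T]) (auto simp: standard_tableau_def)
  then have "bij_betw (T(b := Suc n)) (shape T \<union> {b}) ({1..n} \<union> {(T(b := Suc n)) b})"
    by (intro notIn_Un_bij_betw nb) auto
  moreover have "{1..n} \<union> {Suc n} = {1..Suc n}" by auto
  ultimately show "bij_betw (T(b := Suc n)) (shape (T(b := Suc n))) {1..Suc n}"
    by (simp add: shape_fun_upd)
  show "(T(b := Suc n)) (r, c) < (T(b := Suc n)) (r, c')"
    if "(r, c) \<in> shape (T(b := Suc n)) \<and> (r, c') \<in> shape (T(b := Suc n)) \<and> c < c'" for r c c'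
  proof (cases "b = (r, c)")
    case True
    then have "(r, c') \<in> shape T" using that by (auto simp: shape_fun_upd)
    then have "b \<in> shape T"
      using that True young_diagramD[OF standard_tableau_shape(1)[OF T], of r c' r c] by simp
    with nb show ?thesis by simp
  next
    case False
    then show ?thesis
      using that T standard_tableau_le[OF T, of "(r, c)"] unfolding standard_tableau_def
      by (auto simp: shape_fun_upd less_Suc_eq_le)
  qed
  show "(T(b := Suc n)) (r, c) < (T(b := Suc n)) (r', c)"
    if "(r, c) \<in> shape (T(b := Suc n)) \<and> (r', c) \<in> shape (T(b := Suc n)) \<and> r < r'" for r r' c
  proof (cases "b = (r, c)")
    case True
    then have "(r', c) \<in> shape T" using that by (auto simp: shape_fun_upd)
    then have "b \<in> shape T"
      using that True young_diagramD[OF standard_tableau_shape(1)[OF T], of r' c r c] by simp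
    with nb show ?thesis by simp
  next
    case False
    then show ?thesis
      using that T standard_tableau_le[OF T, of "(r, c)"] unfolding standard_tableau_def
      by (auto simp: shape_fun_upd less_Suc_eq_le)
  qed
qed

lemma standard_tableau_subtableau:
  assumes T: "standard_tableau n T" and k: "k \<le> n"
  shows "standard_tableau k (subtableau T k)"
  unfolding standard_tableau_def
proof (intro conjI allI impI)
  show "young_diagram (shape (subtableau T k))"
    unfolding young_diagram_def
  proof (intro conjI allI impI)
    show "finite (shape (subtableau T k))"
      using standard_tableau_shape[OF T] by (simp add: shape_subtableau)
    fix r c r' c' assume *: "(r, c) \<in> shape (subtableau T k) \<and> r' \<le> r \<and> c' \<le> c"
    then have "(r', c') \<in> shape T" "T (r', c') \<le> T (r, c)"
      using young_diagramD[OF standard_tableau_shape(1)[OF T]] standard_tableau_mono[OF T]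
      by (auto simp: shape_subtableau)
    with * show "(r', c') \<in> shape (subtableau T k)" by (simp add: shape_subtableau)
  qed
  have "bij_betw T (shape (subtableau T k)) {1..k}"
    unfolding bij_betw_def
  proof
    show "inj_on T (shape (subtableau T k))"
      using T by (auto simp: standard_tableau_def bij_betw_def shape_subtableau inj_on_def)
    show "T ` shape (subtableau T k) = {1..k}"
    proof
      show "T ` shape (subtableau T k) \<subseteq> {1..k}"
        by (auto simp: shape_subtableau in_shape_iff)
      show "{1..k} \<subseteq> T ` shape (subtableau T k)"
      proof
        fix i assume "i \<in> {1..k}"
        then have "box_of T i \<in> shape (subtableau T k)" "T (box_of T i) = i"
          using box_of_in_shape[OF T, of i] entry_box_of[OF T, of i] k by (auto simp: shape_subtableau)
        then show "i \<in> T ` shape (subtableau T k)" by force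
      qed
    qed
  qed
  then show "bij_betw (subtableau T k) (shape (subtableau T k)) {1..k}"
    by (subst bij_betw_cong[of _ _ T]) (auto simp: shape_subtableau, simp add: subtableau_def)
next
  have *: "b \<in> shape (subtableau T k) \<Longrightarrow> b \<in> shape T \<and> subtableau T k b = T b" for b
    by (simp add: shape_subtableau) (simp add: subtableau_def)
  show "subtableau T k (r, c) < subtableau T k (r, c')"
    if "(r, c) \<in> shape (subtableau T k) \<and> (r, c') \<in> shape (subtableau T k) \<and> c < c'" for r c c'
    using that *[of "(r, c)"] *[of "(r, c')"] T unfolding standard_tableau_def by metis
  show "subtableau T k (r, c) < subtableau T k (r', c)"
    if "(r, c) \<in> shape (subtableau T k) \<and> (r', c) \<in> shape (subtableau T k) \<and> r < r'" for r r' c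
    using that *[of "(r, c)"] *[of "(r', c)"] T unfolding standard_tableau_def by metis
qed

lemma subtableau_self: "standard_tableau n T \<Longrightarrow> subtableau T n = T"
  using standard_tableau_le by (auto simp: subtableau_def)

lemma subtableau_subtableau: "k \<le> m \<Longrightarrow> subtableau (subtableau T m) k = subtableau T k"
  by (auto simp: subtableau_def fun_eq_iff)

lemma box_of_subtableau:
  assumes "standard_tableau n T" "i \<in> {1..k}" "k \<le> n"
  shows "box_of (subtableau T k) i = box_of T i"
  by (rule box_of_eqI[OF standard_tableau_subtableau[OF assms(1,3)]])
     (use assms entry_box_of[OF assms(1), of i] in \<open>auto simp: subtableau_def\<close>)

lemma
  assumes T: "standard_tableau n T" and b: "b \<in> outer_corners (shape T)"
  shows subtableau_extend: "subtableau (T(b := Suc n)) n = T"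
    and box_of_extend: "box_of (T(b := Suc n)) (Suc n) = b"
proof -
  show "subtableau (T(b := Suc n)) n = T"
    using outer_cornersD(1)[OF b] standard_tableau_le[OF T]
    by (auto simp: subtableau_def fun_eq_iff in_shape_iff)
  show "box_of (T(b := Suc n)) (Suc n) = b"
    using box_of_eqI[OF standard_tableau_extend[OF T b], of b "Suc n"] by simp
qed

lemma
  assumes T: "standard_tableau (Suc n) T"
  shows box_of_last_outer: "box_of T (Suc n) \<in> outer_corners (shape (subtableau T n))"
    and extend_subtableau: "(subtableau T n)(box_of T (Suc n) := Suc n) = T"
    and shape_last: "shape T = insert (box_of T (Suc n)) (shape (subtableau T n))"
proof -
  let ?b = "box_of T (Suc n)"
  have b: "?b \<in> shape T" "T ?b = Suc n"
    using box_of_in_shape[OF T] entry_box_of[OF T] by auto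
  show eq: "(subtableau T n)(?b := Suc n) = T"
  proof
    fix x
    show "((subtableau T n)(?b := Suc n)) x = T x"
    proof (cases "x = ?b")
      case False
      then have "T x \<noteq> Suc n" using box_of_eqI[OF T, of x "Suc n"] by blast
      then have "T x \<le> n" using standard_tableau_le[OF T, of x] by simp
      with False show ?thesis by (simp add: subtableau_def)
    qed (use b(2) in simp)
  qed
  show "shape T = insert ?b (shape (subtableau T n))"
    using shape_fun_upd[of "Suc n" "subtableau T n" ?b] by (simp add: eq)
  then show "?b \<in> outer_corners (shape (subtableau T n))"
    using standard_tableau_shape(1)[OF T] b(2) by (auto simp: outer_corners_def shape_subtableau)
qed

text \<open>The shape minus that of the subtableau is a single box. The lemma is applied in
  contrapositive form: distinct tableaux of one shape still differ after removal of the largest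
  entry.\<close>

lemma tableau_eq_by_shape:
  assumes "standard_tableau (Suc n) S" "standard_tableau (Suc n) T"
    and "shape S = shape T" "subtableau S n = subtableau T n"
  shows "S = T"
proof -
  have "box_of S (Suc n) \<in> shape T"
    using box_of_in_shape[OF assms(1), of "Suc n"] unfolding assms(3) by simp
  then have "box_of S (Suc n) \<in> insert (box_of T (Suc n)) (shape (subtableau T n))"
    using shape_last[OF assms(2)] by simp
  moreover have "box_of S (Suc n) \<notin> shape (subtableau T n)"
    using outer_cornersD(1)[OF box_of_last_outer[OF assms(1)]] unfolding assms(4) .
  ultimately have "box_of S (Suc n) = box_of T (Suc n)" by simp
  then show ?thesis
    using extend_subtableau[OF assms(1)] extend_subtableau[OF assms(2)] assms(4) by metis
qed

definition tableaux :: "nat \<Rightarrow> tableau set" where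
  "tableaux n = {T. standard_tableau n T}"

lemma tableaux_0: "tableaux 0 = {\<lambda>_. 0}"
proof -
  have "T = (\<lambda>_. 0)" if "standard_tableau 0 T" for T
    using standard_tableau_le[OF that] by auto
  moreover have "shape (\<lambda>_. 0) = {}" by (simp add: shape_def)
  then have "standard_tableau 0 (\<lambda>_. 0)" by (simp add: standard_tableau_def bij_betw_def)
  ultimately show ?thesis unfolding tableaux_def by blast
qed

lemma bij_betw_tableaux_Suc:
  "bij_betw (\<lambda>(T, b). T(b := Suc n)) (SIGMA T:tableaux n. outer_corners (shape T)) (tableaux (Suc n))"
proof (rule bij_betw_byWitness[where f' = "\<lambda>T. (subtableau T n, box_of T (Suc n))"])
  show "\<forall>a\<in>SIGMA T:tableaux n. outer_corners (shape T).
       (subtableau (case a of (T, b) \<Rightarrow> T(b := Suc n)) n, box_of (case a of (T, b) \<Rightarrow> T(b := Suc n)) (Suc n)) = a"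
    using subtableau_extend box_of_extend by (auto simp: tableaux_def)
  show "\<forall>T\<in>tableaux (Suc n). (case (subtableau T n, box_of T (Suc n)) of (T, b) \<Rightarrow> T(b := Suc n)) = T"
    using extend_subtableau by (auto simp: tableaux_def)
  show "(\<lambda>(T, b). T(b := Suc n)) ` (SIGMA T:tableaux n. outer_corners (shape T)) \<subseteq> tableaux (Suc n)"
    using standard_tableau_extend by (auto simp: tableaux_def)
  show "(\<lambda>T. (subtableau T n, box_of T (Suc n))) ` tableaux (Suc n) \<subseteq> (SIGMA T:tableaux n. outer_corners (shape T))"
    using standard_tableau_subtableau box_of_last_outer by (auto simp: tableaux_def)
qed

lemma finite_tableaux [simp]: "finite (tableaux n)"
proof (induction n)
  case (Suc n)
  have "finite (SIGMA T:tableaux n. outer_corners (shape T))"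
    using Suc standard_tableau_shape(2) by (intro finite_SigmaI) (auto simp: tableaux_def)
  then show ?case
    using bij_betw_finite[OF bij_betw_tableaux_Suc] by blast
qed (simp add: tableaux_0)

lemma sum_tableaux_Suc:
  "(\<Sum>T\<in>tableaux (Suc n). f T) = (\<Sum>T\<in>tableaux n. \<Sum>b\<in>outer_corners (shape T). f (T(b := Suc n)))"
proof -
  have "(\<Sum>T\<in>tableaux (Suc n). f T) = (\<Sum>x\<in>(SIGMA T:tableaux n. outer_corners (shape T)). f (case x of (T, b) \<Rightarrow> T(b := Suc n)))"
    by (rule sum.reindex_bij_betw[OF bij_betw_tableaux_Suc, symmetric])
  also have "\<dots> = (\<Sum>T\<in>tableaux n. \<Sum>b\<in>outer_corners (shape T). f (T(b := Suc n)))"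
  proof (subst sum.Sigma)
    show "\<forall>T\<in>tableaux n. finite (outer_corners (shape T))"
      using standard_tableau_shape(2) by (auto simp: tableaux_def)
  qed (simp_all add: case_prod_unfold)
  finally show ?thesis .
qed

section \<open>Counting standard tableaux of a given shape\<close>

lemma SYT_eq: "young_diagram D \<Longrightarrow> SYT D = {T \<in> tableaux (card D). shape T = D}"
  by (auto simp: SYT_def tableaux_def)

lemma finite_SYT [simp]: "finite (SYT D)"
  by (rule finite_subset[OF _ finite_tableaux[of "card D"]]) (auto simp: SYT_def tableaux_def)

lemma SYT_extend:
  assumes "young_diagram D" "d \<in> inner_corners D" "T \<in> SYT (D - {d})"
  shows "T(d := card D) \<in> SYT D" "d \<notin> shape T" "standard_tableau (card D - 1) T" "shape T = D - {d}"
proof -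
  have fin: "finite D" "d \<in> D"
    using assms young_diagram_finite by (auto simp: inner_corners_def)
  obtain n where c: "card D = Suc n" "card (D - {d}) = n"
    using card.remove[OF fin] by blast
  show sh: "shape T = D - {d}" "standard_tableau (card D - 1) T" "d \<notin> shape T"
    using assms(3) c by (auto simp: SYT_def)
  have "d \<in> outer_corners (shape T)"
    using inner_corner_outer[OF assms(1,2)] sh by simp
  from standard_tableau_extend[OF sh(2) this] have "standard_tableau (card D) (T(d := card D))"
    by (simp add: c(1))
  then show "T(d := card D) \<in> SYT D"
    using c(1) sh(1) fin(2) by (simp add: SYT_def shape_fun_upd insert_absorb)
qed

lemma card_SYT_rec:
  assumes D: "young_diagram D" and ne: "D \<noteq> {}"
  shows "card (SYT D) = (\<Sum>d\<in>inner_corners D. card (SYT (D - {d})))"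
proof -
  have fin: "finite D" using young_diagram_finite[OF D] .
  have "bij_betw (\<lambda>(d, T). T(d := card D)) (SIGMA d:inner_corners D. SYT (D - {d})) (SYT D)"
    unfolding bij_betw_def
  proof
    have pos: "card D \<noteq> 0" using ne fin by simp
    show "inj_on (\<lambda>(d, T). T(d := card D)) (SIGMA d:inner_corners D. SYT (D - {d}))"
    proof (rule inj_onI, clarify)
      fix d T e U assume *: "d \<in> inner_corners D" "T \<in> SYT (D - {d})" "e \<in> inner_corners D" "U \<in> SYT (D - {e})"
        and eq: "T(d := card D) = U(e := card D)"
      have "d = e"
      proof (rule ccontr)
        assume "d \<noteq> e"
        then have "U d = card D" using fun_cong[OF eq, of d] by simp
        then show False
          using standard_tableau_le[OF SYT_extend(3)[OF D *(3,4)], of d] pos by simp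
      qed
      moreover have "T d = 0" "U e = 0"
        using SYT_extend(2)[OF D *(1,2)] SYT_extend(2)[OF D *(3,4)] by (auto simp: in_shape_iff)
      ultimately have "T = U" using eq by (metis fun_upd_triv fun_upd_upd)
      with \<open>d = e\<close> show "d = e \<and> T = U" by simp
    qed
    show "(\<lambda>(d, T). T(d := card D)) ` (SIGMA d:inner_corners D. SYT (D - {d})) = SYT D"
    proof
      show "(\<lambda>(d, T). T(d := card D)) ` (SIGMA d:inner_corners D. SYT (D - {d})) \<subseteq> SYT D"
        using SYT_extend(1)[OF D] by auto
      show "SYT D \<subseteq> (\<lambda>(d, T). T(d := card D)) ` (SIGMA d:inner_corners D. SYT (D - {d}))"
      proof
        fix T assume T: "T \<in> SYT D"
        obtain n where n: "card D = Suc n" using pos by (cases "card D") auto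
        have st: "standard_tableau (Suc n) T" and sh: "shape T = D" using T n by (auto simp: SYT_def)
        let ?d = "box_of T (Suc n)" and ?U = "subtableau T n"
        have U: "standard_tableau n ?U" by (rule standard_tableau_subtableau[OF st]) simp
        have o: "?d \<in> outer_corners (shape ?U)" using box_of_last_outer[OF st] .
        have D_eq: "D = insert ?d (shape ?U)" using shape_last[OF st] sh by simp
        have "shape ?U = D - {?d}" using D_eq outer_cornersD(1)[OF o] by auto
        then have "?d \<in> inner_corners D" "?U \<in> SYT (D - {?d})"
          using outer_corner_inner[OF standard_tableau_shape(1)[OF U] o] D_eq U
            standard_tableau_shape(3)[OF U]
          by (auto simp: SYT_def)
        then show "T \<in> (\<lambda>(d, T). T(d := card D)) ` (SIGMA d:inner_corners D. SYT (D - {d}))"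
          using extend_subtableau[OF st] n by (intro image_eqI[of _ _ "(?d, ?U)"]) auto
      qed
    qed
  qed
  from bij_betw_same_card[OF this] show ?thesis
    using fin by simp
qed

lemma SYT_nonempty: "young_diagram D \<Longrightarrow> SYT D \<noteq> {}"
proof (induction "card D" arbitrary: D)
  case 0
  then have "D = {}" using young_diagram_finite by auto
  then have "(\<lambda>_. 0) \<in> SYT D"
    using tableaux_0 by (auto simp: SYT_def tableaux_def shape_def)
  then show ?case by auto
next
  case (Suc n)
  then have "D \<noteq> {}" by auto
  then obtain d where d: "d \<in> inner_corners D"
    using inner_corner_exists Suc.prems by blast
  have "young_diagram (D - {d})" "n = card (D - {d})"
    using d Suc young_diagram_finite[OF Suc.prems] by (auto simp: inner_corners_def)
  then obtain T where "T \<in> SYT (D - {d})" using Suc.hyps(1) by blast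
  then show ?case using SYT_extend(1)[OF Suc.prems d] by auto
qed

lemma SYT_empty [simp]: "SYT {} = {\<lambda>_. 0}"
  using SYT_eq[of "{}"] tableaux_0 by (auto simp: shape_def)

text \<open>With \<open>f\<close> counting standard tableaux, this is the half needed here of the
  identity that \<open>f (insert b D)\<close>, summed over the outer corners, equals
  \<open>Suc (card D) * f D\<close>. Expanding \<open>f (insert b D)\<close> by the box of the
  largest entry returns \<open>f D\<close> once for each outer corner; the other terms are compared
  with the induction hypothesis at \<open>D - {d}\<close>, and the balance closes because outer
  corners outnumber inner ones by at most one.\<close>

lemma sum_card_SYT_insert_le:
  assumes "young_diagram D"
  shows "(\<Sum>b\<in>outer_corners D. card (SYT (insert b D))) \<le> Suc (card D) * card (SYT D)"
  using assms
proof (induction "card D" arbitrary: D)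
  case 0
  then have D: "D = {}" using young_diagram_finite by auto
  have "inner_corners {(0, 0)} = {(0, 0)}" by (auto simp: inner_corners_def)
  moreover have "young_diagram {(0, 0)}" by (auto simp: young_diagram_def)
  ultimately show ?case
    using card_SYT_rec[of "{(0, 0)}"] by (simp add: D)
next
  case (Suc n)
  note D = Suc.prems
  have fin: "finite D" "D \<noteq> {}" using Suc.hyps(2) young_diagram_finite[OF D] by auto
  let ?f = "\<lambda>D. card (SYT D)"
  let ?P = "SIGMA b:outer_corners D. inner_corners (insert b D) - {b}"
  let ?Q = "SIGMA d:inner_corners D. outer_corners (D - {d}) - {d}"
  have ins: "?f (insert b D) = ?f D + (\<Sum>d\<in>inner_corners (insert b D) - {b}. ?f (insert b (D - {d})))"
    if b: "b \<in> outer_corners D" for b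
  proof -
    have nb: "b \<notin> D" "young_diagram (insert b D)" using outer_cornersD[OF b] by auto
    have "?f (insert b D) = (\<Sum>d\<in>inner_corners (insert b D). ?f (insert b D - {d}))"
      by (rule card_SYT_rec) (use nb in auto)
    also have "\<dots> = ?f (insert b D - {b}) + (\<Sum>d\<in>inner_corners (insert b D) - {b}. ?f (insert b D - {d}))"
      using outer_corner_inner[OF D b] fin by (subst sum.remove[of _ b]) auto
    also have "insert b D - {b} = D" using nb by auto
    also have "(\<Sum>d\<in>inner_corners (insert b D) - {b}. ?f (insert b D - {d}))
        = (\<Sum>d\<in>inner_corners (insert b D) - {b}. ?f (insert b (D - {d})))"
      by (intro sum.cong refl arg_cong[of _ _ ?f]) auto
    finally show ?thesis .
  qed
  \<comment> \<open>The diagrams \<open>D\<close> and \<open>insert b D - {d}\<close> intersect in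
    \<open>D - {d}\<close>, so \<open>d\<close> can be removed before \<open>b\<close> is
    added.\<close>
  have PQ: "(d, b) \<in> ?Q" if "(b, d) \<in> ?P" for b d
  proof -
    from that have b: "b \<in> outer_corners D" and d: "d \<in> D" "young_diagram (insert b D - {d})" "d \<noteq> b"
      by (auto simp: inner_corners_def)
    have "D \<inter> (insert b D - {d}) = D - {d}" using outer_cornersD(1)[OF b] d by auto
    moreover have "young_diagram (D \<inter> (insert b D - {d}))"
      by (rule young_diagram_Int[OF D d(2)])
    ultimately have "young_diagram (D - {d})" by simp
    moreover have "insert b (D - {d}) = insert b D - {d}" using d by auto
    ultimately show ?thesis
      using d outer_cornersD(1)[OF b] by (auto simp: inner_corners_def outer_corners_def)
  qed
  have "(\<Sum>b\<in>outer_corners D. ?f (insert b D))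
      = card (outer_corners D) * ?f D + (\<Sum>b\<in>outer_corners D. \<Sum>d\<in>inner_corners (insert b D) - {b}. ?f (insert b (D - {d})))"
    by (simp add: ins sum.distrib)
  also have "(\<Sum>b\<in>outer_corners D. \<Sum>d\<in>inner_corners (insert b D) - {b}. ?f (insert b (D - {d})))
      = (\<Sum>(b, d)\<in>?P. ?f (insert b (D - {d})))"
    using fin by (intro sum.Sigma) auto
  also have "\<dots> = (\<Sum>(d, b)\<in>prod.swap ` ?P. ?f (insert b (D - {d})))"
    by (subst sum.reindex) (auto simp: inj_on_def intro!: sum.cong)
  also have "\<dots> \<le> (\<Sum>(d, b)\<in>?Q. ?f (insert b (D - {d})))"
  proof (rule sum_mono2)
    show "finite ?Q" using fin by (intro finite_SigmaI) auto
    show "prod.swap ` ?P \<subseteq> ?Q" using PQ by (metis (no_types, lifting) image_subsetI prod.collapse swap_simp)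
  qed simp
  also have "\<dots> = (\<Sum>d\<in>inner_corners D. \<Sum>b\<in>outer_corners (D - {d}) - {d}. ?f (insert b (D - {d})))"
    using fin by (intro sum.Sigma[symmetric]) auto
  finally have 1: "(\<Sum>b\<in>outer_corners D. ?f (insert b D)) \<le> card (outer_corners D) * ?f D
      + (\<Sum>d\<in>inner_corners D. \<Sum>b\<in>outer_corners (D - {d}) - {d}. ?f (insert b (D - {d})))"
    by simp
  \<comment> \<open>In the induction hypothesis for \<open>D - {d}\<close> the outer corner
    \<open>d\<close> itself contributes \<open>?f D\<close>, which is split off.\<close>
  have "(\<Sum>b\<in>outer_corners (D - {d}) - {d}. ?f (insert b (D - {d}))) + ?f D \<le> card D * ?f (D - {d})"
    if d: "d \<in> inner_corners D" for d
  proof -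
    have dD: "d \<in> D" "young_diagram (D - {d})" using d by (auto simp: inner_corners_def)
    have "(\<Sum>b\<in>outer_corners (D - {d}). ?f (insert b (D - {d}))) \<le> Suc (card (D - {d})) * ?f (D - {d})"
      by (rule Suc.hyps(1)) (use dD fin Suc.hyps(2) in auto)
    moreover have "(\<Sum>b\<in>outer_corners (D - {d}). ?f (insert b (D - {d})))
        = ?f (insert d (D - {d})) + (\<Sum>b\<in>outer_corners (D - {d}) - {d}. ?f (insert b (D - {d})))"
      by (rule sum.remove) (use fin inner_corner_outer[OF D d] in auto)
    moreover have "insert d (D - {d}) = D" "Suc (card (D - {d})) = card D"
      using dD(1) card.remove[OF fin(1) dD(1)] by (blast, simp only:)
    ultimately show ?thesis by simp
  qed
  then have "(\<Sum>d\<in>inner_corners D. (\<Sum>b\<in>outer_corners (D - {d}) - {d}. ?f (insert b (D - {d}))) + ?f D)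
      \<le> (\<Sum>d\<in>inner_corners D. card D * ?f (D - {d}))"
    by (rule sum_mono)
  also have "\<dots> = card D * ?f D"
    using card_SYT_rec[OF D fin(2)] by (simp add: sum_distrib_left)
  finally have 2: "(\<Sum>d\<in>inner_corners D. \<Sum>b\<in>outer_corners (D - {d}) - {d}. ?f (insert b (D - {d})))
      + card (inner_corners D) * ?f D \<le> card D * ?f D"
    by (simp add: sum.distrib)
  have "card (outer_corners D) * ?f D \<le> (card (inner_corners D) + 1) * ?f D"
    by (rule mult_right_mono[OF card_outer_corners_le[OF D]]) simp
  with 1 2 show ?case by (simp add: algebra_simps)
qed

text \<open>The cardinality is the sum over all shapes of the squared number of tableaux; each
  further box multiplies it by at most \<open>Suc n\<close>.\<close>

lemma card_tableau_pairs_le: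
  "card (SIGMA S:tableaux n. {T \<in> tableaux n. shape S = shape T}) \<le> fact n"
proof -
  have "(\<Sum>T\<in>tableaux n. card (SYT (shape T))) \<le> fact n"
  proof (induction n)
    case (Suc n)
    have "(\<Sum>T\<in>tableaux (Suc n). card (SYT (shape T)))
        = (\<Sum>T\<in>tableaux n. \<Sum>b\<in>outer_corners (shape T). card (SYT (insert b (shape T))))"
      by (simp add: sum_tableaux_Suc shape_fun_upd)
    also have "\<dots> \<le> (\<Sum>T\<in>tableaux n. Suc n * card (SYT (shape T)))"
    proof (rule sum_mono)
      fix T assume "T \<in> tableaux n"
      then have "standard_tableau n T" by (simp add: tableaux_def)
      from sum_card_SYT_insert_le[OF standard_tableau_shape(1)[OF this]] standard_tableau_shape(3)[OF this]
      show "(\<Sum>b\<in>outer_corners (shape T). card (SYT (insert b (shape T)))) \<le> Suc n * card (SYT (shape T))"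
        by simp
    qed
    also have "\<dots> \<le> Suc n * fact n"
      using Suc by (simp only: sum_distrib_left[symmetric] mult_le_mono2)
    finally show ?case by simp
  qed (simp add: tableaux_0 shape_def)
  moreover have "{T \<in> tableaux n. shape S = shape T} = SYT (shape S)" if "S \<in> tableaux n" for S
    using that standard_tableau_shape[of n S] by (auto simp: SYT_def tableaux_def)
  ultimately show ?thesis
    by simp
qed

section \<open>Jucys--Murphy elements\<close>

lemma poly_at_altdef:
  assumes "degree p \<le> n"
  shows "poly_at p x = (\<Sum>i\<le>n. cscale (coeff p i) (x ^ i))"
  unfolding poly_at_def
  by (rule sum.mono_neutral_left) (use assms in \<open>auto simp: coeff_eq_0\<close>)

lemma poly_at_0 [simp]: "poly_at 0 x = 0"
  by (simp add: poly_at_def)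

lemma poly_at_pCons: "poly_at (pCons a p) x = cscale a 1 + x * poly_at p x"
proof -
  have "poly_at (pCons a p) x = (\<Sum>i\<le>Suc (degree p). cscale (coeff (pCons a p) i) (x ^ i))"
    by (rule poly_at_altdef) (rule degree_pCons_le)
  also have "\<dots> = cscale a 1 + (\<Sum>i\<le>degree p. cscale (coeff p i) (x ^ Suc i))"
    unfolding sum.atMost_Suc_shift by simp
  also have "\<dots> = cscale a 1 + x * poly_at p x"
    by (simp add: poly_at_def sum_distrib_left)
  finally show ?thesis .
qed

lemma poly_at_1 [simp]: "poly_at 1 x = 1"
  by (simp add: one_pCons poly_at_pCons)

lemma poly_at_linear: "poly_at [:a, 1:] x = cscale a 1 + x"
  by (simp add: poly_at_pCons)

lemma poly_at_add: "poly_at (p + q) x = poly_at p x + poly_at q x"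
proof -
  have "poly_at (p + q) x = (\<Sum>i\<le>max (degree p) (degree q). cscale (coeff (p + q) i) (x ^ i))"
    by (rule poly_at_altdef) (rule degree_add_le_max)
  then show ?thesis
    by (simp add: poly_at_altdef[of p "max (degree p) (degree q)"]
        poly_at_altdef[of q "max (degree p) (degree q)"] sum.distrib cvec.scale_left_distrib)
qed

lemma poly_at_smult: "poly_at (smult c p) x = cscale c (poly_at p x)"
proof -
  have "poly_at (smult c p) x = (\<Sum>i\<le>degree p. cscale (coeff (smult c p) i) (x ^ i))"
    by (rule poly_at_altdef) (rule degree_smult_le)
  then show ?thesis
    by (simp add: poly_at_def cvec.scale_sum_right)
qed

lemma poly_at_mult: "poly_at (p * q) x = poly_at p x * poly_at q x"
  by (induction p)
     (simp_all add: poly_at_add poly_at_smult poly_at_pCons distrib_right mult.assoc)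

lemma poly_at_sum: "poly_at (\<Sum>i\<in>I. f i) x = (\<Sum>i\<in>I. poly_at (f i) x)"
  by (induction I rule: infinite_finite_induct) (auto simp: poly_at_add)

lemma poly_at_intertwine:
  assumes "a * x = y * a"
  shows "a * poly_at p x = poly_at p y * a"
proof (induction p)
  case (pCons c p)
  have "a * (x * poly_at p x) = y * (a * poly_at p x)"
    by (simp add: assms flip: mult.assoc)
  with pCons show ?case
    by (simp add: poly_at_pCons distrib_left distrib_right mult.assoc)
qed simp

lemma poly_at_eigen_right:
  assumes "v * x = cscale c v"
  shows "v * poly_at p x = cscale (poly p c) v"
proof (induction p)
  case (pCons a p)
  have "v * (x * poly_at p x) = cscale c (v * poly_at p x)"
    by (simp add: assms flip: mult.assoc)
  with pCons show ?case
    by (simp add: poly_at_pCons distrib_left cvec.scale_left_distrib)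
qed simp

lemma poly_at_in_CS [intro]: "x \<in> CS n \<Longrightarrow> poly_at p x \<in> CS n"
  unfolding poly_at_def by auto

section \<open>Relations between Jucys-Murphy elements and permutations\<close>

lemma JM_in_CS: "k \<le> n \<Longrightarrow> JM k \<in> CS n"
  unfolding JM_def by (intro CS_sum) (auto intro: swap_in_Sym)

lemma perm_mult_swap: "\<sigma> * Perm.swap i j = Perm.swap (Perm.apply \<sigma> i) (Perm.apply \<sigma> j) * \<sigma>"
proof (rule perm_eqI)
  fix x
  show "Perm.apply (\<sigma> * Perm.swap i j) x
      = Perm.apply (Perm.swap (Perm.apply \<sigma> i) (Perm.apply \<sigma> j) * \<sigma>) x"
    by (cases "x = i"; cases "x = j") (auto simp: apply_times apply_inj)
qed

text \<open>Conjugation by \<open>\<sigma>\<close> fixes \<open>Suc n\<close> and permutes the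
  transpositions summed in \<open>JM (Suc n)\<close>.\<close>

lemma gelem_JM_commute:
  assumes "\<sigma> \<in> Sym n"
  shows "gelem \<sigma> * JM (Suc n) = JM (Suc n) * gelem \<sigma>"
proof -
  have bij: "bij_betw (Perm.apply \<sigma>) {1..<Suc n} {1..<Suc n}"
    using apply_image_Sym[of n] assms permutes_imp_bij[of "Perm.apply \<sigma>" "{1..n}"]
    by (auto simp: atLeastLessThanSuc_atLeastAtMost)
  have "gelem \<sigma> * JM (Suc n) = (\<Sum>j\<in>{1..<Suc n}. gelem (Perm.swap (Perm.apply \<sigma> j) (Suc n)) * gelem \<sigma>)"
    unfolding JM_def sum_distrib_left
    using Sym_apply_fixed[OF assms, of "Suc n"] by (simp add: perm_mult_swap flip: gelem_mult)
  also have "\<dots> = (\<Sum>j\<in>{1..<Suc n}. gelem (Perm.swap j (Suc n)) * gelem \<sigma>)"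
    by (rule sum.reindex_bij_betw[OF bij])
  finally show ?thesis
    by (simp only: JM_def sum_distrib_right)
qed

lemma CS_JM_commute:
  assumes "a \<in> CS m" "m < k"
  shows "a * JM k = JM k * a"
proof -
  obtain n where k: "k = Suc n" "m \<le> n" using assms(2) by (cases k) auto
  have "a \<in> CS n" using CS_mono'[OF assms(1) k(2)] .
  then show ?thesis
    unfolding k(1)
    by (induction rule: CS_induct) (auto simp: gelem_JM_commute distrib_left distrib_right)
qed

lemma JM_JM_commute: "JM i * JM j = JM j * JM i"
proof -
  have "JM i * JM j = JM j * JM i" if "i < j" for i j
    using that by (intro CS_JM_commute[OF JM_in_CS]) auto
  from this[of i j] this[of j i] show ?thesis by (cases i j rule: linorder_cases) auto
qed

definition adj_swap :: "nat \<Rightarrow> galg" where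
  "adj_swap n = gelem (Perm.swap n (Suc n))"

lemma adj_swap_square [simp]: "adj_swap n * adj_swap n = 1"
  by (simp add: adj_swap_def flip: gelem_mult)

lemma star_adj_swap [simp]: "star (adj_swap n) = adj_swap n"
  by (simp add: adj_swap_def)

lemma adj_swap_commute:
  assumes "a \<in> CS m" "m < n"
  shows "a * adj_swap n = adj_swap n * a"
  using assms(1)
proof (induction rule: CS_induct)
  case (gelem c \<sigma>)
  have "affected (Perm.swap n (Suc n)) \<inter> affected \<sigma> = {}"
    using gelem assms(2) by (auto simp: affected_swap Sym_def)
  then have "gelem (\<sigma> * Perm.swap n (Suc n)) = gelem (Perm.swap n (Suc n) * \<sigma>)"
    by (rule arg_cong[OF perm_mult_commute])
  then show ?case
    by (simp add: adj_swap_def gelem_mult)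
qed (auto simp: distrib_left distrib_right)

lemma adj_swap_braid: "adj_swap n * adj_swap (Suc n) * adj_swap n = adj_swap (Suc n) * adj_swap n * adj_swap (Suc n)"
proof -
  have "Perm.swap n (Suc n) * Perm.swap (Suc n) (Suc (Suc n)) * Perm.swap n (Suc n)
      = Perm.swap (Suc n) (Suc (Suc n)) * Perm.swap n (Suc n) * Perm.swap (Suc n) (Suc (Suc n))"
  proof (rule perm_eqI)
    fix x
    consider "x = n" | "x = Suc n" | "x = Suc (Suc n)" | "x \<noteq> n" "x \<noteq> Suc n" "x \<noteq> Suc (Suc n)"
      by blast
    then show "Perm.apply (Perm.swap n (Suc n) * Perm.swap (Suc n) (Suc (Suc n)) * Perm.swap n (Suc n)) x
      = Perm.apply (Perm.swap (Suc n) (Suc (Suc n)) * Perm.swap n (Suc n) * Perm.swap (Suc n) (Suc (Suc n))) x"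
      by cases (simp_all add: apply_times)
  qed
  then show ?thesis by (simp add: adj_swap_def flip: gelem_mult)
qed

text \<open>All four are forms of \<open>s * JM n * s = JM (Suc n) - s\<close> with \<open>s\<close>
  the adjacent transposition: conjugation by \<open>s\<close> turns each swap of \<open>j\<close>
  and \<open>n\<close> into that of \<open>j\<close> and \<open>Suc n\<close>, and
  \<open>JM (Suc n)\<close> has \<open>s\<close> itself as one more summand. Taking adjoints
  exchanges the order of the factors.\<close>

lemma adj_swap_JM:
  assumes "1 \<le> n"
  shows "adj_swap n * JM n = JM (Suc n) * adj_swap n - 1"
    and "adj_swap n * JM (Suc n) = JM n * adj_swap n + 1"
    and "JM n * adj_swap n = adj_swap n * JM (Suc n) - 1"
    and "JM (Suc n) * adj_swap n = adj_swap n * JM n + 1"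
proof -
  have "adj_swap n * JM n = (\<Sum>j\<in>{1..<n}. gelem (Perm.swap j (Suc n)) * adj_swap n)"
    unfolding JM_def sum_distrib_left adj_swap_def
    by (rule sum.cong) (simp_all add: perm_mult_swap[of "Perm.swap n (Suc n)"] flip: gelem_mult)
  moreover have "JM (Suc n) = (\<Sum>j\<in>{1..<n}. gelem (Perm.swap j (Suc n))) + adj_swap n"
    using assms by (simp add: JM_def adj_swap_def)
  ultimately show 1: "adj_swap n * JM n = JM (Suc n) * adj_swap n - 1"
    by (simp add: distrib_right sum_distrib_right)
  have "star (adj_swap n * JM n) = star (JM (Suc n) * adj_swap n - 1)" by (simp add: 1)
  then show 3: "JM n * adj_swap n = adj_swap n * JM (Suc n) - 1"
    using star.antiaut_gelem[of 1] by (simp add: star.antiaut_mult star.antiaut_diff)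
  show "adj_swap n * JM (Suc n) = JM n * adj_swap n + 1" "JM (Suc n) * adj_swap n = adj_swap n * JM n + 1"
    by (simp_all add: 1 3)
qed

text \<open>These are the two double cosets of \<open>Sym n\<close> in \<open>Sym (Suc n)\<close>,
  told apart by whether \<open>Suc n\<close> is fixed.\<close>

lemma Sym_Suc_cases:
  assumes "1 \<le> n" "\<sigma> \<in> Sym (Suc n)"
  obtains "\<sigma> \<in> Sym n"
    | \<alpha> \<beta> where "\<alpha> \<in> Sym n" "\<beta> \<in> Sym n" "\<sigma> = \<alpha> * Perm.swap n (Suc n) * \<beta>"
proof (cases "Perm.apply \<sigma> (Suc n) = Suc n")
  case True
  have "\<sigma> \<in> Sym n"
    unfolding Sym_def
  proof clarify
    fix x assume x: "x \<in> affected \<sigma>"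
    then have "x \<in> {1..Suc n}" "x \<noteq> Suc n" using assms(2) True by (auto simp: Sym_def in_affected)
    then show "x \<in> {1..n}" by auto
  qed
  then show ?thesis by (rule that(1))
next
  case False
  let ?j = "Perm.apply \<sigma> (Suc n)"
  have j: "?j \<in> {1..n}" using Sym_apply_in[OF assms(2), of "Suc n"] False by auto
  let ?\<alpha> = "Perm.swap ?j n" and ?s = "Perm.swap n (Suc n)"
  \<comment> \<open>The product \<open>?\<alpha> * ?s\<close> sends \<open>Suc n\<close> to the same
    point as \<open>\<sigma>\<close>; \<open>?\<beta>\<close> is its inverse times
    \<open>\<sigma>\<close> and hence fixes \<open>Suc n\<close>.\<close>
  let ?\<beta> = "?s * ?\<alpha> * \<sigma>"
  have \<alpha>: "?\<alpha> \<in> Sym n" using j assms(1) by (intro swap_in_Sym) auto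
  have s: "?s \<in> Sym (Suc n)" using assms(1) by (intro swap_in_Sym) auto
  have "?\<beta> \<in> Sym (Suc n)" using \<alpha> s assms(2) Sym_mono[of n "Suc n"] by (intro Sym_mult) auto
  moreover have "Perm.apply ?\<beta> (Suc n) = Suc n" by (simp add: apply_times)
  ultimately have \<beta>: "?\<beta> \<in> Sym n"
    unfolding Sym_def by (clarsimp simp: in_affected) (metis atLeastAtMost_iff in_affected le_Suc_eq subset_iff Suc_eq_plus1 One_nat_def)
  have "?\<alpha> * ?s * ?\<beta> = ?\<alpha> * (?s * ?s) * (?\<alpha> * \<sigma>)" by (simp only: mult.assoc)
  also have "\<dots> = (?\<alpha> * ?\<alpha>) * \<sigma>" by (simp only: swap_self[of n] mult_1_right mult.assoc)
  finally have "\<sigma> = ?\<alpha> * ?s * ?\<beta>" by simp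
  with \<alpha> \<beta> show ?thesis by (rule that(2))
qed

text \<open>Linear form of the double coset decomposition; it reduces statements about
  \<open>CS (Suc n)\<close> to elements with a single occurrence of the new transposition.\<close>

lemma CS_Suc_induct [consumes 2, case_names add lower adj_swap]:
  assumes "1 \<le> n" "a \<in> CS (Suc n)"
    and add: "\<And>a b. P a \<Longrightarrow> P b \<Longrightarrow> P (a + b)"
    and lower: "\<And>a. a \<in> CS n \<Longrightarrow> P a"
    and adj_swap: "\<And>a b. a \<in> CS n \<Longrightarrow> b \<in> CS n \<Longrightarrow> P (a * adj_swap n * b)"
  shows "P a"
  using assms(2)
proof (induction rule: CS_induct)
  case zero
  show ?case by (rule lower) simp
next
  case (gelem c \<sigma>)
  from \<open>1 \<le> n\<close> gelem show ?case
  proof (cases rule: Sym_Suc_cases)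
    case 1
    then show ?thesis by (intro lower) auto
  next
    case (2 \<alpha> \<beta>)
    then have "P (cscale c (gelem \<alpha>) * adj_swap n * gelem \<beta>)" by (intro adj_swap) auto
    then show ?thesis using 2 by (simp add: adj_swap_def gelem_mult)
  qed
qed (rule add)

section \<open>Projectors\<close>

abbreviation ccont :: "box \<Rightarrow> complex" where
  "ccont b \<equiv> of_int (cont b)"

text \<open>Its roots are the values that \<open>JM (Suc n)\<close> may take on the projector of a
  tableau of shape \<open>D\<close>; that it annihilates \<open>JM (Suc n)\<close> there is the
  statement \<open>killed\<close>.\<close>

definition corner_poly :: "box set \<Rightarrow> complex poly" where
  "corner_poly D = (\<Prod>b\<in>outer_corners D. [:- ccont b, 1:])"

text \<open>The Lagrange basis polynomial for the contents of the outer corners, that is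
  \<open>step_poly\<close> expressed by a diagram and a corner only.\<close>

definition lagrange :: "box set \<Rightarrow> box \<Rightarrow> complex poly" where
  "lagrange D b = (\<Prod>b'\<in>outer_corners D - {b}. smult (1 / of_int (cont b - cont b')) [:- ccont b', 1:])"

lemma outer_corners_nonempty:
  assumes "young_diagram D"
  shows "outer_corners D \<noteq> {}"
proof -
  have "infinite (range (\<lambda>m::nat. (0::nat, m)))"
    by (rule range_inj_infinite) (auto simp: inj_on_def)
  then have "\<exists>m. (0, m) \<notin> D"
    using young_diagram_finite[OF assms] by (metis finite_subset image_subsetI)
  define m where "m = (LEAST m. (0, m) \<notin> D)"
  have m: "(0, m) \<notin> D" "\<And>i. i < m \<Longrightarrow> (0, i) \<in> D"
    using LeastI_ex[OF \<open>\<exists>m. _\<close>] not_less_Least unfolding m_def by blast+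
  have "young_diagram (insert (0, m) D)"
    unfolding young_diagram_def
  proof (intro conjI allI impI)
    show "finite (insert (0, m) D)" using young_diagram_finite[OF assms] by simp
    fix r c r' c' assume *: "(r, c) \<in> insert (0, m) D \<and> r' \<le> r \<and> c' \<le> c"
    then consider "(r, c) \<in> D" | "r = 0" "c = m" by auto
    then show "(r', c') \<in> insert (0, m) D"
    proof cases
      case 1
      then show ?thesis using * young_diagramD[OF assms] by blast
    next
      case 2
      then show ?thesis using * m(2)[of c'] by (cases "c' = m") auto
    qed
  qed
  with m(1) have "(0, m) \<in> outer_corners D" by (simp add: outer_corners_def)
  then show ?thesis by blast
qed

lemma poly_lagrange:
  assumes "finite D" "b \<in> outer_corners D" "d \<in> outer_corners D"
  shows "poly (lagrange D b) (ccont d) = (if d = b then 1 else 0)"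
proof (cases "d = b")
  case True
  have "poly (smult (1 / of_int (cont b - cont b')) [:- ccont b', 1:]) (ccont b) = 1"
    if "b' \<in> outer_corners D - {b}" for b'
  proof -
    have "cont b \<noteq> cont b'" using that assms inj_on_cont_outer_corners[of D] by (auto simp: inj_on_def)
    then have "ccont b - ccont b' \<noteq> 0" by (simp only: right_minus_eq of_int_eq_iff not_False_eq_True)
    then show ?thesis by (simp add: diff_divide_distrib[symmetric])
  qed
  then show ?thesis
    unfolding lagrange_def poly_prod True by (simp only: prod.neutral_const cong: prod.cong) simp
next
  case False
  then show ?thesis
    using assms by (auto simp: lagrange_def poly_prod)
qed

text \<open>Supplying the one missing root completes the interpolation polynomial to a multiple of
  \<open>corner_poly\<close>; in this way annihilation by \<open>corner_poly\<close> becomes an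
  eigenvector equation for the projector.\<close>

lemma lagrange_mult_linear:
  assumes "finite D" "b \<in> outer_corners D"
  obtains c where "lagrange D b * [:- ccont b, 1:] = smult c (corner_poly D)"
proof
  have "lagrange D b = smult (\<Prod>b'\<in>outer_corners D - {b}. 1 / of_int (cont b - cont b'))
      (\<Prod>b'\<in>outer_corners D - {b}. [:- ccont b', 1:])"
    unfolding lagrange_def by (rule prod_smult)
  moreover have "corner_poly D = [:- ccont b, 1:] * (\<Prod>b'\<in>outer_corners D - {b}. [:- ccont b', 1:])"
    unfolding corner_poly_def by (rule prod.remove) (use assms in auto)
  ultimately show "lagrange D b * [:- ccont b, 1:]
      = smult (\<Prod>b'\<in>outer_corners D - {b}. 1 / of_int (cont b - cont b')) (corner_poly D)"
    by (simp add: mult.commute)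
qed

lemma degree_lagrange_less:
  assumes "finite D" "b \<in> outer_corners D"
  shows "degree (lagrange D b) < card (outer_corners D)"
proof -
  have "degree (lagrange D b) \<le> (\<Sum>b'\<in>outer_corners D - {b}. degree (smult (1 / of_int (cont b - cont b')) [:- ccont b', 1:]))"
    unfolding lagrange_def by (rule degree_prod_sum_le[unfolded o_def]) (use assms in auto)
  also have "\<dots> \<le> (\<Sum>b'\<in>outer_corners D - {b}. 1)"
    by (rule sum_mono) auto
  also have "\<dots> < card (outer_corners D)"
  proof -
    have "card (outer_corners D) > 0" using assms by (auto simp: card_gt_0_iff)
    then show ?thesis using assms by simp
  qed
  finally show ?thesis .
qed

text \<open>Both sides agree at the distinct contents of the outer corners, and both degrees are
  smaller than the number of these.\<close>

lemma sum_lagrange: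
  assumes "young_diagram D"
  shows "(\<Sum>b\<in>outer_corners D. lagrange D b) = 1"
proof (rule poly_eqI_degree)
  have fin: "finite D" using young_diagram_finite[OF assms] .
  have card: "card (ccont ` outer_corners D) = card (outer_corners D)"
    using inj_on_cont_outer_corners[of D] by (intro card_image) (auto simp: inj_on_def)
  have pos: "card (outer_corners D) > 0"
    using fin outer_corners_nonempty[OF assms] by (simp add: card_gt_0_iff)
  show "poly (\<Sum>b\<in>outer_corners D. lagrange D b) x = poly 1 x" if "x \<in> ccont ` outer_corners D" for x
  proof -
    from that obtain d where d: "d \<in> outer_corners D" "x = ccont d" by auto
    have "poly (\<Sum>b\<in>outer_corners D. lagrange D b) x = (\<Sum>b\<in>outer_corners D. if d = b then 1 else 0)"
      unfolding poly_sum d(2) by (rule sum.cong) (use fin d poly_lagrange in auto)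
    also have "\<dots> = 1" using fin d(1) by simp
    finally show ?thesis by simp
  qed
  have "degree (\<Sum>b\<in>outer_corners D. lagrange D b) \<le> card (outer_corners D) - 1"
    by (rule degree_sum_le) (use fin degree_lagrange_less in force)+
  then show "degree (\<Sum>b\<in>outer_corners D. lagrange D b) < card (ccont ` outer_corners D)"
    using pos card by linarith
  show "degree (1 :: complex poly) < card (ccont ` outer_corners D)"
    using pos card by simp
qed

lemma step_poly_Suc: "step_poly T (Suc n) = lagrange (shape (subtableau T n)) (box_of T (Suc n))"
  by (simp add: step_poly_def lagrange_def)

lemma projector_Suc:
  assumes T: "standard_tableau (Suc n) T"
  shows "projector T = projector (subtableau T n) *
    poly_at (lagrange (shape (subtableau T n)) (box_of T (Suc n))) (JM (Suc n))"
proof -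
  have U: "standard_tableau n (subtableau T n)"
    using standard_tableau_subtableau[OF T, of n] by simp
  have sp: "step_poly (subtableau T n) k = step_poly T k" if "k \<in> {1..n}" for k
  proof -
    have "k - 1 \<le> n" using that by (simp add: le_diff_conv)
    then show ?thesis
      using box_of_subtableau[OF T that] subtableau_subtableau[of "k - 1" n T]
      by (simp only: step_poly_def)
  qed
  show ?thesis
  proof (cases "n = 0")
    \<comment> \<open>Here the factor to be split off is absent from \<open>projector\<close>, whose
      product starts at 2; correspondingly \<open>lagrange\<close> is an empty product, the origin
      being the only outer corner of the empty diagram.\<close>
    case True
    have "shape (subtableau T 0) = {}" by (auto simp: shape_def subtableau_def)
    then show ?thesis
      using box_of_last_outer[OF T] standard_tableau_shape(3)[OF T] standard_tableau_shape(3)[OF U] True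
      by (simp add: projector_def lagrange_def)
  next
    case False
    then have upt: "[2..<Suc n + 1] = [2..<n + 1] @ [Suc n]"
      using upt_Suc_append[of 2 "Suc n"] by simp
    have map: "map (\<lambda>k. poly_at (step_poly T k) (JM k)) [2..<n + 1]
        = map (\<lambda>k. poly_at (step_poly (subtableau T n) k) (JM k)) [2..<n + 1]"
      by (rule map_cong) (use sp in auto)
    show ?thesis
      unfolding projector_def standard_tableau_shape(3)[OF T] standard_tableau_shape(3)[OF U]
        upt map_append prod_list.append map
      by (simp add: step_poly_Suc)
  qed
qed

lemma projector_0 [simp]: "projector (\<lambda>_. 0) = 1"
  by (simp add: projector_def shape_def)

lemma projector_extend:
  assumes "standard_tableau n T" "b \<in> outer_corners (shape T)"
  shows "projector (T(b := Suc n)) = projector T * poly_at (lagrange (shape T) b) (JM (Suc n))"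
  using projector_Suc[OF standard_tableau_extend[OF assms]]
  by (simp add: subtableau_extend[OF assms] box_of_extend[OF assms])

lemma commute_mult:
  fixes a b c :: "'a :: semigroup_mult"
  assumes "a * b = b * a" "a * c = c * a"
  shows "a * (b * c) = b * c * a"
proof -
  have "a * (b * c) = b * (a * c)" by (simp only: assms(1) flip: mult.assoc)
  then show ?thesis by (simp only: assms(2) mult.assoc)
qed

abbreviation weight :: "tableau \<Rightarrow> nat \<Rightarrow> complex" where
  "weight T i \<equiv> ccont (box_of T i)"

lemma projector_in_CS: "standard_tableau n T \<Longrightarrow> projector T \<in> CS n"
proof (induction n arbitrary: T)
  case 0
  then have "T = (\<lambda>_. 0)" using tableaux_0 by (auto simp: tableaux_def)
  then show ?case by simp
next
  case (Suc n)
  have "projector (subtableau T n) \<in> CS n"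
    by (rule Suc.IH) (rule standard_tableau_subtableau[OF Suc.prems], simp)
  then have "projector (subtableau T n) \<in> CS (Suc n)" by (rule CS_mono') simp
  then show ?case
    unfolding projector_Suc[OF Suc.prems] by (intro CS_mult poly_at_in_CS JM_in_CS) auto
qed

lemma projector_commute:
  assumes "\<And>i. a * JM i = JM i * a"
  shows "a * projector T = projector T * a"
proof -
  have *: "a * prod_list xs = prod_list xs * a" if "\<And>x. x \<in> set xs \<Longrightarrow> a * x = x * a" for xs
    using that by (induction xs) (auto intro: commute_mult)
  show ?thesis
    unfolding projector_def by (rule *) (auto intro!: poly_at_intertwine assms)
qed

lemma projector_JM_commute: "projector T * JM i = JM i * projector T"
  by (rule projector_commute[OF JM_JM_commute, symmetric])

lemma projector_projector_commute: "projector S * projector T = projector T * projector S"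
  by (rule projector_commute) (rule projector_JM_commute)

text \<open>Evaluating the Lagrange polynomials at the weight: distinct tableaux part ways at some first
  step, where the weight of one is a root of the factor of the other.\<close>

lemma right_weight_mult_projector:
  assumes "standard_tableau n T" "standard_tableau n S"
    and "\<And>i. i \<in> {1..n} \<Longrightarrow> v * JM i = cscale (weight T i) v"
  shows "v * projector S = (if S = T then v else 0)"
  using assms
proof (induction n arbitrary: S T)
  case 0
  then have "S = (\<lambda>_. 0)" "T = (\<lambda>_. 0)" using tableaux_0 by (auto simp: tableaux_def)
  then show ?case by simp
next
  case (Suc n)
  let ?T = "subtableau T n" and ?S = "subtableau S n"
  have st: "standard_tableau n ?T" "standard_tableau n ?S"
    using standard_tableau_subtableau[of "Suc n" _ n] Suc.prems by auto
  have IH: "v * projector ?S = (if ?S = ?T then v else 0)"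
    by (rule Suc.IH[OF st]) (use Suc.prems(3) box_of_subtableau[OF Suc.prems(1), of _ n] in auto)
  have "v * projector S = v * projector ?S * poly_at (lagrange (shape ?S) (box_of S (Suc n))) (JM (Suc n))"
    by (simp add: projector_Suc[OF Suc.prems(2)] mult.assoc)
  also have "\<dots> = (if S = T then v else 0)"
  proof (cases "?S = ?T")
    case True
    have "poly (lagrange (shape ?S) (box_of S (Suc n))) (weight T (Suc n))
        = (if box_of T (Suc n) = box_of S (Suc n) then 1 else 0)"
      using box_of_last_outer[OF Suc.prems(1)] box_of_last_outer[OF Suc.prems(2)] True
        standard_tableau_shape(2)[OF st(2)]
      by (intro poly_lagrange) auto
    moreover have "box_of T (Suc n) = box_of S (Suc n) \<longleftrightarrow> S = T"
      using extend_subtableau[OF Suc.prems(1)] extend_subtableau[OF Suc.prems(2)] True by metis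
    ultimately show ?thesis
      using IH True poly_at_eigen_right[OF Suc.prems(3)[of "Suc n"]] by simp
  qed (use IH in auto)
  finally show ?case .
qed

subsection \<open>Central elements and contents\<close>

text \<open>The generating function of the elementary symmetric polynomials in the Jucys-Murphy
  elements: one element with a parameter \<open>z\<close> stands for all symmetric
  functions.\<close>

primrec char_elem :: "complex \<Rightarrow> nat \<Rightarrow> galg" where
  "char_elem z 0 = 1"
| "char_elem z (Suc n) = char_elem z n * (cscale z 1 - JM (Suc n))"

lemma char_elem_in_CS: "char_elem z n \<in> CS n"
proof (induction n)
  case (Suc n)
  then have "char_elem z n \<in> CS (Suc n)" by (rule CS_mono') simp
  then show ?case by (auto intro!: JM_in_CS)
qed simp

text \<open>Elements of \<open>CS n\<close> commute with the earlier factors by induction and with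
  the last one by \<open>CS_JM_commute\<close>. The transposition commutes with the product of the
  last two factors, which is symmetric in \<open>JM n\<close> and \<open>JM (Suc n)\<close>, and
  with the factors before them, which lie in a smaller algebra.\<close>

lemma char_elem_central: "a \<in> CS n \<Longrightarrow> a * char_elem z n = char_elem z n * a"
proof (induction n arbitrary: a)
  case 0
  show ?case by simp
next
  case (Suc n)
  show ?case
  proof (cases n)
    case 0
    then show ?thesis using Suc.prems CS_le_1[of 1] by auto
  next
    case (Suc m)
    let ?X = "JM n" and ?Y = "JM (Suc n)" and ?s = "adj_swap n"
    have 1: "1 \<le> n" using Suc by simp
    have lower: "b * char_elem z (Suc n) = char_elem z (Suc n) * b" if "b \<in> CS n" for b
    proof -
      have "b * ?Y = ?Y * b" by (rule CS_JM_commute[OF that]) simp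
      then have "b * (cscale z 1 - ?Y) = (cscale z 1 - ?Y) * b"
        by (simp add: left_diff_distrib right_diff_distrib)
      from commute_mult[OF Suc.IH[OF that] this] show ?thesis by simp
    qed
    have YX: "?Y * ?X = ?X * ?Y" by (rule JM_JM_commute)
    \<comment> \<open>The corrections \<open>- 1\<close> and \<open>+ 1\<close> that arise from
      moving the transposition past the two factors cancel.\<close>
    have XY: "?s * (?X * ?Y) = ?X * ?Y * ?s"
    proof -
      have "?s * (?X * ?Y) = (?Y * ?s - 1) * ?Y"
        by (simp add: adj_swap_JM(1)[OF 1] flip: mult.assoc)
      also have "\<dots> = ?Y * (?s * ?Y) - ?Y" by (simp add: left_diff_distrib mult.assoc)
      also have "\<dots> = ?X * ?Y * ?s"
        by (simp add: adj_swap_JM(2)[OF 1] distrib_left YX flip: mult.assoc)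
      finally show ?thesis .
    qed
    have "?s * ((cscale z 1 - ?X) * (cscale z 1 - ?Y))
        = cscale (z * z) ?s - cscale z (?s * ?X) - cscale z (?s * ?Y) + ?s * (?X * ?Y)"
      by (simp add: left_diff_distrib right_diff_distrib algebra_simps)
    also have "\<dots> = cscale (z * z) ?s - cscale z (?Y * ?s) - cscale z (?X * ?s) + ?X * ?Y * ?s"
      by (simp add: adj_swap_JM(1,2)[OF 1] XY cvec.scale_right_distrib cvec.scale_right_diff_distrib)
    also have "\<dots> = ((cscale z 1 - ?X) * (cscale z 1 - ?Y)) * ?s"
      by (simp add: left_diff_distrib right_diff_distrib algebra_simps)
    finally have quad: "?s * ((cscale z 1 - ?X) * (cscale z 1 - ?Y)) = (cscale z 1 - ?X) * (cscale z 1 - ?Y) * ?s" .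
    have "char_elem z m * ?s = ?s * char_elem z m"
      by (rule adj_swap_commute[OF char_elem_in_CS]) (use Suc in simp)
    moreover have "char_elem z (Suc n) = char_elem z m * ((cscale z 1 - ?X) * (cscale z 1 - ?Y))"
      by (simp add: Suc mult.assoc)
    ultimately have s: "?s * char_elem z (Suc n) = char_elem z (Suc n) * ?s"
      using commute_mult[of ?s "char_elem z m", OF _ quad] by simp
    from 1 Suc.prems show ?thesis
    proof (induction rule: CS_Suc_induct)
      case (adj_swap a b)
      have "char_elem z (Suc n) * (a * ?s) = a * ?s * char_elem z (Suc n)"
        by (rule commute_mult[OF lower[OF adj_swap(1), symmetric] s[symmetric]])
      from commute_mult[OF this lower[OF adj_swap(2), symmetric]] show ?case by (rule sym)
    qed (use lower in \<open>auto simp: distrib_left distrib_right\<close>)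
  qed
qed

lemma char_elem_eigen_right:
  assumes "\<And>i. i \<in> {1..n} \<Longrightarrow> v * JM i = cscale (c i) v"
  shows "v * char_elem z n = cscale (\<Prod>i\<in>{1..n}. z - c i) v"
  using assms
proof (induction n)
  case (Suc n)
  have "v * char_elem z (Suc n) = v * char_elem z n * (cscale z 1 - JM (Suc n))"
    by (simp add: mult.assoc)
  also have "\<dots> = cscale ((\<Prod>i\<in>{1..n}. z - c i) * (z - c (Suc n))) v"
    using Suc by (simp add: right_diff_distrib cvec.scale_left_diff_distrib)
  finally show ?case by (simp add: mult.commute)
qed simp

text \<open>As a polynomial in \<open>z\<close> the product determines the multiset of contents: the
  multiplicity of a root is the length of the corresponding diagonal, and the lengths of the
  diagonals determine the diagram.\<close>

lemma shape_eq_by_weights: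
  assumes S: "standard_tableau n S" and T: "standard_tableau n T"
    and eq: "\<And>z. (\<Prod>i\<in>{1..n}. z - weight S i) = (\<Prod>i\<in>{1..n}. z - weight T i)"
  shows "shape S = shape T"
proof (rule young_diagram_eq_by_contents)
  show "young_diagram (shape S)" "young_diagram (shape T)"
    using standard_tableau_shape(1) S T by auto
  define p where "p U = (\<Prod>b\<in>shape U. [:- ccont b, 1:])" for U
  have p: "poly (p U) z = (\<Prod>i\<in>{1..n}. z - weight U i)" if "standard_tableau n U" for U z
    unfolding p_def poly_prod
    using prod.reindex_bij_betw[OF bij_betw_box_of[OF that], of "\<lambda>b. z - ccont b"] by simp
  have pST: "p S = p T"
    using p[OF S] p[OF T] eq by (simp add: poly_eq_poly_eq_iff[symmetric] fun_eq_iff)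
  have c: "count (proots (p U)) (of_int x) = card {b \<in> shape U. cont b = x}"
    if "standard_tableau n U" for U x
  proof -
    have fin: "finite (shape U)" using standard_tableau_shape(2)[OF that] .
    have "proots (p U) = (\<Sum>b\<in>shape U. {#ccont b#})"
      unfolding p_def by (subst proots_prod) auto
    also have "\<dots> = image_mset ccont (mset_set (shape U))"
    proof -
      have "(\<Sum>b\<in>A. {#ccont b#}) = image_mset ccont (mset_set A)" if "finite A" for A
        using that by (induction A) simp_all
      then show ?thesis using fin .
    qed
    also have "count \<dots> (of_int x) = card {b \<in> shape U. ccont b = of_int x}"
      using fin by (rule count_image_mset_eq_card_vimage)
    also have "{b \<in> shape U. ccont b = of_int x} = {b \<in> shape U. cont b = x}"
      using of_int_eq_iff[where 'a = complex] by blast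
    finally show ?thesis .
  qed
  show "card {b \<in> shape S. cont b = x} = card {b \<in> shape T. cont b = x}" for x
    using c[OF S, of x] c[OF T, of x] pST by simp
qed

subsection \<open>Weight vectors under adjacent transpositions\<close>

text \<open>With \<open>s = adj_swap n\<close> one gets \<open>v * s * (JM n - a) = - v\<close>, a
  Jordan block. Since \<open>a\<close> is real and \<open>JM n\<close> self-adjoint,
  \<open>JM n - a\<close> annihilates \<open>star v\<close> from the left, and multiplying by
  \<open>star v\<close> leaves \<open>v * star v = 0\<close>.\<close>

lemma same_weight_eq_0:
  assumes n: "1 \<le> n" and "v * JM n = cscale (of_int a) v" "v * JM (Suc n) = cscale (of_int a) v"
  shows "v = 0"
proof -
  have "v * adj_swap n * JM n = v * (adj_swap n * JM n)" by (simp add: mult.assoc)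
  also have "\<dots> = cscale (of_int a) (v * adj_swap n) - v"
    by (simp add: adj_swap_JM(1)[OF n] right_diff_distrib assms(3) flip: mult.assoc)
  finally have 1: "v * adj_swap n * JM n = cscale (of_int a) (v * adj_swap n) - v" .
  have "JM n * star v = star (v * JM n)" by (simp add: star.antiaut_mult)
  then have 2: "JM n * star v = cscale (of_int a) (star v)" by (simp add: assms(2))
  have "v * adj_swap n * JM n * star v = cscale (of_int a) (v * adj_swap n * star v)"
    by (simp add: 2 mult.assoc)
  then have "v * star v = 0"
    by (simp add: 1 left_diff_distrib)
  then show ?thesis by (rule mult_star_self_eq_0)
qed

text \<open>The defect \<open>w\<close> has weight \<open>a + \<epsilon>\<close> for
  \<open>JM n\<close>, different from that of \<open>v\<close>, so \<open>w * star v = 0\<close>; it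
  is also an eigenvector of the transposition with eigenvalue \<open>- \<epsilon>\<close>. Together
  these give \<open>w * star w = 0\<close>.\<close>

lemma adjacent_weight_adj_swap:
  assumes n: "1 \<le> n" and \<epsilon>: "\<epsilon> = 1 \<or> \<epsilon> = (- 1 :: int)"
    and Y: "v * JM n = cscale (of_int a) v" and X: "v * JM (Suc n) = cscale (of_int (a + \<epsilon>)) v"
  shows "v * adj_swap n = cscale (of_int \<epsilon>) v"
proof -
  define e :: complex where "e = of_int \<epsilon>"
  define w where "w = v * adj_swap n - cscale e v"
  have ee: "e * e = 1" "cnj e = e" using \<epsilon> by (auto simp: e_def)
  have "w * JM n = v * (adj_swap n * JM n) - cscale (e * of_int a) v"
    by (simp add: w_def left_diff_distrib Y mult.assoc)
  also have "\<dots> = cscale (of_int a + e) (v * adj_swap n) - (cscale 1 v + cscale (e * of_int a) v)"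
    by (simp add: adj_swap_JM(1)[OF n] right_diff_distrib X e_def flip: mult.assoc)
  also have "\<dots> = cscale (of_int a + e) w"
    by (simp add: w_def cvec.scale_right_diff_distrib cvec.scale_left_distrib ee distrib_left distrib_right mult.commute)
  finally have 1: "w * JM n = cscale (of_int a + e) w" .
  have "JM n * star v = star (v * JM n)" by (simp add: star.antiaut_mult)
  then have 2: "JM n * star v = cscale (of_int a) (star v)" by (simp add: Y)
  have "cscale (of_int a + e) (w * star v) = w * JM n * star v" by (simp add: 1)
  also have "\<dots> = cscale (of_int a) (w * star v)" by (simp add: 2 mult.assoc)
  finally have "cscale e (w * star v) = 0" by (simp add: cvec.scale_left_distrib)
  then have wv: "w * star v = 0" using ee by auto
  have "w * adj_swap n = v * (adj_swap n * adj_swap n) - cscale e (v * adj_swap n)"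
    unfolding w_def left_diff_distrib by (simp only: mult.assoc cscale_mult)
  also have "\<dots> = cscale (e * e) v - cscale e (v * adj_swap n)" by (simp add: ee)
  also have "\<dots> = cscale (- e) w" by (simp add: w_def cvec.scale_right_diff_distrib)
  finally have ws: "w * adj_swap n = cscale (- e) w" .
  have "star w = adj_swap n * star v - cscale e (star v)"
    by (simp add: w_def star.antiaut_diff star.antiaut_mult ee)
  then have "w * star w = (w * adj_swap n) * star v - cscale e (w * star v)"
    by (simp add: right_diff_distrib mult.assoc)
  then have "w * star w = 0" by (simp add: ws wv)
  then have "w = 0" by (rule mult_star_self_eq_0)
  then show ?thesis by (simp add: w_def e_def)
qed

text \<open>By the previous lemma the two adjacent transpositions act on \<open>v\<close> by the
  scalars \<open>- \<epsilon>\<close> and \<open>\<epsilon>\<close>, so the two sides of the braid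
  relation act with opposite signs.\<close>

lemma braid_weight_eq_0:
  assumes n: "1 \<le> n" and \<epsilon>: "\<epsilon> = 1 \<or> \<epsilon> = (- 1 :: int)"
    and "v * JM n = cscale (of_int (a + \<epsilon>)) v" "v * JM (Suc n) = cscale (of_int a) v"
    "v * JM (Suc (Suc n)) = cscale (of_int (a + \<epsilon>)) v"
  shows "v = 0"
proof -
  have 1: "v * adj_swap n = cscale (of_int (- \<epsilon>)) v"
    by (rule adjacent_weight_adj_swap[OF n, where a = "a + \<epsilon>"]) (use assms in auto)
  have 2: "v * adj_swap (Suc n) = cscale (of_int \<epsilon>) v"
    by (rule adjacent_weight_adj_swap) (use assms in auto)
  have "v * (adj_swap n * adj_swap (Suc n) * adj_swap n) = v * (adj_swap (Suc n) * adj_swap n * adj_swap (Suc n))"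
    by (simp only: adj_swap_braid)
  then have "cscale (of_int (\<epsilon> * \<epsilon> * \<epsilon>)) v = - cscale (of_int (\<epsilon> * \<epsilon> * \<epsilon>)) v"
    by (simp add: 1 2 flip: mult.assoc)
  then have "cscale (of_int (\<epsilon> * \<epsilon> * \<epsilon>)) v + cscale (of_int (\<epsilon> * \<epsilon> * \<epsilon>)) v = 0"
    by (simp only: eq_neg_iff_add_eq_0)
  then show ?thesis using \<epsilon> by (auto simp flip: cvec.scale_left_distrib)
qed

section \<open>The matrix structure of the group algebra\<close>

text \<open>What is known after \<open>n\<close> steps, kept as a locale so that its consequences
  are at hand in the step to \<open>Suc n\<close>. Orthogonality and idempotence are derived from
  the weights by evaluating the interpolation polynomials; the last assumption then leaves no room
  for a proper splitting of a projector.\<close>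

locale level =
  fixes n :: nat
  assumes projector_weight:
      "\<And>T i. standard_tableau n T \<Longrightarrow> i \<in> {1..n} \<Longrightarrow> projector T * JM i = cscale (weight T i) (projector T)"
    and sum_projector: "(\<Sum>T\<in>tableaux n. projector T) = 1"
    and projector_sandwich:
      "\<And>T a. standard_tableau n T \<Longrightarrow> a \<in> CS n \<Longrightarrow> \<exists>c. projector T * a * projector T = cscale c (projector T)"
begin

lemma projector_orthogonal:
  assumes "standard_tableau n S" "standard_tableau n T"
  shows "projector S * projector T = (if S = T then projector S else 0)"
  using right_weight_mult_projector[OF assms, of "projector S"] projector_weight[OF assms(1)] by auto

lemma projector_idem: "standard_tableau n T \<Longrightarrow> projector T * projector T = projector T"
  by (simp add: projector_orthogonal)

lemma projector_idem': "standard_tableau n T \<Longrightarrow> projector T * (projector T * x) = projector T * x"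
  by (simp add: projector_idem flip: mult.assoc)

text \<open>An anti-automorphism fixing the Jucys--Murphy elements maps the projector to a weight vector
  of the same weight.\<close>

lemma antiaut_projector:
  assumes "field_involution h" "\<And>k. h (of_int k) = of_int k" and T: "standard_tableau n T"
  shows "antiaut h (projector T) = projector T"
proof -
  interpret field_involution h by fact
  let ?q = "antiaut h (projector T)"
  have "?q * JM i = cscale (weight T i) ?q" if "i \<in> {1..n}" for i
  proof -
    have "?q * JM i = antiaut h (projector T * JM i)"
      by (simp add: antiaut_mult projector_JM_commute)
    then show ?thesis using projector_weight[OF T that] assms(2) by simp
  qed
  then have q: "?q * projector T = ?q"
    using right_weight_mult_projector[OF T T, of ?q] by simp
  have "antiaut h (?q * projector T) = ?q * projector T"
    by (simp add: antiaut_mult)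
  then show ?thesis using q by simp
qed

lemma star_projector [simp]: "standard_tableau n T \<Longrightarrow> star (projector T) = projector T"
  by (rule antiaut_projector) (unfold_locales, auto)

lemma flip_projector [simp]: "standard_tableau n T \<Longrightarrow> flip (projector T) = projector T"
  by (rule antiaut_projector) (unfold_locales, auto)

lemma left_weight_mult_projector:
  assumes "standard_tableau n T" "standard_tableau n S"
    and "\<And>i. i \<in> {1..n} \<Longrightarrow> JM i * v = cscale (weight T i) v"
  shows "projector S * v = (if S = T then v else 0)"
proof -
  have "flip v * JM i = cscale (weight T i) (flip v)" if "i \<in> {1..n}" for i
    using arg_cong[OF assms(3)[OF that], of flip] by (simp add: flip.antiaut_mult)
  from right_weight_mult_projector[OF assms(1,2) this]
  have "flip (flip v * projector S) = flip (if S = T then flip v else 0)" by simp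
  then show ?thesis using assms(2) by (simp add: flip.antiaut_mult split: if_splits)
qed

lemma JM_projector:
  "standard_tableau n T \<Longrightarrow> i \<in> {1..n} \<Longrightarrow> JM i * projector T = cscale (weight T i) (projector T)"
  using projector_weight projector_JM_commute by metis

lemma expand_left: "a = (\<Sum>S\<in>tableaux n. projector S * a)"
  by (simp add: sum_projector flip: sum_distrib_right)

lemma expand_right: "a = (\<Sum>T\<in>tableaux n. a * projector T)"
  by (simp add: sum_projector flip: sum_distrib_left)

text \<open>The central element \<open>char_elem z n\<close> acts on the block from the right by the
  contents of \<open>T\<close> and, moved through it, from the left by those of \<open>S\<close>. On
  a nonzero element the two scalars agree for every \<open>z\<close>, which forces equal
  shapes.\<close>

lemma block_eq_0:
  assumes S: "standard_tableau n S" and T: "standard_tableau n T"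
    and a: "a \<in> CS n" and ne: "shape S \<noteq> shape T"
  shows "projector S * a * projector T = 0"
proof (rule ccontr)
  let ?u = "projector S * a * projector T"
  assume u: "?u \<noteq> 0"
  have "(\<Prod>i\<in>{1..n}. z - weight S i) = (\<Prod>i\<in>{1..n}. z - weight T i)" for z
  proof -
    have "?u * char_elem z n = projector S * a * cscale (\<Prod>i\<in>{1..n}. z - weight T i) (projector T)"
      using char_elem_eigen_right[OF projector_weight[OF T], where z = z] by (simp add: mult.assoc)
    then have 1: "?u * char_elem z n = cscale (\<Prod>i\<in>{1..n}. z - weight T i) ?u" by simp
    have "a * projector T \<in> CS n" using a projector_in_CS[OF T] by auto
    then have "?u * char_elem z n = projector S * char_elem z n * (a * projector T)"
      using char_elem_central[of "a * projector T" n z] by (simp add: mult.assoc)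
    also have "\<dots> = cscale (\<Prod>i\<in>{1..n}. z - weight S i) ?u"
      using char_elem_eigen_right[OF projector_weight[OF S], where z = z] by (simp add: mult.assoc)
    finally have "cscale ((\<Prod>i\<in>{1..n}. z - weight S i) - (\<Prod>i\<in>{1..n}. z - weight T i)) ?u = 0"
      using 1 by (simp only: cvec.scale_left_diff_distrib right_minus_eq)
    then show ?thesis using u by simp
  qed
  then show False using shape_eq_by_weights[OF S T] ne by blast
qed

text \<open>The element \<open>star u * u\<close> is sandwiched between two copies of
  \<open>projector T\<close>, hence a multiple of it, and positivity excludes 0. So
  \<open>star u\<close> inverts \<open>u\<close> up to a scalar.\<close>

lemma block_star_nonzero:
  assumes S: "standard_tableau n S" and T: "standard_tableau n T" and a: "a \<in> CS n"
    and u: "u = projector S * a * projector T" "u \<noteq> 0"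
  obtains c where "c \<noteq> 0" "star u * u = cscale c (projector T)"
proof -
  have "star u * u = projector T * (star a * projector S * a) * projector T"
    using S T by (simp add: u(1) star.antiaut_mult mult.assoc projector_idem')
  moreover have "star a * projector S * a \<in> CS n"
    using a projector_in_CS[OF S] by (intro CS_mult) auto
  ultimately obtain c where c: "star u * u = cscale c (projector T)"
    using projector_sandwich[OF T] by metis
  moreover have "c \<noteq> 0" using star_mult_self_eq_0[of u] u(2) c by auto
  ultimately show thesis by (rule that[rotated])
qed

text \<open>For a nonzero \<open>u\<close> and any \<open>v\<close> in the block,
  \<open>v * star u\<close> is a multiple of \<open>projector S\<close>; multiplying by
  \<open>u\<close> and cancelling \<open>star u * u\<close> makes \<open>v\<close> a multiple of
  \<open>u\<close>.\<close>

lemma block_one_dimensional: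
  assumes S: "standard_tableau n S" and T: "standard_tableau n T"
    and a: "a \<in> CS n" and b: "b \<in> CS n" and u: "projector S * a * projector T \<noteq> 0"
  obtains c where "projector S * b * projector T = cscale c (projector S * a * projector T)"
proof -
  define u v where "u = projector S * a * projector T" and "v = projector S * b * projector T"
  obtain d where d: "d \<noteq> 0" "star u * u = cscale d (projector T)"
    using block_star_nonzero[OF S T a u_def] u by (auto simp: u_def)
  have "v * star u = projector S * (b * projector T * star a) * projector S"
    using S T by (simp add: u_def v_def star.antiaut_mult mult.assoc projector_idem')
  moreover have "b * projector T * star a \<in> CS n"
    using a b projector_in_CS[OF T] by (intro CS_mult) auto
  ultimately obtain e where e: "v * star u = cscale e (projector S)"
    using projector_sandwich[OF S] by metis
  have "projector S * u = u" by (simp add: u_def projector_idem' S mult.assoc)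
  then have "v * (star u * u) = cscale e u" by (simp add: e flip: mult.assoc)
  moreover have "v * projector T = v" by (simp add: v_def projector_idem T mult.assoc)
  ultimately have "cscale d v = cscale e u" by (simp add: d(2))
  then have "cscale (inverse d) (cscale d v) = cscale (inverse d) (cscale e u)" by simp
  then have "v = cscale (inverse d * e) u" using d(1) by simp
  then show thesis unfolding u_def v_def by (rule that)
qed

text \<open>The nonzero blocks span \<open>CS n\<close> and there are at most \<open>n!\<close> pairs of tableaux of the same
  shape, so no block vanishes.\<close>

lemma block_nonzero:
  assumes S: "standard_tableau n S" and T: "standard_tableau n T" and sh: "shape S = shape T"
  obtains a where "a \<in> CS n" "projector S * a * projector T \<noteq> 0"
proof -
  define pairs where "pairs = (SIGMA S:tableaux n. {T \<in> tableaux n. shape S = shape T})"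
  define good where "good = {(S, T) \<in> tableaux n \<times> tableaux n. \<exists>a\<in>CS n. projector S * a * projector T \<noteq> 0}"
  have "\<forall>x\<in>good. \<exists>a. a \<in> CS n \<and> projector (fst x) * a * projector (snd x) \<noteq> 0"
    by (auto simp: good_def)
  then obtain f where f: "\<And>x. x \<in> good \<Longrightarrow> f x \<in> CS n \<and> projector (fst x) * f x * projector (snd x) \<noteq> 0"
    by metis
  define u where "u x = projector (fst x) * f x * projector (snd x)" for x
  have fin: "finite pairs" by (auto simp: pairs_def)
  have sub: "good \<subseteq> pairs"
    using block_eq_0 by (auto simp: good_def pairs_def tableaux_def)
  then have fin_good: "finite good" using fin by (rule finite_subset)
  \<comment> \<open>Blocks being at most one-dimensional, one chosen vector for each nonzero block
    suffices.\<close>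
  have "CS n \<subseteq> cvec.span (u ` good)"
  proof
    fix a assume a: "a \<in> CS n"
    have "projector S * a * projector T \<in> cvec.span (u ` good)"
      if S: "S \<in> tableaux n" and T: "T \<in> tableaux n" for S T
    proof (cases "projector S * a * projector T = 0")
      case False
      then have g: "(S, T) \<in> good" using S T a by (auto simp: good_def)
      have "projector S * f (S, T) * projector T \<noteq> 0" "f (S, T) \<in> CS n" using f[OF g] by auto
      then obtain c where "projector S * a * projector T = cscale c (projector S * f (S, T) * projector T)"
        using block_one_dimensional[of S T "f (S, T)" a] S T a by (auto simp: tableaux_def)
      then have eq: "projector S * a * projector T = cscale c (u (S, T))" by (simp add: u_def)
      show ?thesis
        unfolding eq by (intro cvec.span_scale cvec.span_base imageI g)
    qed (simp add: cvec.span_zero)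
    then have "(\<Sum>T\<in>tableaux n. \<Sum>S\<in>tableaux n. projector S * a * projector T) \<in> cvec.span (u ` good)"
      by (intro cvec.span_sum)
    moreover have "(\<Sum>T\<in>tableaux n. \<Sum>S\<in>tableaux n. projector S * a * projector T) = a"
      by (simp add: sum_projector flip: sum_distrib_left sum_distrib_right)
    ultimately show "a \<in> cvec.span (u ` good)" by simp
  qed
  then have "fact n \<le> card (u ` good)"
    by (intro fact_le_card_spanning) (use fin_good in auto)
  also have "\<dots> \<le> card good" by (rule card_image_le[OF fin_good])
  finally have "card pairs \<le> card good"
    using card_tableau_pairs_le[of n] by (simp add: pairs_def)
  then have "good = pairs"
    using card_seteq[OF fin sub] by simp
  then have "(S, T) \<in> good" using S T sh by (auto simp: pairs_def tableaux_def)
  then show thesis using that by (auto simp: good_def)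
qed

text \<open>An element commuting with \<open>CS n\<close>, such as a polynomial in
  \<open>JM (Suc n)\<close>, passes through a nonzero \<open>u\<close> of the block of
  \<open>S\<close> and \<open>T\<close>, and \<open>star u\<close> brings the vanishing back to
  \<open>projector T\<close>. Which polynomials annihilate \<open>JM (Suc n)\<close> on a projector
  thus depends only on the shape.\<close>

lemma transfer_annihilator:
  assumes S: "standard_tableau n S" and T: "standard_tableau n T" and sh: "shape S = shape T"
    and f: "\<And>a. a \<in> CS n \<Longrightarrow> a * f = f * a" and z: "projector S * f = 0"
  shows "projector T * f = 0"
proof -
  obtain a where a: "a \<in> CS n" "projector S * a * projector T \<noteq> 0"
    using block_nonzero[OF S T sh] .
  define u where "u = projector S * a * projector T"
  obtain c where c: "c \<noteq> 0" "star u * u = cscale c (projector T)"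
    using block_star_nonzero[OF S T a(1) u_def] a(2) by (auto simp: u_def)
  have "u * f = projector S * (a * projector T * f)" by (simp add: u_def mult.assoc)
  also have "a * projector T * f = f * (a * projector T)"
    using a(1) projector_in_CS[OF T] by (intro f) auto
  also have "projector S * \<dots> = 0" by (simp add: z flip: mult.assoc)
  finally have "star u * u * f = 0" by (simp add: mult.assoc)
  then show ?thesis using c by simp
qed

end

lemma SYT_standard: "T \<in> SYT D \<Longrightarrow> standard_tableau (card D) T" "T \<in> SYT D \<Longrightarrow> shape T = D"
  by (auto simp: SYT_def)

section \<open>The annihilating polynomial of the next Jucys-Murphy element on a projector\<close>

lemma projector_lagrange:
  assumes T: "standard_tableau (Suc n) T"
  defines "q \<equiv> poly_at (lagrange (shape (subtableau T n)) (box_of T (Suc n))) (JM (Suc n))"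
  shows "projector T = projector (subtableau T n) * q" "projector T = q * projector (subtableau T n)"
proof -
  show 1: "projector T = projector (subtableau T n) * q"
    unfolding q_def by (rule projector_Suc[OF T])
  have "standard_tableau n (subtableau T n)" by (rule standard_tableau_subtableau[OF T]) simp
  then have "projector (subtableau T n) * JM (Suc n) = JM (Suc n) * projector (subtableau T n)"
    by (intro CS_JM_commute[OF projector_in_CS]) auto
  then have "projector (subtableau T n) * q = q * projector (subtableau T n)"
    unfolding q_def by (rule poly_at_intertwine)
  with 1 show "projector T = q * projector (subtableau T n)" by simp
qed

text \<open>With \<open>\<phi> = 1 - s (X - Y)\<close> one has \<open>X \<phi> = \<phi> Y\<close> and \<open>\<phi>\<^sup>2 = 1 - (X - Y)\<^sup>2\<close>, where
  \<open>Y\<close> and \<open>X\<close> are consecutive Jucys--Murphy elements and \<open>s\<close> is the transposition.\<close>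

lemma intertwiner_annihilates:
  assumes n: "1 \<le> n" and e: "e * adj_swap n = adj_swap n * e" "e * JM (Suc n) = JM (Suc n) * e"
    and z: "e * poly_at p (JM n) = 0"
  shows "e * poly_at p (JM (Suc n)) * (1 - (JM (Suc n) - JM n) * (JM (Suc n) - JM n)) = 0"
proof -
  let ?X = "JM (Suc n)" and ?Y = "JM n" and ?s = "adj_swap n"
  define \<Delta> where "\<Delta> = ?X - ?Y"
  define \<phi> where "\<phi> = 1 - ?s * \<Delta>"
  have XY: "?X * ?Y = ?Y * ?X" by (rule JM_JM_commute)
  have \<Delta>Y: "\<Delta> * ?Y = ?Y * \<Delta>" by (simp add: \<Delta>_def left_diff_distrib right_diff_distrib XY)
  have "?s * \<Delta> = ?Y * ?s + 1 - (?X * ?s - 1)"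
    by (simp add: \<Delta>_def right_diff_distrib adj_swap_JM(1,2)[OF n])
  \<comment> \<open>The transposition anticommutes with \<open>\<Delta>\<close> up to the constant
    2, the sum of the two corrections by 1.\<close>
  then have s\<Delta>: "?s * \<Delta> = 2 - \<Delta> * ?s" by (simp add: \<Delta>_def left_diff_distrib algebra_simps)
  have "?X * \<phi> = ?X - ?X * ?s * \<Delta>" by (simp add: \<phi>_def right_diff_distrib mult.assoc)
  also have "?X * ?s * \<Delta> = ?s * (?Y * \<Delta>) + \<Delta>"
    by (simp add: adj_swap_JM(4)[OF n] distrib_right mult.assoc)
  also have "?X - (?s * (?Y * \<Delta>) + \<Delta>) = ?Y - ?s * (\<Delta> * ?Y)" by (simp add: \<Delta>Y) (simp add: \<Delta>_def)
  also have "\<dots> = \<phi> * ?Y" by (simp add: \<phi>_def left_diff_distrib mult.assoc)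
  finally have X\<phi>: "?X * \<phi> = \<phi> * ?Y" .
  have "?s * \<Delta> * (?s * \<Delta>) = (2 - \<Delta> * ?s) * (?s * \<Delta>)" by (simp only: s\<Delta>[symmetric])
  also have "\<dots> = 2 * (?s * \<Delta>) - \<Delta> * ((?s * ?s) * \<Delta>)"
    unfolding left_diff_distrib by (simp only: mult.assoc)
  also have "\<dots> = 2 * (?s * \<Delta>) - \<Delta> * \<Delta>" by simp
  finally have sq: "?s * \<Delta> * (?s * \<Delta>) = 2 * (?s * \<Delta>) - \<Delta> * \<Delta>" .
  have "\<phi> * \<phi> = 1 - ?s * \<Delta> - ?s * \<Delta> + ?s * \<Delta> * (?s * \<Delta>)"
    by (simp add: \<phi>_def left_diff_distrib right_diff_distrib)
  then have \<phi>\<phi>: "\<phi> * \<phi> = 1 - \<Delta> * \<Delta>" by (simp add: sq mult_2)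
  \<comment> \<open>The element \<open>?Y = ?s * ?X * ?s - ?s\<close> is built from elements
    commuting with \<open>e\<close>.\<close>
  have "e * ?Y = ?Y * e"
  proof -
    have Y: "?Y = ?s * ?X * ?s - ?s" by (simp add: adj_swap_JM(2)[OF n] distrib_right mult.assoc)
    have "e * (?s * ?X * ?s) = ?s * ?X * ?s * e"
      by (intro commute_mult e)
    then show ?thesis by (subst (1 2) Y) (simp add: left_diff_distrib right_diff_distrib e)
  qed
  then have e\<phi>: "e * \<phi> = \<phi> * e"
    unfolding \<phi>_def \<Delta>_def
    by (simp add: left_diff_distrib right_diff_distrib e commute_mult)
  \<comment> \<open>Carrying \<open>\<phi>\<close> through the polynomial changes its argument from
    \<open>?X\<close> to \<open>?Y\<close>, where the hypothesis on \<open>p\<close>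
    applies.\<close>
  have "\<phi> * poly_at p ?Y = poly_at p ?X * \<phi>"
    by (rule poly_at_intertwine) (rule X\<phi>[symmetric])
  then have "e * poly_at p ?X * (\<phi> * \<phi>) = e * \<phi> * poly_at p ?Y * \<phi>"
    by (simp add: mult.assoc)
  also have "\<dots> = \<phi> * (e * poly_at p ?Y) * \<phi>" by (simp add: e\<phi> mult.assoc)
  finally show ?thesis by (simp add: z \<phi>\<phi> \<Delta>_def)
qed

text \<open>The link between level \<open>n\<close> and level \<open>Suc n\<close>: it makes the
  interpolation factor of the next projector a spectral projection of
  \<open>JM (Suc n)\<close>.\<close>

definition killed :: "nat \<Rightarrow> bool" where
  "killed n \<longleftrightarrow> (\<forall>T. standard_tableau n T \<longrightarrow>
     projector T * poly_at (corner_poly (shape T)) (JM (Suc n)) = 0)"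

lemma killed_0: "killed 0"
proof -
  have "T = (\<lambda>_. 0)" if "standard_tableau 0 T" for T
    using that tableaux_0 by (auto simp: tableaux_def)
  moreover have "shape (\<lambda>_. 0) = {}" by (simp add: shape_def)
  ultimately show ?thesis
    by (auto simp: killed_def corner_poly_def JM_def poly_at_linear)
qed

context level
begin

text \<open>If the conclusion failed, its left-hand side would be a nonzero vector with the same
  weight for \<open>JM n\<close> and \<open>JM (Suc n)\<close>.\<close>

lemma annihilator_remove_repeated:
  assumes n: "1 \<le> n" and T: "standard_tableau n T"
    and z: "projector T * poly_at ([:- weight T n, 1:] * g) (JM (Suc n)) = 0"
  shows "projector T * poly_at g (JM (Suc n)) = 0"
proof -
  let ?v = "projector T * poly_at g (JM (Suc n))"
  have "?v * (JM (Suc n) - cscale (weight T n) 1) = 0"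
    using z by (simp add: mult.commute[of _ g] poly_at_mult poly_at_linear mult.assoc del: mult_pCons_right mult_pCons_left)
  then have "?v * JM (Suc n) = cscale (weight T n) ?v"
    by (simp add: right_diff_distrib)
  moreover have "JM n * poly_at g (JM (Suc n)) = poly_at g (JM (Suc n)) * JM n"
    by (rule poly_at_intertwine) (rule JM_JM_commute)
  then have "?v * JM n = projector T * JM n * poly_at g (JM (Suc n))"
    by (simp add: mult.assoc)
  then have "?v * JM n = cscale (weight T n) ?v"
    using projector_weight[OF T, of n] n by simp
  ultimately show ?thesis using same_weight_eq_0[OF n] by blast
qed

text \<open>By transfer the claim may be tested on any tableau of the same shape. With
  \<open>c\<close> the content of the last box \<open>d\<close> of \<open>T\<close>, the absence of
  an outer corner yields a removable box \<open>h\<close> of content \<open>c + \<epsilon>\<close>;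
  a tableau \<open>S\<close> that ends with \<open>h\<close> followed by \<open>d\<close> would give
  a vector of weights \<open>c + \<epsilon>\<close>, \<open>c\<close>,
  \<open>c + \<epsilon>\<close>.\<close>

lemma annihilator_remove_adjacent:
  assumes n: "n = Suc k" and T: "standard_tableau n T" and \<epsilon>: "\<epsilon> = 1 \<or> \<epsilon> = - 1"
    and no: "\<And>b. b \<in> outer_corners (shape T) \<Longrightarrow> cont b \<noteq> cont (box_of T n) + \<epsilon>"
    and z: "projector T * poly_at ([:- of_int (cont (box_of T n) + \<epsilon>), 1:] * g) (JM (Suc n)) = 0"
  shows "projector T * poly_at g (JM (Suc n)) = 0"
proof -
  let ?d = "box_of T n" and ?T = "subtableau T k"
  let ?D = "shape ?T"
  let ?lin = "[:- of_int (cont ?d + \<epsilon>), 1:] :: complex poly"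
  have T': "standard_tableau (Suc k) T" using T n by simp
  have st: "standard_tableau k ?T" by (rule standard_tableau_subtableau[OF T']) simp
  note D = standard_tableau_shape(1)[OF st]
  have d: "?d \<in> outer_corners ?D" using box_of_last_outer[OF T'] n by simp
  have sh: "shape T = insert ?d ?D" using shape_last[OF T'] n by simp
  obtain h where h: "h \<in> inner_corners ?D" "cont h = cont ?d + \<epsilon>"
    using blocking_inner_corner[OF D d \<epsilon>] no sh by metis
  have hD: "h \<in> ?D" "young_diagram (?D - {h})" using h(1) by (auto simp: inner_corners_def)
  \<comment> \<open>The largest entry \<open>card ?D\<close> goes into \<open>h\<close>; the other
    boxes are filled in any standard way.\<close>
  obtain U where "U \<in> SYT (?D - {h})" using SYT_nonempty[OF hD(2)] by blast
  then have "U(h := card ?D) \<in> SYT ?D" using SYT_extend(1)[OF D h(1)] by blast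
  then obtain S' where S': "standard_tableau k S'" "shape S' = ?D" "S' h = k"
    using SYT_standard[of "U(h := card ?D)" ?D] standard_tableau_shape(3)[OF st] by auto
  have k: "1 \<le> k" using hD(1) standard_tableau_shape(2,3)[OF st] by (metis One_nat_def Suc_leI card_gt_0_iff empty_iff)
  define S where "S = S'(?d := n)"
  have d': "?d \<in> outer_corners (shape S')" using d S'(2) by simp
  have S: "standard_tableau n S" "shape S = shape T"
    using standard_tableau_extend[OF S'(1) d'] n S'(2) sh by (auto simp: S_def shape_fun_upd)
  have "box_of S n = ?d" using box_of_extend[OF S'(1) d'] n by (simp add: S_def)
  moreover have "box_of S k = h"
    using hD(1) S'(3) k outer_cornersD(1)[OF d] by (intro box_of_eqI[OF S(1)]) (auto simp: S_def)
  ultimately have wS: "weight S n = of_int (cont ?d)" "weight S k = of_int (cont ?d + \<epsilon>)"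
    using h(2) by auto
  have comm: "a * poly_at p (JM (Suc n)) = poly_at p (JM (Suc n)) * a" if "a \<in> CS n" for a p
    by (rule poly_at_intertwine, rule CS_JM_commute[OF that]) simp
  have "projector S * poly_at (?lin * g) (JM (Suc n)) = 0"
    by (rule transfer_annihilator[OF T S(1) S(2)[symmetric] comm z])
  then have "projector S * poly_at (g * ?lin) (JM (Suc n)) = 0" by (simp only: mult.commute)
  moreover define v where "v = projector S * poly_at g (JM (Suc n))"
  ultimately have "v * (JM (Suc n) - cscale (of_int (cont ?d + \<epsilon>)) 1) = 0"
    by (simp add: poly_at_mult poly_at_linear mult.assoc del: mult_pCons_right mult_pCons_left of_int_add)
  then have vX: "v * JM (Suc n) = cscale (of_int (cont ?d + \<epsilon>)) v"
    by (simp add: right_diff_distrib del: of_int_add)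
  have vY: "v * JM i = cscale (weight S i) v" if "i \<in> {1..n}" for i
  proof -
    have "JM i * poly_at g (JM (Suc n)) = poly_at g (JM (Suc n)) * JM i"
      by (rule poly_at_intertwine) (rule JM_JM_commute)
    then have "v * JM i = projector S * JM i * poly_at g (JM (Suc n))"
      by (simp add: v_def mult.assoc)
    then show ?thesis using projector_weight[OF S(1) that] by (simp add: v_def)
  qed
  have "v = 0"
    by (rule braid_weight_eq_0[OF k \<epsilon>, where a = "cont ?d"])
       (use vX vY[of n] vY[of k] wS n k in auto)
  then show ?thesis
    unfolding v_def using transfer_annihilator[OF S(1) T S(2) comm] by blast
qed

text \<open>Among the outer corners of \<open>shape T\<close> are those of the subtableau other than
  the added box, and possibly one each of content \<open>c + 1\<close> and \<open>c - 1\<close>. The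
  polynomial coming from the intertwiner is reduced to the product over exactly these, which divides
  \<open>corner_poly (shape T)\<close>.\<close>

lemma killed_step:
  assumes n: "n = Suc k" and IH: "killed k"
  shows "killed n"
  unfolding killed_def
proof (intro allI impI)
  fix T assume T: "standard_tableau n T"
  let ?d = "box_of T n" and ?T = "subtableau T k" and ?X = "JM (Suc n)" and ?e = "projector T"
  let ?D = "shape ?T"
  define L :: "int \<Rightarrow> complex poly" where "L x = [:- of_int x, 1:]" for x
  have 1: "1 \<le> n" using n by simp
  have T': "standard_tableau (Suc k) T" using T n by simp
  have st: "standard_tableau k ?T" by (rule standard_tableau_subtableau[OF T']) simp
  have fin: "finite ?D" using standard_tableau_shape(2)[OF st] .
  have d: "?d \<in> outer_corners ?D" using box_of_last_outer[OF T'] n by simp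
  have sh: "shape T = insert ?d ?D" using shape_last[OF T'] n by simp
  define O' where "O' = outer_corners ?D - {?d}"
  define c where "c = cont ?d"
  define G where "G = (\<Prod>b\<in>O'. L (cont b))"
  have cp: "corner_poly ?D = L c * G"
    unfolding corner_poly_def G_def O'_def L_def c_def by (rule prod.remove) (use fin d in auto)
  have T'_CS: "projector ?T \<in> CS k" by (rule projector_in_CS[OF st])
  have "projector ?T * poly_at (corner_poly ?D) ?X * (1 - (?X - JM n) * (?X - JM n)) = 0"
  proof (rule intertwiner_annihilates[OF 1])
    show "projector ?T * adj_swap n = adj_swap n * projector ?T"
      by (rule adj_swap_commute[OF T'_CS]) (use n in simp)
    show "projector ?T * ?X = ?X * projector ?T"
      by (rule CS_JM_commute[OF T'_CS]) (use n in simp)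
    show "projector ?T * poly_at (corner_poly ?D) (JM n) = 0"
      using IH st n by (simp add: killed_def)
  qed
  then have z: "?e * poly_at (corner_poly ?D) ?X * (1 - (?X - JM n) * (?X - JM n)) = 0"
    by (simp add: projector_lagrange(2)[OF T'] mult.assoc)
  have eX: "?e * ?X = ?X * ?e" by (rule projector_JM_commute)
  have eY: "?e * JM n = cscale (of_int c) ?e" using projector_weight[OF T, of n] 1 by (simp add: c_def)
  \<comment> \<open>On \<open>?e\<close> the element \<open>JM n\<close> is the scalar
    \<open>c\<close>, so the quadratic factor becomes a polynomial in \<open>?X\<close>
    alone.\<close>
  have "?e * (1 - (?X - JM n) * (?X - JM n)) = - (?e * poly_at (L (c + 1) * L (c - 1)) ?X)"
  proof -
    have Ye: "JM n * ?e = cscale (of_int c) ?e" using eY projector_JM_commute by metis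
    let ?Z = "?X - cscale (of_int c) 1"
    have e2: "?e * (?X - JM n) = ?Z * ?e" and e3: "?e * ?Z = ?Z * ?e"
      by (simp_all add: right_diff_distrib left_diff_distrib eX eY)
    have "?e * ((?X - JM n) * (?X - JM n)) = ?Z * ?e * (?X - JM n)"
      by (simp only: e2 flip: mult.assoc)
    also have "\<dots> = ?Z * ?Z * ?e"
      by (simp only: e2 mult.assoc)
    also have "\<dots> = ?e * (?Z * ?Z)"
      by (rule commute_mult[OF e3 e3, symmetric])
    also have "?Z * ?Z = 1 - (1 - ?Z * ?Z)" by simp
    also have "1 - ?Z * ?Z = - poly_at (L (c + 1) * L (c - 1)) ?X"
      unfolding L_def poly_at_mult poly_at_linear
      by (simp add: algebra_simps cvec.scale_left_distrib)
    finally show ?thesis by (simp add: right_diff_distrib distrib_left)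
  qed
  moreover have "?e * poly_at (corner_poly ?D) ?X = poly_at (corner_poly ?D) ?X * ?e"
    by (rule poly_at_intertwine[OF eX])
  ultimately have "poly_at (corner_poly ?D) ?X * (?e * poly_at (L (c + 1) * L (c - 1)) ?X) = 0"
    using z by (simp add: mult.assoc)
  then have "?e * poly_at (corner_poly ?D * (L (c + 1) * L (c - 1))) ?X = 0"
    unfolding poly_at_mult[of "corner_poly ?D"]
    using \<open>?e * poly_at (corner_poly ?D) ?X = _\<close> by (simp flip: mult.assoc)
  then have z1: "?e * poly_at (L c * (L (c + 1) * (L (c - 1) * G))) ?X = 0"
    by (simp only: cp mult_ac)
  have z2: "?e * poly_at (L (c + 1) * (L (c - 1) * G)) ?X = 0"
    using annihilator_remove_repeated[OF 1 T] z1 by (simp add: L_def c_def del: mult_pCons_left mult_pCons_right)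
  \<comment> \<open>The set \<open>N \<epsilon>\<close> has at most one element, so the product over
    it is the linear factor with root \<open>c + \<epsilon>\<close> or 1. This treats keeping and
    dropping the factor uniformly.\<close>
  define N where "N \<epsilon> = {b \<in> outer_corners (shape T). cont b = c + \<epsilon>}" for \<epsilon>
  have N: "(\<Prod>b\<in>N \<epsilon>. L (cont b)) = L (c + \<epsilon>)" if "N \<epsilon> \<noteq> {}" for \<epsilon>
  proof -
    from that obtain b where b: "b \<in> outer_corners (shape T)" "cont b = c + \<epsilon>" by (auto simp: N_def)
    have "x = b" if "x \<in> outer_corners (shape T)" "cont x = c + \<epsilon>" for x
      using inj_onD[OF inj_on_cont_outer_corners[of "shape T"], of x b] b that by simp
    with b have "N \<epsilon> = {b}" unfolding N_def by blast
    then show ?thesis using b by simp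
  qed
  have remove: "?e * poly_at ((\<Prod>b\<in>N \<epsilon>. L (cont b)) * g) ?X = 0"
    if "?e * poly_at (L (c + \<epsilon>) * g) ?X = 0" "\<epsilon> = 1 \<or> \<epsilon> = - 1" for \<epsilon> g
  proof (cases "N \<epsilon> = {}")
    case True
    have "?e * poly_at g ?X = 0"
      by (rule annihilator_remove_adjacent[OF n T that(2)])
         (use True that(1) in \<open>auto simp: N_def L_def c_def simp del: mult_pCons_left mult_pCons_right\<close>)
    then show ?thesis by (simp add: True)
  next
    case False
    show ?thesis unfolding N[OF False] by (rule that)
  qed
  have "?e * poly_at ((\<Prod>b\<in>N 1. L (cont b)) * (L (c - 1) * G)) ?X = 0"
    by (rule remove[OF z2]) simp
  then have "?e * poly_at (L (c + - 1) * ((\<Prod>b\<in>N 1. L (cont b)) * G)) ?X = 0"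
    by (simp only: mult.left_commute add_uminus_conv_diff)
  then have "?e * poly_at ((\<Prod>b\<in>N (- 1). L (cont b)) * ((\<Prod>b\<in>N 1. L (cont b)) * G)) ?X = 0"
    by (rule remove) simp
  also have "(\<Prod>b\<in>N (- 1). L (cont b)) * ((\<Prod>b\<in>N 1. L (cont b)) * G) = (\<Prod>b\<in>N (- 1) \<union> (N 1 \<union> O'). L (cont b))"
  proof -
    have "finite (outer_corners (shape T))" using standard_tableau_shape(2)[OF T] by simp
    then have finN: "finite (N \<epsilon>)" "finite O'" for \<epsilon> using fin by (auto simp: N_def O'_def)
    \<comment> \<open>Distinct outer corners of one diagram have contents at least 2 apart, so the
      old corners do not collide with the new ones.\<close>
    have far: "\<not> (cont b = c + 1 \<or> cont b = c - 1)" if "b \<in> O'" for b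
      using outer_corners_cont_near[of b ?D ?d] that d by (auto simp: O'_def c_def)
    have "N 1 \<inter> O' = {}" "N (- 1) \<inter> (N 1 \<union> O') = {}"
      using far by (auto simp: N_def)
    then show ?thesis using finN by (simp add: G_def prod.union_disjoint)
  qed
  finally have z3: "?e * poly_at (\<Prod>b\<in>N (- 1) \<union> (N 1 \<union> O'). L (cont b)) ?X = 0" .
  have "(\<Prod>b\<in>N (- 1) \<union> (N 1 \<union> O'). L (cont b)) dvd (\<Prod>b\<in>outer_corners (shape T). L (cont b))"
  proof (rule prod_dvd_prod_subset)
    show "N (- 1) \<union> (N 1 \<union> O') \<subseteq> outer_corners (shape T)"
      using outer_corner_insert[OF _ d] by (auto simp: N_def O'_def sh)
  qed (use standard_tableau_shape(2)[OF T] in simp)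
  then obtain r where "corner_poly (shape T) = (\<Prod>b\<in>N (- 1) \<union> (N 1 \<union> O'). L (cont b)) * r"
    unfolding corner_poly_def L_def by (rule dvdE)
  then show "?e * poly_at (corner_poly (shape T)) ?X = 0"
    using z3 by (simp add: poly_at_mult flip: mult.assoc)
qed


section \<open>From level n to level n + 1\<close>

lemma projector_Suc_weight:
  assumes K: "killed n" and T: "standard_tableau (Suc n) T" and i: "i \<in> {1..Suc n}"
  shows "projector T * JM i = cscale (weight T i) (projector T)"
proof -
  let ?T = "subtableau T n" and ?b = "box_of T (Suc n)" and ?X = "JM (Suc n)"
  let ?q = "poly_at (lagrange (shape ?T) ?b) ?X"
  have st: "standard_tableau n ?T" by (rule standard_tableau_subtableau[OF T]) simp
  note P = projector_lagrange[OF T]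
  show ?thesis
  proof (cases "i = Suc n")
    case True
    obtain c where c: "lagrange (shape ?T) ?b * [:- ccont ?b, 1:] = smult c (corner_poly (shape ?T))"
      using lagrange_mult_linear[OF standard_tableau_shape(2)[OF st] box_of_last_outer[OF T]] .
    \<comment> \<open>Multiplying the interpolation factor by the linear factor of the omitted root
      gives a multiple of the corner polynomial, which \<open>killed n\<close> annihilates.\<close>
    have "projector T * (?X - cscale (ccont ?b) 1)
        = projector ?T * poly_at (lagrange (shape ?T) ?b * [:- ccont ?b, 1:]) ?X"
      by (simp only: P(1) poly_at_mult poly_at_linear mult.assoc) simp
    also have "\<dots> = 0"
      unfolding c poly_at_smult using K st by (simp add: killed_def)
    finally show ?thesis by (simp add: True right_diff_distrib)
  next
    case False
    then have i: "i \<in> {1..n}" using i by auto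
    have "projector T * JM i = ?q * (projector ?T * JM i)" by (simp only: P(2) mult.assoc)
    also have "\<dots> = cscale (weight T i) (projector T)"
      using projector_weight[OF st i] box_of_subtableau[OF T i] by (simp add: P(2))
    finally show ?thesis .
  qed
qed

lemma sum_projector_Suc: "(\<Sum>T\<in>tableaux (Suc n). projector T) = 1"
proof -
  have "(\<Sum>T\<in>tableaux (Suc n). projector T)
      = (\<Sum>T\<in>tableaux n. \<Sum>b\<in>outer_corners (shape T). projector T * poly_at (lagrange (shape T) b) (JM (Suc n)))"
    unfolding sum_tableaux_Suc
    by (intro sum.cong refl projector_extend) (auto simp: tableaux_def)
  also have "\<dots> = (\<Sum>T\<in>tableaux n. projector T)"
    using sum_lagrange[OF standard_tableau_shape(1)]
    by (intro sum.cong refl) (simp add: tableaux_def flip: sum_distrib_left poly_at_sum)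
  finally show ?thesis by (simp add: sum_projector)
qed

text \<open>Distinct tableaux of one shape have distinct subtableaux with \<open>k\<close> entries,
  and \<open>adj_swap n\<close> commutes with \<open>CS k\<close>. So the projector of the
  subtableau of \<open>Q\<close> can be moved next to \<open>projector R\<close>, which it
  annihilates.\<close>

lemma adj_swap_between_projectors:
  assumes n: "n = Suc k" and R: "standard_tableau n R" and Q: "standard_tableau n Q"
    and sh: "shape R = shape Q" and ne: "R \<noteq> Q"
  shows "projector R * adj_swap n * projector Q = 0"
proof -
  let ?R = "subtableau R k" and ?Q = "subtableau Q k"
  have st: "standard_tableau k ?R" "standard_tableau k ?Q"
    using standard_tableau_subtableau[of n _ k] n R Q by auto
  have "?R \<noteq> ?Q" using tableau_eq_by_shape[of k R Q] R Q n sh ne by auto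
  have sub: "projector U * projector W = (if W = subtableau U k then projector U else 0)"
    if "standard_tableau n U" "standard_tableau k W" for U W
    by (rule right_weight_mult_projector[OF standard_tableau_subtableau that(2)])
       (use projector_weight[OF that(1)] box_of_subtableau[OF that(1)] that(1) n in auto)
  have "adj_swap n * projector Q = adj_swap n * (projector ?Q * projector Q)"
    using sub[OF Q st(2)] by (simp add: projector_projector_commute)
  also have "\<dots> = projector ?Q * adj_swap n * projector Q"
    using adj_swap_commute[OF projector_in_CS[OF st(2)], of n] n by (simp flip: mult.assoc)
  finally have "projector R * adj_swap n * projector Q = projector R * projector ?Q * adj_swap n * projector Q"
    by (simp add: mult.assoc)
  then show ?thesis using sub[OF R st(2)] \<open>?R \<noteq> ?Q\<close> by simp
qed

text \<open>For \<open>R = Q\<close> the diagonal block of the transposition is inverse to \<open>X - c\<close>, hence acts as a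
  scalar on a projector of the next level.\<close>

lemma adj_swap_diagonal_block:
  assumes n: "1 \<le> n" and R: "standard_tableau n R"
  shows "projector R * adj_swap n * projector R * JM (Suc n)
    = cscale (weight R n) (projector R * adj_swap n * projector R) + projector R"
proof -
  have "projector R * adj_swap n * projector R * JM (Suc n) = projector R * (adj_swap n * JM (Suc n)) * projector R"
    by (simp add: mult.assoc projector_JM_commute)
  also have "\<dots> = projector R * JM n * adj_swap n * projector R + projector R"
    by (simp add: adj_swap_JM(2)[OF n] distrib_left distrib_right projector_idem[OF R] mult.assoc)
  also have "projector R * JM n = cscale (weight R n) (projector R)"
    by (rule projector_weight[OF R]) (use n in simp)
  finally show ?thesis by simp
qed

text \<open>Elements of \<open>CS n\<close> are settled by the sandwich property one level down. For
  \<open>a * adj_swap n * b\<close> the identity is resolved on both sides of the transposition;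
  only terms with \<open>R = Q\<close> of the shape of \<open>subtableau T n\<close> survive, and
  these are computed from the diagonal block.\<close>

lemma projector_Suc_sandwich:
  assumes K: "killed n" and T: "standard_tableau (Suc n) T" and a: "a \<in> CS (Suc n)"
  shows "\<exists>c. projector T * a * projector T = cscale c (projector T)"
proof -
  let ?T = "subtableau T n" and ?b = "box_of T (Suc n)" and ?X = "JM (Suc n)" and ?P = "projector T"
  let ?q = "poly_at (lagrange (shape ?T) ?b) ?X"
  have st: "standard_tableau n ?T" by (rule standard_tableau_subtableau[OF T]) simp
  note P = projector_lagrange[OF T]
  have idem: "?P * ?P = ?P"
    using right_weight_mult_projector[OF T T projector_Suc_weight[OF K T]] by simp
  have lower: "\<exists>c. ?P * a * ?P = cscale c ?P" if a: "a \<in> CS n" for a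
  proof -
    obtain c where c: "projector ?T * a * projector ?T = cscale c (projector ?T)"
      using projector_sandwich[OF st a] by blast
    have PT: "?P * projector ?T = ?P"
      by (simp add: P(2) projector_idem[OF st] mult.assoc)
    have "?P * a * ?P = ?q * (projector ?T * a * projector ?T) * ?q"
      by (subst P(2), subst P(1)) (simp only: mult.assoc)
    also have "\<dots> = cscale c (?P * (projector ?T * ?q))"
      unfolding c by (simp add: PT flip: P(2) mult.assoc)
    also have "\<dots> = cscale c ?P" by (simp add: idem flip: P(1))
    finally show ?thesis by blast
  qed
  show ?thesis
  proof (cases n)
    case 0
    then have "a \<in> CS n" using a CS_le_1[of 0] CS_le_1[of 1] by simp
    then show ?thesis by (rule lower)
  next
    case (Suc k)
    then have "1 \<le> n" by simp
    from this a show ?thesis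
    proof (induction rule: CS_Suc_induct)
      case (add a b)
      then obtain c d where "?P * a * ?P = cscale c ?P" "?P * b * ?P = cscale d ?P" by blast
      then have "?P * (a + b) * ?P = cscale (c + d) ?P"
        by (simp only: distrib_left distrib_right cvec.scale_left_distrib)
      then show ?case by blast
    next
      case (lower a)
      then show ?case by (rule \<open>\<And>a. a \<in> CS n \<Longrightarrow> \<exists>c. ?P * a * ?P = cscale c ?P\<close>)
    next
      case (adj_swap a b)
      have summand: "\<exists>c. ?P * a * (projector R * adj_swap n * projector Q) * b * ?P = cscale c ?P"
        if RQ: "R \<in> tableaux n" "Q \<in> tableaux n" for R Q
      proof -
        have R: "standard_tableau n R" and Q: "standard_tableau n Q" using RQ by (auto simp: tableaux_def)
        have left: "?P * a * projector R = 0" if "shape R \<noteq> shape ?T"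
          using block_eq_0[OF st R adj_swap(1)] that by (simp add: P(2) mult.assoc)
        have right: "projector Q * b * ?P = 0" if "shape Q \<noteq> shape ?T"
          using block_eq_0[OF Q st adj_swap(2)] that by (simp add: P(1) flip: mult.assoc)
        consider "shape R \<noteq> shape ?T" | "shape Q \<noteq> shape ?T" | "shape R = shape Q" "R \<noteq> Q"
          | "R = Q" "shape R = shape ?T" by auto
        then show ?thesis
        proof cases
          case 1
          have "?P * a * (projector R * adj_swap n * projector Q) * b * ?P
              = ?P * a * projector R * (adj_swap n * projector Q * b * ?P)" by (simp only: mult.assoc)
          then show ?thesis using left[OF 1] by (intro exI[of _ 0]) simp
        next
          case 2
          have "?P * a * (projector R * adj_swap n * projector Q) * b * ?P
              = ?P * a * projector R * adj_swap n * (projector Q * b * ?P)" by (simp only: mult.assoc)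
          then show ?thesis using right[OF 2] by (intro exI[of _ 0]) simp
        next
          case 3
          then show ?thesis
            using adj_swap_between_projectors[OF Suc R Q] by (intro exI[of _ 0]) simp
        next
          case 4
          define D where "D = projector R * adj_swap n * projector R"
          define y where "y = ?P * a * D * b * ?P"
          have bX: "b * ?X = ?X * b" by (rule CS_JM_commute[OF adj_swap(2)]) simp
          \<comment> \<open>The product \<open>y * ?X\<close> is evaluated twice, at the right end
            by the weight of \<open>T\<close> and, moved next to \<open>D\<close>, by the diagonal
            block. The difference of the two scalars times \<open>y\<close> is then a sandwich of an
            element of \<open>CS n\<close>.\<close>
          have "cscale (weight T (Suc n)) y = y * ?X"
            using projector_Suc_weight[OF K T, of "Suc n"] by (simp add: y_def mult.assoc)
          also have "\<dots> = ?P * a * (D * ?X) * b * ?P"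
          proof -
            have "y * ?X = ?P * a * D * b * (?P * ?X)" by (simp only: y_def mult.assoc)
            also have "\<dots> = ?P * a * D * (b * ?X) * ?P" by (simp only: projector_JM_commute mult.assoc)
            finally show ?thesis by (simp only: bX mult.assoc)
          qed
          also have "\<dots> = cscale (weight R n) y + ?P * (a * projector R * b) * ?P"
            unfolding D_def adj_swap_diagonal_block[OF \<open>1 \<le> n\<close> R] y_def
            by (simp add: distrib_left distrib_right mult.assoc)
          finally have y: "cscale (weight T (Suc n) - weight R n) y = ?P * (a * projector R * b) * ?P"
            by (simp add: cvec.scale_left_diff_distrib)
          obtain c where c: "?P * (a * projector R * b) * ?P = cscale c ?P"
            using lower[of "a * projector R * b"] adj_swap projector_in_CS[OF R] by blast
          have R': "standard_tableau (Suc k) R" using R Suc by simp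
          have "standard_tableau k (subtableau R k)" by (rule standard_tableau_subtableau[OF R']) simp
          \<comment> \<open>In the shape of \<open>subtableau T n\<close> the last box of
            \<open>R\<close> is removable while the last box of \<open>T\<close> is addable, so
            their contents differ.\<close>
          from outer_corner_inner[OF standard_tableau_shape(1)[OF this] box_of_last_outer[OF R']]
          have "box_of R n \<in> inner_corners (shape ?T)"
            using shape_last[OF R'] 4 Suc by simp
          then have "cont (box_of T (Suc n)) \<noteq> cont (box_of R n)"
            using cont_inner_outer_neq[OF standard_tableau_shape(1)[OF st]] box_of_last_outer[OF T] by blast
          then have ne: "weight T (Suc n) - weight R n \<noteq> 0" by (simp only: right_minus_eq of_int_eq_iff not_False_eq_True)
          define d where "d = weight T (Suc n) - weight R n"
          have "cscale (inverse d) (cscale d y) = cscale (inverse d) (cscale c ?P)"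
            unfolding d_def y c ..
          then have "y = cscale (inverse d * c) ?P"
            using ne by (simp add: d_def)
          then show ?thesis using 4 by (auto simp: y_def D_def)
        qed
      qed
      then obtain c where c: "\<And>R Q. R \<in> tableaux n \<Longrightarrow> Q \<in> tableaux n \<Longrightarrow>
          ?P * a * (projector R * adj_swap n * projector Q) * b * ?P = cscale (c R Q) ?P"
        by metis
      have "?P * (a * adj_swap n * b) * ?P = ?P * a * ((\<Sum>R\<in>tableaux n. projector R) * adj_swap n * (\<Sum>Q\<in>tableaux n. projector Q)) * b * ?P"
        by (simp add: sum_projector mult.assoc)
      also have "\<dots> = (\<Sum>R\<in>tableaux n. \<Sum>Q\<in>tableaux n. ?P * a * (projector R * adj_swap n * projector Q) * b * ?P)"
        by (simp only: sum_distrib_left sum_distrib_right) (rule sum.swap)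
      also have "\<dots> = (\<Sum>R\<in>tableaux n. \<Sum>Q\<in>tableaux n. cscale (c R Q) ?P)"
        by (intro sum.cong refl c)
      also have "\<dots> = cscale (\<Sum>R\<in>tableaux n. \<Sum>Q\<in>tableaux n. c R Q) ?P"
        by (simp only: cvec.scale_sum_left)
      finally show ?case by blast
    qed
  qed
qed

lemma level_Suc: "killed n \<Longrightarrow> level (Suc n)"
  by unfold_locales (rule projector_Suc_weight sum_projector_Suc projector_Suc_sandwich; assumption)+

end

text \<open>The identity at \<open>Suc n\<close> uses both \<open>killed n\<close> and the
  nonvanishing of blocks at \<open>Suc n\<close>, so \<open>level\<close> is raised before
  \<open>killed\<close>.\<close>

lemma level_and_killed: "level n \<and> killed n"
proof (induction n)
  case 0
  have T: "T = (\<lambda>_. 0)" if "standard_tableau 0 T" for T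
    using that tableaux_0 by (auto simp: tableaux_def)
  have "level 0"
  proof
    show "\<exists>c. projector T * a * projector T = cscale c (projector T)"
      if "standard_tableau 0 T" "a \<in> CS 0" for T a
      using T[OF that(1)] that(2) CS_le_1[of 0] by auto
  qed (simp_all add: tableaux_0)
  with killed_0 show ?case by blast
next
  case (Suc n)
  then have "level (Suc n)" by (blast intro: level.level_Suc)
  with Suc show ?case using level.killed_step by blast
qed

lemma level: "level n"
  using level_and_killed by blast

section \<open>Transport of modules\<close>

lemma linear_onD:
  assumes "linear_on M f"
  shows "u \<in> M \<Longrightarrow> v \<in> M \<Longrightarrow> f (u + v) = f u + f v" "v \<in> M \<Longrightarrow> f (cscale c v) = cscale c (f v)"
  using assms by (auto simp: linear_on_def)

lemma linear_on_0: "linear_on M f \<Longrightarrow> cvec.subspace M \<Longrightarrow> f 0 = 0"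
  using linear_onD(2)[of M f 0 0] by (simp add: cvec.subspace_0)

lemma linear_on_sum:
  assumes "linear_on M f" "cvec.subspace M" "\<And>i. i \<in> I \<Longrightarrow> g i \<in> M"
  shows "f (\<Sum>i\<in>I. g i) = (\<Sum>i\<in>I. f (g i))"
  using assms(3)
proof (induction I rule: infinite_finite_induct)
  case (insert x F)
  then show ?case
    using linear_onD(1)[OF assms(1), of "g x" "sum g F"] assms(2) by (simp add: cvec.subspace_sum)
qed (auto simp: linear_on_0[OF assms(1,2)])

text \<open>\<open>S_isomorphic\<close> does not say that its target is a module. Here only the
  source is assumed to be one and the target inherits the structure, which is also how an action is
  carried over to \<open>young_space\<close>.\<close>

locale module_iso =
  fixes k :: nat
    and \<rho> :: "nat perm \<Rightarrow> ('a \<Rightarrow>\<^sub>0 complex) \<Rightarrow> ('a \<Rightarrow>\<^sub>0 complex)" and M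
    and \<rho>' :: "nat perm \<Rightarrow> ('b \<Rightarrow>\<^sub>0 complex) \<Rightarrow> ('b \<Rightarrow>\<^sub>0 complex)" and M'
    and \<phi> :: "('a \<Rightarrow>\<^sub>0 complex) \<Rightarrow> ('b \<Rightarrow>\<^sub>0 complex)"
  assumes module: "S_module k \<rho> M"
    and bij: "bij_betw \<phi> M M'"
    and lin: "linear_on M \<phi>"
    and equivariant: "\<And>\<sigma> v. \<sigma> \<in> Sym k \<Longrightarrow> v \<in> M \<Longrightarrow> \<phi> (\<rho> \<sigma> v) = \<rho>' \<sigma> (\<phi> v)"
begin

lemma subspace: "cvec.subspace M" and closed: "\<sigma> \<in> Sym k \<Longrightarrow> v \<in> M \<Longrightarrow> \<rho> \<sigma> v \<in> M"
  using module by (auto simp: S_module_def)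

lemma image_module:
  assumes "N \<subseteq> M" "S_module k \<rho> N"
  shows "S_module k \<rho>' (\<phi> ` N)"
  unfolding S_module_def
proof (intro conjI ballI)
  have sub: "cvec.subspace N" and cl: "\<And>\<sigma> v. \<sigma> \<in> Sym k \<Longrightarrow> v \<in> N \<Longrightarrow> \<rho> \<sigma> v \<in> N"
    and linN: "\<And>\<sigma>. \<sigma> \<in> Sym k \<Longrightarrow> linear_on N (\<rho> \<sigma>)" and one: "\<And>v. v \<in> N \<Longrightarrow> \<rho> 1 v = v"
    and mult: "\<And>\<sigma> \<tau> v. \<sigma> \<in> Sym k \<Longrightarrow> \<tau> \<in> Sym k \<Longrightarrow> v \<in> N \<Longrightarrow> \<rho> (\<sigma> * \<tau>) v = \<rho> \<sigma> (\<rho> \<tau> v)"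
    using assms(2) by (auto simp: S_module_def)
  have NM: "v \<in> M" if "v \<in> N" for v using assms(1) that by blast
  have add: "\<phi> u + \<phi> v = \<phi> (u + v)" if "u \<in> N" "v \<in> N" for u v
    using linear_onD(1)[OF lin] NM that by simp
  have scale: "cscale c (\<phi> v) = \<phi> (cscale c v)" if "v \<in> N" for c v
    using linear_onD(2)[OF lin] NM that by simp
  have act: "\<rho>' \<sigma> (\<phi> v) = \<phi> (\<rho> \<sigma> v)" if "\<sigma> \<in> Sym k" "v \<in> N" for \<sigma> v
    using equivariant NM that by simp
  have addN: "u + v \<in> N" if "u \<in> N" "v \<in> N" for u v using cvec.subspace_add[OF sub] that .
  have scaleN: "cscale c v \<in> N" if "v \<in> N" for c v using cvec.subspace_scale[OF sub] that .
  show "cvec.subspace (\<phi> ` N)"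
  proof (rule cvec.subspaceI)
    show "0 \<in> \<phi> ` N"
      using linear_on_0[OF lin subspace] cvec.subspace_0[OF sub] by (metis imageI)
  qed (auto simp: add scale addN scaleN)
  show "\<rho>' \<sigma> ` \<phi> ` N \<subseteq> \<phi> ` N" if "\<sigma> \<in> Sym k" for \<sigma>
    using that by (auto simp: act cl)
  show "linear_on (\<phi> ` N) (\<rho>' \<sigma>)" if \<sigma>: "\<sigma> \<in> Sym k" for \<sigma>
    unfolding linear_on_def
    by (auto simp: add scale act \<sigma> addN scaleN cl linear_onD[OF linN[OF \<sigma>]])
  show "\<rho>' 1 v = v" if "v \<in> \<phi> ` N" for v
    using that by (auto simp: act one)
  show "\<rho>' (\<sigma> * \<tau>) v = \<rho>' \<sigma> (\<rho>' \<tau> v)" if "\<sigma> \<in> Sym k" "\<tau> \<in> Sym k" "v \<in> \<phi> ` N" for \<sigma> \<tau> v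
    using that Sym_mult[OF that(1,2)] by (auto simp: act mult cl)
qed

lemma module': "S_module k \<rho>' M'"
  using image_module[OF subset_refl module] bij by (simp add: bij_betw_def)

lemma inverse_iso: "module_iso k \<rho>' M' \<rho> M (inv_into M \<phi>)"
proof
  let ?\<psi> = "inv_into M \<phi>"
  have \<psi>: "?\<psi> (\<phi> v) = v" if "v \<in> M" for v using bij that by (simp add: bij_betw_inv_into_left)
  have ex: "\<exists>v\<in>M. y = \<phi> v" if "y \<in> M'" for y using bij that by (auto simp: bij_betw_def)
  show "S_module k \<rho>' M'" by (rule module')
  show "bij_betw ?\<psi> M' M" by (rule bij_betw_inv_into[OF bij])
  show "linear_on M' ?\<psi>"
    unfolding linear_on_def
  proof (intro conjI ballI allI)
    fix x y assume "x \<in> M'" "y \<in> M'"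
    then obtain u v where uv: "u \<in> M" "v \<in> M" "x = \<phi> u" "y = \<phi> v" using ex by metis
    then show "?\<psi> (x + y) = ?\<psi> x + ?\<psi> y"
      using linear_onD(1)[OF lin uv(1,2)] \<psi>[of "u + v"] cvec.subspace_add[OF subspace uv(1,2)] \<psi> by simp
  next
    fix c y assume "y \<in> M'"
    then obtain v where v: "v \<in> M" "y = \<phi> v" using ex by metis
    then show "?\<psi> (cscale c y) = cscale c (?\<psi> y)"
      using linear_onD(2)[OF lin v(1)] \<psi>[of "cscale c v"] cvec.subspace_scale[OF subspace v(1)] \<psi> by simp
  qed
  show "?\<psi> (\<rho>' \<sigma> y) = \<rho> \<sigma> (?\<psi> y)" if \<sigma>: "\<sigma> \<in> Sym k" and y: "y \<in> M'" for \<sigma> y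
  proof -
    obtain v where v: "v \<in> M" "y = \<phi> v" using ex[OF y] by blast
    then have "\<rho>' \<sigma> y = \<phi> (\<rho> \<sigma> v)" using equivariant \<sigma> by simp
    then show ?thesis using \<psi> v closed[OF \<sigma> v(1)] by simp
  qed
qed

lemma irreducible':
  assumes "irreducible_S_module k \<rho> M"
  shows "irreducible_S_module k \<rho>' M'"
  unfolding irreducible_S_module_def
proof (intro conjI allI impI)
  interpret inv: module_iso k \<rho>' M' \<rho> M "inv_into M \<phi>" by (rule inverse_iso)
  have \<phi>0: "\<phi> 0 = 0" by (rule linear_on_0[OF lin subspace])
  have M': "M' = \<phi> ` M" using bij by (simp add: bij_betw_def)
  show "S_module k \<rho>' M'" by (rule module')
  show "M' \<noteq> {0}"
  proof
    assume "M' = {0}"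
    then have "M = inv_into M \<phi> ` {0}" using inv.bij by (simp add: bij_betw_def)
    moreover have "inv_into M \<phi> 0 = 0" by (rule linear_on_0[OF inv.lin inv.subspace])
    ultimately show False using assms by (simp add: irreducible_S_module_def)
  qed
  fix N assume N: "N \<subseteq> M' \<and> S_module k \<rho>' N"
  have "inv_into M \<phi> ` N \<subseteq> M" "S_module k \<rho> (inv_into M \<phi> ` N)"
    using N inv.bij inv.image_module[of N] by (auto simp: bij_betw_def)
  then have "inv_into M \<phi> ` N = {0} \<or> inv_into M \<phi> ` N = M"
    using assms unfolding irreducible_S_module_def by blast
  moreover have "\<phi> ` inv_into M \<phi> ` N = N"
    using N bij_betw_inv_into_right[OF bij] by (force simp: image_image)
  ultimately show "N = {0} \<or> N = M'" using \<phi>0 M' by (metis image_empty image_insert)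
qed

lemma isomorphic: "S_isomorphic k \<rho> M \<rho>' M'"
  using bij lin equivariant unfolding S_isomorphic_def by blast

end

lemma has_type_transport:
  assumes "module_iso (card \<mu>) \<rho> M \<rho>' M' \<phi>" and "has_type \<mu> \<rho>' M'"
  shows "has_type \<mu> \<rho> M"
proof -
  interpret module_iso "card \<mu>" \<rho> M \<rho>' M' \<phi> by fact
  obtain \<rho>'' where \<rho>'': "young_module \<mu> \<rho>''" "S_isomorphic (card \<mu>) \<rho>' M' \<rho>'' (young_space \<mu>)"
    using assms(2) by (auto simp: has_type_def)
  then obtain \<psi> where \<psi>: "bij_betw \<psi> M' (young_space \<mu>)" "linear_on M' \<psi>"
    "\<And>\<sigma> v. \<sigma> \<in> Sym (card \<mu>) \<Longrightarrow> v \<in> M' \<Longrightarrow> \<psi> (\<rho>' \<sigma> v) = \<rho>'' \<sigma> (\<psi> v)"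
    by (auto simp: S_isomorphic_def)
  have M': "\<phi> v \<in> M'" if "v \<in> M" for v using bij that by (auto simp: bij_betw_def)
  have "bij_betw (\<psi> \<circ> \<phi>) M (young_space \<mu>)" by (rule bij_betw_trans[OF bij \<psi>(1)])
  moreover have "linear_on M (\<psi> \<circ> \<phi>)"
    unfolding linear_on_def by (simp add: linear_onD[OF lin] linear_onD[OF \<psi>(2)] M')
  moreover have "\<forall>\<sigma>\<in>Sym (card \<mu>). \<forall>v\<in>M. (\<psi> \<circ> \<phi>) (\<rho> \<sigma> v) = \<rho>'' \<sigma> ((\<psi> \<circ> \<phi>) v)"
    by (simp add: equivariant \<psi>(3) M')
  ultimately show ?thesis
    using \<rho>''(1) unfolding has_type_def S_isomorphic_def by blast
qed

section \<open>Gelfand--Tsetlin modules\<close>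

lemma S_module_left_act_iff:
  "S_module n left_act M \<longleftrightarrow> cvec.subspace M \<and> (\<forall>a\<in>CS n. \<forall>v\<in>M. a * v \<in> M)"
proof
  assume M: "S_module n left_act M"
  then have sub: "cvec.subspace M" and cl: "\<And>\<sigma> v. \<sigma> \<in> Sym n \<Longrightarrow> v \<in> M \<Longrightarrow> gelem \<sigma> * v \<in> M"
    by (auto simp: S_module_def left_act_def)
  have "a * v \<in> M" if "a \<in> CS n" "v \<in> M" for a v
    using that(1)
  proof (induction rule: CS_induct)
    case zero
    then show ?case using sub by (simp add: cvec.subspace_0)
  next
    case (gelem c \<sigma>)
    then show ?case using cl[OF _ that(2)] sub by (simp add: cvec.subspace_scale)
  next
    case (add a b)
    then show ?case using sub by (simp add: distrib_right cvec.subspace_add)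
  qed
  with sub show "cvec.subspace M \<and> (\<forall>a\<in>CS n. \<forall>v\<in>M. a * v \<in> M)" by blast
next
  assume "cvec.subspace M \<and> (\<forall>a\<in>CS n. \<forall>v\<in>M. a * v \<in> M)"
  then show "S_module n left_act M"
    by (auto simp: S_module_def left_act_def linear_on_def gelem_mult distrib_left mult.assoc)
qed

definition left_ideal :: "nat \<Rightarrow> tableau \<Rightarrow> galg set" where
  "left_ideal n T = {a * projector T | a. a \<in> CS n}"

lemma keys_young_space: "y \<in> young_space \<mu> \<Longrightarrow> Poly_Mapping.keys y \<subseteq> SYT \<mu>"
proof -
  have "young_vec ` SYT \<mu> \<subseteq> {v. Poly_Mapping.keys v \<subseteq> SYT \<mu>}"
    by (auto simp: young_vec_def)
  then have "young_space \<mu> \<subseteq> {v. Poly_Mapping.keys v \<subseteq> SYT \<mu>}"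
    unfolding young_space_def by (rule cvec.span_minimal[OF _ subspace_keys])
  then show "y \<in> young_space \<mu> \<Longrightarrow> Poly_Mapping.keys y \<subseteq> SYT \<mu>" by blast
qed

context level
begin

lemma left_ideal_subspace: "cvec.subspace (left_ideal n T)"
proof (rule cvec.subspaceI)
  show "0 \<in> left_ideal n T" unfolding left_ideal_def by (auto intro!: exI[of _ 0])
  show "x + y \<in> left_ideal n T" if "x \<in> left_ideal n T" "y \<in> left_ideal n T" for x y
    using that unfolding left_ideal_def by (auto simp flip: distrib_right)
  show "cscale c x \<in> left_ideal n T" if "x \<in> left_ideal n T" for c x
    using that unfolding left_ideal_def by (auto simp flip: cscale_mult_left)
qed

lemma left_ideal_iff:
  assumes T: "standard_tableau n T"
  shows "v \<in> left_ideal n T \<longleftrightarrow> v \<in> CS n \<and> v * projector T = v"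
  unfolding left_ideal_def
proof safe
  fix a assume "a \<in> CS n"
  then show "a * projector T \<in> CS n" using projector_in_CS[OF T] by auto
  show "a * projector T * projector T = a * projector T" by (simp add: mult.assoc projector_idem[OF T])
next
  assume "v \<in> CS n" "v * projector T = v"
  then show "\<exists>a. v = a * projector T \<and> a \<in> CS n" by metis
qed

lemma left_ideal_weight_space:
  assumes T: "standard_tableau n T"
  shows "left_ideal n T = {v \<in> CS n. \<forall>i\<in>{1..n}. v * JM i = cscale (weight T i) v}"
proof (intro equalityI subsetI)
  fix v assume "v \<in> left_ideal n T"
  then have v: "v \<in> CS n" "v * projector T = v" using left_ideal_iff[OF T] by auto
  have "v * JM i = cscale (weight T i) v" if "i \<in> {1..n}" for i
    using projector_weight[OF T that] v(2) by (metis cscale_mult_right mult.assoc)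
  with v(1) show "v \<in> {v \<in> CS n. \<forall>i\<in>{1..n}. v * JM i = cscale (weight T i) v}" by blast
next
  fix v assume v: "v \<in> {v \<in> CS n. \<forall>i\<in>{1..n}. v * JM i = cscale (weight T i) v}"
  then have "v * projector T = v" using right_weight_mult_projector[OF T T, of v] by simp
  then show "v \<in> left_ideal n T" using v left_ideal_iff[OF T] by blast
qed

lemma left_ideal_module:
  "standard_tableau n T \<Longrightarrow> S_module n left_act (left_ideal n T)"
  unfolding S_module_left_act_iff
  using left_ideal_subspace left_ideal_iff by (auto simp: mult.assoc)

text \<open>A nonzero \<open>v\<close> in a submodule has a nonzero component
  \<open>u = projector S * v\<close>, and \<open>star u * u\<close> is a nonzero multiple of the
  generator \<open>projector T\<close>.\<close>

lemma left_ideal_irreducible: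
  assumes T: "standard_tableau n T"
  shows "irreducible_S_module n left_act (left_ideal n T)"
  unfolding irreducible_S_module_def
proof (intro conjI allI impI)
  show "S_module n left_act (left_ideal n T)" by (rule left_ideal_module[OF T])
  obtain a where a: "a \<in> CS n" "projector T * a * projector T \<noteq> 0"
    using block_nonzero[OF T T refl] .
  then have "projector T \<noteq> 0" by auto
  moreover have "projector T \<in> left_ideal n T"
    using left_ideal_iff[OF T] projector_in_CS[OF T] projector_idem[OF T] by blast
  ultimately show "left_ideal n T \<noteq> {0}" by blast
  fix N assume N: "N \<subseteq> left_ideal n T \<and> S_module n left_act N"
  then have sub: "cvec.subspace N" and cl: "\<And>a v. a \<in> CS n \<Longrightarrow> v \<in> N \<Longrightarrow> a * v \<in> N"
    by (auto simp: S_module_left_act_iff)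
  show "N = {0} \<or> N = left_ideal n T"
  proof (rule disjCI)
    assume ne: "N \<noteq> left_ideal n T"
    have "v = 0" if v: "v \<in> N" for v
    proof (rule ccontr)
      assume "v \<noteq> 0"
      then obtain S where S: "S \<in> tableaux n" "projector S * v \<noteq> 0"
        using expand_left[of v] by (metis sum.neutral)
      have S': "standard_tableau n S" using S by (simp add: tableaux_def)
      have vC: "v \<in> CS n" "v * projector T = v"
        using v N left_ideal_iff[OF T] by auto
      define u where "u = projector S * v * projector T"
      have u: "u = projector S * v" by (simp add: u_def mult.assoc vC)
      obtain c where c: "c \<noteq> 0" "star u * u = cscale c (projector T)"
        using block_star_nonzero[OF S' T vC(1) u_def] S(2) u by auto
      have uC: "u \<in> CS n" using vC projector_in_CS[OF S'] u by auto
      have "u \<in> N" unfolding u by (rule cl[OF projector_in_CS[OF S'] v])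
      then have "star u * u \<in> N" using uC by (intro cl) auto
      then have "cscale (inverse c) (star u * u) \<in> N" by (rule cvec.subspace_scale[OF sub])
      then have "projector T \<in> N" using c by simp
      then have "left_ideal n T \<subseteq> N" using cl by (auto simp: left_ideal_def)
      with N ne show False by blast
    qed
    then show "N = {0}" using cvec.subspace_0[OF sub] by blast
  qed
qed

text \<open>A nonzero \<open>u S\<close> chosen in the block of \<open>S\<close> and
  \<open>T\<close> for each \<open>S\<close> of the shape gives a basis of left weight vectors of
  the ideal. Matching \<open>young_vec S\<close> with \<open>u S\<close> and carrying the action
  over constructs the module that \<open>young_module\<close> asks for.\<close>

lemma left_ideal_has_type:
  assumes T: "standard_tableau n T"
  shows "has_type (shape T) left_act (left_ideal n T)"
proof -
  let ?\<mu> = "shape T" and ?W = "left_ideal n T"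
  have card: "card ?\<mu> = n" by (rule standard_tableau_shape(3)[OF T])
  have SYT: "S \<in> SYT ?\<mu> \<longleftrightarrow> S \<in> tableaux n \<and> shape S = ?\<mu>" for S
    by (auto simp: SYT_def tableaux_def card)
  have "\<forall>S\<in>SYT ?\<mu>. \<exists>a. a \<in> CS n \<and> projector S * a * projector T \<noteq> 0"
    using block_nonzero[OF _ T] SYT by (metis mem_Collect_eq tableaux_def)
  then obtain f where f: "\<And>S. S \<in> SYT ?\<mu> \<Longrightarrow> f S \<in> CS n \<and> projector S * f S * projector T \<noteq> 0"
    by metis
  define u where "u S = projector S * f S * projector T" for S
  define \<Psi> where "\<Psi> y = (\<Sum>S\<in>SYT ?\<mu>. cscale (Poly_Mapping.lookup y S) (u S))" for y :: "tableau \<Rightarrow>\<^sub>0 complex"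
  have uW: "u S \<in> ?W" if "S \<in> SYT ?\<mu>" for S
    unfolding left_ideal_def u_def
    using f[OF that] projector_in_CS that SYT by (auto simp: tableaux_def)
  have \<Psi>W: "\<Psi> y \<in> ?W" for y
    unfolding \<Psi>_def using uW left_ideal_subspace
    by (auto intro!: cvec.subspace_sum cvec.subspace_scale)
  have \<Psi>_add: "\<Psi> (x + y) = \<Psi> x + \<Psi> y" for x y
    by (simp add: \<Psi>_def lookup_add cvec.scale_left_distrib sum.distrib)
  have \<Psi>_scale: "\<Psi> (cscale c y) = cscale c (\<Psi> y)" for c y
    by (simp add: \<Psi>_def lookup_cscale cvec.scale_sum_right)
  have \<Psi>_young: "\<Psi> (young_vec S) = u S" if "S \<in> SYT ?\<mu>" for S
  proof -
    have "\<Psi> (young_vec S) = (\<Sum>R\<in>SYT ?\<mu>. if R = S then u R else 0)"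
      unfolding \<Psi>_def by (rule sum.cong) (auto simp: young_vec_def lookup_single when_def)
    then show ?thesis using that by simp
  qed
  have proj_u: "projector S * u R = (if R = S then u S else 0)" if "S \<in> SYT ?\<mu>" "R \<in> SYT ?\<mu>" for S R
    using projector_orthogonal[of S R] that SYT by (auto simp: u_def tableaux_def simp flip: mult.assoc)
  \<comment> \<open>Multiplication by \<open>projector S\<close> reads off the coordinate at
    \<open>S\<close>, which gives injectivity.\<close>
  have proj_\<Psi>: "projector S * \<Psi> y = cscale (Poly_Mapping.lookup y S) (u S)" if "S \<in> SYT ?\<mu>" for S y
  proof -
    have "projector S * \<Psi> y = (\<Sum>R\<in>SYT ?\<mu>. if R = S then cscale (Poly_Mapping.lookup y R) (u R) else 0)"
      unfolding \<Psi>_def sum_distrib_left by (rule sum.cong) (use that in \<open>auto simp: proj_u\<close>)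
    then show ?thesis using that by simp
  qed
  have sub_young: "cvec.subspace (young_space ?\<mu>)"
    by (simp add: young_space_def cvec.subspace_span)
  have young_in: "young_vec S \<in> young_space ?\<mu>" if "S \<in> SYT ?\<mu>" for S
    using that by (auto simp: young_space_def intro: cvec.span_base)
  have inj: "inj_on \<Psi> (young_space ?\<mu>)"
  proof (rule inj_onI)
    fix x y assume xy: "x \<in> young_space ?\<mu>" "y \<in> young_space ?\<mu>" "\<Psi> x = \<Psi> y"
    show "x = y"
    proof (rule poly_mapping_eqI)
      fix S
      show "Poly_Mapping.lookup x S = Poly_Mapping.lookup y S"
      proof (cases "S \<in> SYT ?\<mu>")
        case True
        have "cscale (Poly_Mapping.lookup x S) (u S) = cscale (Poly_Mapping.lookup y S) (u S)"
          by (metis proj_\<Psi>[OF True] xy(3))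
        moreover have "u S \<noteq> 0" using f[OF True] by (simp add: u_def)
        ultimately show ?thesis by (simp only: cvec.scale_cancel_right) simp
      next
        case False
        then show ?thesis
          using keys_young_space[OF xy(1)] keys_young_space[OF xy(2)] by (metis in_keys_iff subsetD)
      qed
    qed
  qed
  have surj: "?W \<subseteq> \<Psi> ` young_space ?\<mu>"
  proof
    fix v assume v: "v \<in> ?W"
    then have vC: "v \<in> CS n" "v * projector T = v" using left_ideal_iff[OF T] by auto
    have "\<exists>c. projector S * v = cscale c (u S)" if S: "S \<in> SYT ?\<mu>" for S
    proof -
      have "projector S * f S * projector T \<noteq> 0" "f S \<in> CS n" "standard_tableau n S"
        using f[OF S] S SYT by (auto simp: tableaux_def)
      from block_one_dimensional[OF this(3) T this(2) vC(1) this(1)]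
      obtain c where "projector S * v * projector T = cscale c (projector S * f S * projector T)" .
      then show ?thesis using vC(2) by (auto simp: u_def mult.assoc)
    qed
    then obtain c where c: "\<And>S. S \<in> SYT ?\<mu> \<Longrightarrow> projector S * v = cscale (c S) (u S)" by metis
    have "v = (\<Sum>S\<in>tableaux n. projector S * v)" by (rule expand_left)
    also have "\<dots> = (\<Sum>S\<in>SYT ?\<mu>. projector S * v)"
    proof (rule sum.mono_neutral_right)
      show "\<forall>S\<in>tableaux n - SYT ?\<mu>. projector S * v = 0"
      proof
        fix S assume S: "S \<in> tableaux n - SYT ?\<mu>"
        have "projector S * v * projector T = 0"
          by (rule block_eq_0[OF _ T vC(1)]) (use S SYT in \<open>auto simp: tableaux_def\<close>)
        then show "projector S * v = 0" by (simp add: mult.assoc vC(2))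
      qed
    qed (use SYT in auto)
    also have "\<dots> = (\<Sum>S\<in>SYT ?\<mu>. cscale (c S) (u S))" by (simp add: c)
    also have "\<dots> = \<Psi> (\<Sum>S\<in>SYT ?\<mu>. cscale (c S) (young_vec S))"
    proof -
      have "\<Psi> (\<Sum>S\<in>A. cscale (c S) (young_vec S)) = (\<Sum>S\<in>A. cscale (c S) (u S))"
        if "finite A" "A \<subseteq> SYT ?\<mu>" for A
        using that by (induction A) (auto simp: \<Psi>_add \<Psi>_scale \<Psi>_young, simp add: \<Psi>_def)
      then show ?thesis by simp
    qed
    finally show "v \<in> \<Psi> ` young_space ?\<mu>"
      using sub_young young_in by (auto intro!: imageI cvec.subspace_sum cvec.subspace_scale)
  qed
  define \<phi> where "\<phi> = inv_into (young_space ?\<mu>) \<Psi>"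
  define \<rho> where "\<rho> \<sigma> y = \<phi> (left_act \<sigma> (\<Psi> y))" for \<sigma> y
  have bij: "bij_betw \<Psi> (young_space ?\<mu>) ?W"
    using inj surj \<Psi>W by (auto simp: bij_betw_def)
  have \<phi>\<Psi>: "\<phi> (\<Psi> y) = y" if "y \<in> young_space ?\<mu>" for y
    using bij_betw_inv_into_left[OF bij that] by (simp add: \<phi>_def)
  have \<Psi>\<phi>: "\<Psi> (\<phi> v) = v" "\<phi> v \<in> young_space ?\<mu>" if "v \<in> ?W" for v
    using bij_betw_inv_into_right[OF bij that] bij_betwE[OF bij_betw_inv_into[OF bij]] that
    by (auto simp: \<phi>_def)
  have lin: "linear_on ?W \<phi>"
    unfolding linear_on_def
  proof (intro conjI ballI allI)
    fix x y assume "x \<in> ?W" "y \<in> ?W"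
    then show "\<phi> (x + y) = \<phi> x + \<phi> y"
      using \<phi>\<Psi>[of "\<phi> x + \<phi> y"] \<Psi>\<phi> cvec.subspace_add[OF sub_young] by (simp add: \<Psi>_add)
  next
    fix c x assume "x \<in> ?W"
    then show "\<phi> (cscale c x) = cscale c (\<phi> x)"
      using \<phi>\<Psi>[of "cscale c (\<phi> x)"] \<Psi>\<phi> cvec.subspace_scale[OF sub_young] by (simp add: \<Psi>_scale)
  qed
  interpret iso: module_iso n left_act ?W \<rho> "young_space ?\<mu>" \<phi>
  proof
    show "bij_betw \<phi> ?W (young_space ?\<mu>)" unfolding \<phi>_def by (rule bij_betw_inv_into[OF bij])
  qed (use left_ideal_module[OF T] lin \<Psi>\<phi> in \<open>auto simp: \<rho>_def\<close>)
  have "(\<Sum>j\<in>{1..<i}. \<rho> (Perm.swap j i) (young_vec S)) = cscale (weight S i) (young_vec S)"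
    if S: "S \<in> SYT ?\<mu>" and i: "i \<in> {1..n}" for S i
  proof -
    have "gelem (Perm.swap j i) * u S \<in> ?W" if "j \<in> {1..<i}" for j
      using iso.closed[of "Perm.swap j i" "u S"] uW[OF S] that i by (auto simp: left_act_def swap_in_Sym)
    then have "(\<Sum>j\<in>{1..<i}. \<rho> (Perm.swap j i) (young_vec S)) = \<phi> (JM i * u S)"
      using linear_on_sum[OF lin left_ideal_subspace, of "{1..<i}" "\<lambda>j. gelem (Perm.swap j i) * u S"]
      by (simp add: \<rho>_def left_act_def \<Psi>_young[OF S] JM_def sum_distrib_right)
    also have "JM i * u S = cscale (weight S i) (u S)"
      using JM_projector[of S i] S i SYT by (simp add: u_def tableaux_def flip: mult.assoc)
    also have "\<phi> \<dots> = cscale (weight S i) (\<phi> (u S))" by (rule linear_onD(2)[OF lin uW[OF S]])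
    also have "\<phi> (u S) = young_vec S" using \<phi>\<Psi>[OF young_in[OF S]] \<Psi>_young[OF S] by simp
    finally show ?thesis .
  qed
  then have "young_module ?\<mu> \<rho>"
    using iso.irreducible'[OF left_ideal_irreducible[OF T]] by (simp add: young_module_def card)
  then show ?thesis
    using iso.isomorphic unfolding has_type_def card by blast
qed

text \<open>This is all that the uniqueness argument uses of the type: the preimage of
  \<open>young_vec T\<close> under the isomorphism has the weight of \<open>T\<close> from the
  left.\<close>

lemma has_type_weight_vector:
  assumes T: "standard_tableau n T" and W: "S_module n left_act W" and type: "has_type (shape T) left_act W"
  obtains v where "v \<in> W" "v \<noteq> 0" "\<And>i. i \<in> {1..n} \<Longrightarrow> JM i * v = cscale (weight T i) v"
proof -
  let ?\<mu> = "shape T"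
  have card: "card ?\<mu> = n" by (rule standard_tableau_shape(3)[OF T])
  obtain \<rho> \<phi> where \<rho>: "young_module ?\<mu> \<rho>" and bij: "bij_betw \<phi> W (young_space ?\<mu>)" and lin: "linear_on W \<phi>"
    and eq: "\<And>\<sigma> v. \<sigma> \<in> Sym n \<Longrightarrow> v \<in> W \<Longrightarrow> \<phi> (left_act \<sigma> v) = \<rho> \<sigma> (\<phi> v)"
    using type unfolding has_type_def S_isomorphic_def card by blast
  have TS: "T \<in> SYT ?\<mu>" using T by (simp add: SYT_def card)
  then have "young_vec T \<in> young_space ?\<mu>" by (auto simp: young_space_def intro: cvec.span_base)
  then obtain v where v: "v \<in> W" "\<phi> v = young_vec T"
    using bij_betw_imp_surj_on[OF bij] by (metis imageE)
  have sub: "cvec.subspace W" and cl: "\<And>a v. a \<in> CS n \<Longrightarrow> v \<in> W \<Longrightarrow> a * v \<in> W"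
    using W by (auto simp: S_module_left_act_iff)
  have "Poly_Mapping.lookup (young_vec T) T = 1" by (simp add: young_vec_def)
  then have "young_vec T \<noteq> 0" by (metis lookup_zero zero_neq_one)
  then have "v \<noteq> 0"
    using v linear_on_0[OF lin sub] by metis
  moreover have "JM i * v = cscale (weight T i) v" if i: "i \<in> {1..n}" for i
  proof -
    have sw: "Perm.swap j i \<in> Sym n" if "j \<in> {1..<i}" for j using that i by (auto intro!: swap_in_Sym)
    have "\<phi> (JM i * v) = (\<Sum>j\<in>{1..<i}. \<phi> (gelem (Perm.swap j i) * v))"
      unfolding JM_def sum_distrib_right
      by (rule linear_on_sum[OF lin sub]) (use sw cl[OF _ v(1)] in auto)
    also have "\<dots> = (\<Sum>j\<in>{1..<i}. \<rho> (Perm.swap j i) (young_vec T))"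
      by (rule sum.cong) (use eq[OF sw v(1)] v(2) in \<open>auto simp: left_act_def\<close>)
    also have "\<dots> = cscale (weight T i) (young_vec T)"
      using \<rho> TS i by (simp add: young_module_def card)
    also have "\<dots> = \<phi> (cscale (weight T i) v)"
      using linear_onD(2)[OF lin v(1)] v(2) by simp
    finally show ?thesis
      using bij cl[OF JM_in_CS v(1), of i] cvec.subspace_scale[OF sub v(1)] i
      by (auto simp: bij_betw_def inj_on_def)
  qed
  ultimately show thesis using that v(1) by blast
qed

end

section \<open>Induction paths\<close>

text \<open>The factors commute, so \<open>projector T\<close> is a left multiple of the projector
  of the subtableau.\<close>

lemma left_ideal_subset_induced:
  assumes T: "standard_tableau (Suc n) T"
  shows "left_ideal (Suc n) T \<subseteq> left_induced (Suc n) (left_ideal n (subtableau T n))"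
proof
  let ?T = "subtableau T n"
  fix v assume "v \<in> left_ideal (Suc n) T"
  then obtain a where a: "a \<in> CS (Suc n)" "v = a * projector T" by (auto simp: left_ideal_def)
  define q where "q = poly_at (lagrange (shape ?T) (box_of T (Suc n))) (JM (Suc n))"
  have "v = (a * q) * projector ?T"
    by (simp add: a(2) projector_lagrange(2)[OF T] q_def mult.assoc)
  moreover have "a * q \<in> CS (Suc n)"
    unfolding q_def using a(1) by (auto intro!: JM_in_CS)
  moreover have "projector ?T \<in> left_ideal n ?T"
    unfolding left_ideal_def by (auto intro!: exI[of _ 1])
  ultimately show "v \<in> left_induced (Suc n) (left_ideal n ?T)"
    unfolding left_induced_def by (blast intro: cvec.span_base)
qed

lemma left_induced_fixed:
  assumes T: "standard_tableau (Suc n) T"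
    and v: "v \<in> left_induced (Suc n) (left_ideal n (subtableau T n))"
  shows "v \<in> CS (Suc n)" "v * projector (subtableau T n) = v"
proof -
  let ?T = "subtableau T n"
  interpret level n by (rule level)
  have st: "standard_tableau n ?T" by (rule standard_tableau_subtableau[OF T]) simp
  let ?F = "{v \<in> CS (Suc n). v * projector ?T = v}"
  have "left_induced (Suc n) (left_ideal n ?T) \<subseteq> ?F"
    unfolding left_induced_def
  proof (rule cvec.span_minimal)
    show "{a * v |a v. a \<in> CS (Suc n) \<and> v \<in> left_ideal n ?T} \<subseteq> ?F"
      using left_ideal_iff[OF st] CS_mono'[of _ n "Suc n"] by (auto simp: mult.assoc)
    show "cvec.subspace ?F"
      by (rule cvec.subspaceI) (auto simp: distrib_right)
  qed
  then show "v \<in> CS (Suc n)" "v * projector ?T = v" using v by auto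
qed

text \<open>The weight vector \<open>v\<close> is fixed by \<open>projector T\<close> from the left,
  so on its right only tableaux of the shape of \<open>T\<close> can occur; it is fixed by the
  projector of \<open>subtableau T n\<close> from the right, so only tableaux extending that one
  can. This leaves \<open>T\<close> alone, and \<open>v\<close> lies in the left ideal.\<close>

lemma left_induced_unique:
  assumes T: "standard_tableau (Suc n) T"
    and W: "W \<subseteq> left_induced (Suc n) (left_ideal n (subtableau T n))"
      "irreducible_S_module (Suc n) left_act W" "has_type (shape T) left_act W"
  shows "W = left_ideal (Suc n) T"
proof -
  let ?T = "subtableau T n"
  interpret level "Suc n" by (rule level)
  have mod: "S_module (Suc n) left_act W" using W(2) by (simp add: irreducible_S_module_def)
  obtain v where v: "v \<in> W" "v \<noteq> 0" "\<And>i. i \<in> {1..Suc n} \<Longrightarrow> JM i * v = cscale (weight T i) v"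
    using has_type_weight_vector[OF T mod W(3)] by blast
  have Pv: "projector T * v = v" using left_weight_mult_projector[OF T T v(3)] by simp
  have vC: "v \<in> CS (Suc n)" "v * projector ?T = v"
    using left_induced_fixed[OF T] v(1) W(1) by auto
  have "v * projector S = 0" if S: "standard_tableau (Suc n) S" "S \<noteq> T" for S
  proof (cases "shape S = shape T")
    case True
    let ?S = "subtableau S n"
    have "?S \<noteq> ?T" using tableau_eq_by_shape[OF S(1) T True] S(2) by blast
    moreover have "standard_tableau n ?S" "standard_tableau n ?T"
      using standard_tableau_subtableau S(1) T by auto
    ultimately have "projector ?T * projector ?S = 0"
      using level.projector_orthogonal[OF level] by metis
    then have "v * projector ?S = 0" using vC(2) by (metis mult.assoc mult_zero_right)
    then show ?thesis by (simp add: projector_lagrange(1)[OF S(1)] flip: mult.assoc)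
  next
    case False
    then show ?thesis using block_eq_0[OF T S(1) vC(1)] Pv by simp
  qed
  then have "(\<Sum>S\<in>tableaux (Suc n). v * projector S) = (\<Sum>S\<in>{T}. v * projector S)"
    using T by (intro sum.mono_neutral_right finite_tableaux) (auto simp: tableaux_def)
  then have "v * projector T = v" using expand_right[of v] by simp
  then have "v \<in> left_ideal (Suc n) T" using vC(1) left_ideal_iff[OF T] by blast
  \<comment> \<open>Two irreducible modules sharing the nonzero vector \<open>v\<close> both
    coincide with their intersection.\<close>
  define N where "N = W \<inter> left_ideal (Suc n) T"
  have "S_module (Suc n) left_act N"
    using mod left_ideal_module[OF T]
    by (auto simp: N_def S_module_left_act_iff cvec.subspace_inter)
  moreover have "v \<in> N" using v(1) \<open>v \<in> left_ideal (Suc n) T\<close> by (simp add: N_def)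
  ultimately have "N = W" "N = left_ideal (Suc n) T"
    using W(2) left_ideal_irreducible[OF T] v(2) unfolding irreducible_S_module_def N_def by blast+
  then show ?thesis by simp
qed

text \<open>In the form of an equivalence with an equation, existence and uniqueness let the
  definite description in \<open>left_path\<close> be evaluated by rewriting.\<close>

lemma left_step_iff:
  assumes T: "standard_tableau (Suc n) T"
  shows "W \<subseteq> left_induced (Suc n) (left_ideal n (subtableau T n)) \<and>
      irreducible_S_module (Suc n) left_act W \<and> has_type (shape T) left_act W \<longleftrightarrow>
    W = left_ideal (Suc n) T"
proof -
  interpret level "Suc n" by (rule level)
  show ?thesis
    using left_ideal_subset_induced[OF T] left_ideal_irreducible[OF T] left_ideal_has_type[OF T]
      left_induced_unique[OF T] by blast
qed

lemma left_ideal_le_1: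
  assumes "standard_tableau k T" "k \<le> 1"
  shows "left_ideal k T = CS k"
proof -
  have "card (shape T) = k" using standard_tableau_shape(3)[OF assms(1)] .
  then have "projector T = 1" using assms(2) by (cases k) (simp_all add: projector_def)
  then show ?thesis by (simp add: left_ideal_def)
qed

lemma left_path_eq:
  assumes T: "standard_tableau n T"
  shows "k \<le> n \<Longrightarrow> left_path T k = left_ideal k (subtableau T k)"
proof (induction k rule: less_induct)
  case (less k)
  have st: "standard_tableau k (subtableau T k)"
    by (rule standard_tableau_subtableau[OF T less.prems])
  consider "k = 0" | "k = 1" | m where "k = Suc (Suc m)" by (metis One_nat_def not0_implies_Suc)
  then show ?case
  proof cases
    case 3
    have IH: "left_path T (Suc m) = left_ideal (Suc m) (subtableau T (Suc m))"
      by (rule less.IH) (use 3 less.prems in auto)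
    have sub: "subtableau (subtableau T k) (Suc m) = subtableau T (Suc m)"
      by (rule subtableau_subtableau) (use 3 in simp)
    show ?thesis
      using left_step_iff[of "Suc m" "subtableau T k"] st unfolding 3 left_path.simps IH sub[unfolded 3]
      by simp
  qed (use left_ideal_le_1[OF st] in simp_all)
qed

section \<open>Transfer to right modules by inversion of permutations\<close>

lemma flip_span: "flip ` cvec.span B = cvec.span (flip ` B)"
proof -
  interpret Vector_Spaces.linear cscale cscale flip
    by unfold_locales (simp_all add: flip.antiaut_add)
  show ?thesis by (rule span_image[symmetric])
qed

lemma flip_left_induced: "flip ` left_induced k V = right_induced k (flip ` V)"
proof -
  have "flip ` {a * v |a v. a \<in> CS k \<and> v \<in> V} = {v * a |a v. a \<in> CS k \<and> v \<in> flip ` V}" (is "?L = ?R")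
  proof
    show "?L \<subseteq> ?R"
      by (auto simp: flip.antiaut_mult) (metis flip.antiaut_in_CS imageI)
    show "?R \<subseteq> ?L"
    proof clarify
      fix a v assume "a \<in> CS k" "v \<in> V"
      then have "flip a * v \<in> {a * v |a v. a \<in> CS k \<and> v \<in> V}"
        using flip.antiaut_in_CS by blast
      then show "flip v * a \<in> ?L"
        by (rule image_eqI[rotated]) (simp add: flip.antiaut_mult)
    qed
  qed
  then show ?thesis by (simp add: left_induced_def right_induced_def flip_span)
qed

lemma flip_flip_image [simp]: "flip ` flip ` W = W"
  by (simp add: image_image)

text \<open>The inverse in \<open>right_act\<close> makes \<open>flip\<close> equivariant for the
  same \<open>\<sigma>\<close> on both sides.\<close>

lemma flip_act: "flip (left_act \<sigma> v) = right_act \<sigma> (flip v)" "flip (right_act \<sigma> v) = left_act \<sigma> (flip v)"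
  by (simp_all add: left_act_def right_act_def flip.antiaut_mult)

lemma flip_inj: "bij_betw flip W (flip ` W)"
  by (rule bij_betw_imageI) (auto intro!: inj_onI dest: arg_cong[of _ _ flip])

lemma flip_linear: "linear_on W flip"
  by (simp add: linear_on_def flip.antiaut_add)

lemma flip_iso:
  "S_module k left_act W \<Longrightarrow> module_iso k left_act W right_act (flip ` W) flip"
  "S_module k right_act W \<Longrightarrow> module_iso k right_act W left_act (flip ` W) flip"
  by unfold_locales (auto simp: flip_act flip_inj flip_linear)

lemma irreducible_flip:
  "irreducible_S_module k left_act W \<longleftrightarrow> irreducible_S_module k right_act (flip ` W)"
proof
  assume *: "irreducible_S_module k left_act W"
  then have "S_module k left_act W" by (simp add: irreducible_S_module_def)
  from module_iso.irreducible'[OF flip_iso(1)[OF this] *]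
  show "irreducible_S_module k right_act (flip ` W)" .
next
  assume *: "irreducible_S_module k right_act (flip ` W)"
  then have "S_module k right_act (flip ` W)" by (simp add: irreducible_S_module_def)
  from module_iso.irreducible'[OF flip_iso(2)[OF this] *]
  show "irreducible_S_module k left_act W" by simp
qed

lemma has_type_flip:
  assumes "S_module (card \<mu>) left_act W"
  shows "has_type \<mu> left_act W \<longleftrightarrow> has_type \<mu> right_act (flip ` W)"
proof
  assume "has_type \<mu> right_act (flip ` W)"
  then show "has_type \<mu> left_act W" by (rule has_type_transport[OF flip_iso(1)[OF assms]])
next
  have mod: "S_module (card \<mu>) right_act (flip ` W)"
    by (rule module_iso.module'[OF flip_iso(1)[OF assms]])
  assume "has_type \<mu> left_act W"
  then show "has_type \<mu> right_act (flip ` W)"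
    using has_type_transport[OF flip_iso(2)[OF mod]] by simp
qed


text \<open>The involution \<open>flip\<close> preserves inclusion, irreducibility and type and
  exchanges the two inductions, so this is the left statement for the image of
  \<open>W\<close>.\<close>

lemma right_step_iff:
  assumes T: "standard_tableau (Suc n) T"
  shows "W \<subseteq> right_induced (Suc n) (flip ` left_ideal n (subtableau T n)) \<and>
      irreducible_S_module (Suc n) right_act W \<and> has_type (shape T) right_act W \<longleftrightarrow>
    W = flip ` left_ideal (Suc n) T"
proof -
  have card: "card (shape T) = Suc n" by (rule standard_tableau_shape(3)[OF T])
  define V where "V = flip ` W"
  have W: "W = flip ` V" by (simp add: V_def)
  have sub: "flip ` A \<subseteq> flip ` B \<longleftrightarrow> A \<subseteq> B" for A B
    using flip_flip_image by (metis image_mono)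
  have eq: "flip ` A = flip ` B \<longleftrightarrow> A = B" for A B
    using flip_flip_image by metis
  have type: "has_type (shape T) left_act V \<longleftrightarrow> has_type (shape T) right_act (flip ` V)"
    if "irreducible_S_module (Suc n) left_act V"
    using has_type_flip[of "shape T" V] that by (simp add: card irreducible_S_module_def)
  show ?thesis
    unfolding W eq sub flip_left_induced[symmetric]
    using left_step_iff[OF T, of V] type irreducible_flip by metis
qed

lemma right_path_eq:
  assumes T: "standard_tableau n T"
  shows "k \<le> n \<Longrightarrow> right_path T k = flip ` left_ideal k (subtableau T k)"
proof (induction k rule: less_induct)
  case (less k)
  have st: "standard_tableau k (subtableau T k)"
    by (rule standard_tableau_subtableau[OF T less.prems])
  have flip_CS: "flip ` CS j = CS j" for j
    by (auto intro: image_eqI[of _ _ "flip _"])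
  consider "k = 0" | "k = 1" | m where "k = Suc (Suc m)" by (metis One_nat_def not0_implies_Suc)
  then show ?case
  proof cases
    case 3
    have IH: "right_path T (Suc m) = flip ` left_ideal (Suc m) (subtableau T (Suc m))"
      by (rule less.IH) (use 3 less.prems in auto)
    have sub: "subtableau (subtableau T k) (Suc m) = subtableau T (Suc m)"
      by (rule subtableau_subtableau) (use 3 in simp)
    show ?thesis
      using right_step_iff[of "Suc m" "subtableau T k"] st unfolding 3 right_path.simps IH sub[unfolded 3]
      by simp
  qed (use left_ideal_le_1[OF st] flip_CS in simp_all)
qed

section \<open>Identification of the two Gelfand-Tsetlin modules of a tableau\<close>

lemma left_GT_eq:
  assumes "standard_tableau n T"
  shows "left_GT T = left_ideal n T"
  using left_path_eq[OF assms order_refl] standard_tableau_shape(3)[OF assms] subtableau_self[OF assms]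
  by (simp add: left_GT_def)

context level
begin

lemma flip_left_ideal:
  assumes T: "standard_tableau n T"
  shows "flip ` left_ideal n T = {projector T * a | a. a \<in> CS n}"
proof
  show "flip ` left_ideal n T \<subseteq> {projector T * a | a. a \<in> CS n}"
    using T by (auto simp: left_ideal_def flip.antiaut_mult)
  show "{projector T * a | a. a \<in> CS n} \<subseteq> flip ` left_ideal n T"
  proof clarify
    fix a assume "a \<in> CS n"
    then show "projector T * a \<in> flip ` left_ideal n T"
      using T by (intro image_eqI[of _ _ "flip a * projector T"])
        (auto simp: left_ideal_def flip.antiaut_mult)
  qed
qed

lemma flip_left_ideal_weight_space:
  assumes T: "standard_tableau n T"
  shows "flip ` left_ideal n T = {v \<in> CS n. \<forall>i\<in>{1..n}. JM i * v = cscale (weight T i) v}"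
proof (intro equalityI subsetI)
  fix v assume "v \<in> flip ` left_ideal n T"
  then obtain a where a: "a \<in> CS n" "v = projector T * a" using flip_left_ideal[OF T] by auto
  then have "v \<in> CS n" using projector_in_CS[OF T] by auto
  moreover have "\<forall>i\<in>{1..n}. JM i * v = cscale (weight T i) v"
    using JM_projector[OF T] by (simp add: a(2) flip: mult.assoc)
  ultimately show "v \<in> {v \<in> CS n. \<forall>i\<in>{1..n}. JM i * v = cscale (weight T i) v}" by blast
next
  fix v assume v: "v \<in> {v \<in> CS n. \<forall>i\<in>{1..n}. JM i * v = cscale (weight T i) v}"
  then have "projector T * v = v" using left_weight_mult_projector[OF T T, of v] by simp
  with v show "v \<in> flip ` left_ideal n T"
    unfolding flip_left_ideal[OF T] by (metis (mono_tags, lifting) mem_Collect_eq)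
qed

text \<open>A nonzero element of the block of \<open>T\<close> and \<open>S\<close> meets the
  conditions of the choice in \<open>GT_vec T S\<close>, so the choice is not vacuous, and whatever
  is chosen lies in this block.\<close>

lemma GT_vec_block:
  assumes S: "standard_tableau n S" and T: "standard_tableau n T" and sh: "shape S = shape T"
  shows "GT_vec T S \<in> CS n" "projector T * GT_vec T S * projector S = GT_vec T S" "GT_vec T S \<noteq> 0"
proof -
  let ?Q = "\<lambda>v. v \<in> left_GT S \<and> v \<noteq> 0 \<and> (\<forall>i\<in>{1..card (shape S)}. JM i * v = cscale (weight T i) v)"
  have card: "card (shape S) = n" by (rule standard_tableau_shape(3)[OF S])
  obtain a where a: "a \<in> CS n" "projector T * a * projector S \<noteq> 0"
    using block_nonzero[OF T S sh[symmetric]] .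
  have "projector T * a * projector S \<in> left_ideal n S"
    unfolding left_ideal_def using a(1) projector_in_CS[OF T] by auto
  then have "?Q (projector T * a * projector S)"
    using a(2) left_GT_eq[OF S] JM_projector[OF T] by (simp add: card flip: mult.assoc)
  then have Q: "?Q (GT_vec T S)" unfolding GT_vec_def by (rule someI)
  then show "GT_vec T S \<in> CS n" "GT_vec T S \<noteq> 0"
    using left_ideal_iff[OF S] left_GT_eq[OF S] by auto
  have "GT_vec T S * projector S = GT_vec T S"
    using Q left_ideal_iff[OF S] left_GT_eq[OF S] by auto
  moreover have "projector T * GT_vec T S = GT_vec T S"
    using left_weight_mult_projector[OF T T, of "GT_vec T S"] Q card by simp
  ultimately show "projector T * GT_vec T S * projector S = GT_vec T S" by simp
qed

text \<open>The right ideal is the sum of the blocks of \<open>T\<close> and \<open>S\<close> over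
  the tableaux \<open>S\<close> of the same shape. Each is a line spanned by the chosen vector
  \<open>GT_vec T S\<close>, so the undetermined scalars do not affect the span.\<close>

lemma right_GT_eq:
  assumes T: "standard_tableau n T"
  shows "right_GT T = {projector T * a | a. a \<in> CS n}"
proof
  have SYT: "S \<in> SYT (shape T) \<longleftrightarrow> S \<in> tableaux n \<and> shape S = shape T" for S
    using standard_tableau_shape(3)[OF T] by (auto simp: SYT_def tableaux_def)
  \<comment> \<open>Closure under sums and multiples is read off from the description as a weight
    space.\<close>
  have sub: "cvec.subspace {projector T * a | a. a \<in> CS n}"
    unfolding flip_left_ideal_weight_space[OF T, unfolded flip_left_ideal[OF T]]
    by (rule cvec.subspaceI) (auto simp: distrib_left cvec.scale_right_distrib mult.commute)
  show "right_GT T \<subseteq> {projector T * a | a. a \<in> CS n}"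
    unfolding right_GT_def
  proof (rule cvec.span_minimal[OF _ sub], clarify)
    fix S assume "S \<in> SYT (shape T)"
    then have S: "standard_tableau n S" "shape S = shape T" using SYT by (auto simp: tableaux_def)
    note G = GT_vec_block[OF S(1) T S(2)]
    have "GT_vec T S = projector T * (GT_vec T S * projector S)" using G(2) by (simp add: mult.assoc)
    moreover have "GT_vec T S * projector S \<in> CS n" using G(1) projector_in_CS[OF S(1)] by auto
    ultimately show "\<exists>a. GT_vec T S = projector T * a \<and> a \<in> CS n" by blast
  qed
  show "{projector T * a | a. a \<in> CS n} \<subseteq> right_GT T"
  proof clarify
    fix a assume a: "a \<in> CS n"
    have "projector T * a * projector S \<in> right_GT T" if S: "S \<in> tableaux n" for S
    proof (cases "shape S = shape T")
      case True
      have S': "standard_tableau n S" using S by (simp add: tableaux_def)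
      note G = GT_vec_block[OF S' T True]
      have "projector T * GT_vec T S * projector S \<noteq> 0" using G by simp
      from block_one_dimensional[OF T S' G(1) a this] G(2)
      obtain c where c: "projector T * a * projector S = cscale c (GT_vec T S)" by metis
      show ?thesis
        unfolding c right_GT_def using S True SYT by (intro cvec.span_scale cvec.span_base) auto
    next
      case False
      then have "projector T * a * projector S = 0"
        using block_eq_0[OF T _ a] S by (auto simp: tableaux_def)
      then show ?thesis by (simp add: right_GT_def cvec.span_zero)
    qed
    then have "(\<Sum>S\<in>tableaux n. projector T * a * projector S) \<in> right_GT T"
      unfolding right_GT_def by (rule cvec.span_sum)
    then show "projector T * a \<in> right_GT T" using expand_right[of "projector T * a"] by simp
  qed
qed

end

theorem theorem2p2:
  fixes T :: tableau and n :: nat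
  assumes "standard_tableau n T"
  shows "(left_GT T = left_path T n \<and>
      left_GT T = {v \<in> CS n. \<forall>i\<in>{1..n}. v * JM i = cscale (of_int (cont (box_of T i))) v} \<and>
      left_GT T = {a * projector T | a. a \<in> CS n}) \<and>
    (right_GT T = right_path T n \<and>
      right_GT T = {v \<in> CS n. \<forall>i\<in>{1..n}. JM i * v = cscale (of_int (cont (box_of T i))) v} \<and>
      right_GT T = {projector T * a | a. a \<in> CS n})"
proof -
  interpret level n by (rule level)
  have self: "subtableau T n = T" by (rule subtableau_self[OF assms])
  have "left_path T n = left_ideal n T" "right_path T n = flip ` left_ideal n T"
    using left_path_eq[OF assms order_refl] right_path_eq[OF assms order_refl] by (simp_all add: self)
  then show ?thesis
    using left_GT_eq[OF assms] right_GT_eq[OF assms] left_ideal_weight_space[OF assms]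
      flip_left_ideal[OF assms] flip_left_ideal_weight_space[OF assms]
    unfolding left_ideal_def by simp
qed

end
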